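(* Let $f,g\in\mathbb{K}[x]$ be monic polynomials of degrees $m$ and $n$, with multisets of roots $A,B\subset\mathbb{K}$ respectively (so $f=\prod_{a\in A}(x-a)$, $g=\prod_{b\in B}(x-b)$, products with multiplicity). Let $\overline A$ and $\overline B$ be subsets of the sets of distinct roots of $f$ and $g$, respectively, and set $m':=m-|\overline A|$ and $n':=n-|\overline B|$. Then for $0\le d\le\min\{m,n\}$ if $m\ne n$, or $0\le d<m=n$, we have $$\operatorname{Sres}_d(f,g)(x)=(-1)^{d(m-d)}\operatorname{SylM}_d(A,B)(x).$$
   Context: $\mathbb{K}$ is a field. For a multiset $X$, $|X|$ is the number of elements counted with multiplicity; for multisets $X'\subset X$, $X\backslash X'$ is the multiset difference; unions of multisets appearing as arguments of $S_k^{(R)}$ below add multiplicities. For multisets $X,Y$, $\mathcal{R}(X,Y):=\prod_{x\in X,\,y\in Y}(x-y)$ (with multiplicities), equal to $1$ if $X$ or $Y$ is empty; $\mathcal{R}(x,Y):=\mathcal{R}(\{x\},Y)$. Subresultant: for $f=f_mx^m+\cdots+f_0$ and $g=g_nx^n+\cdots+g_0$, and $0\le d\le\min\{m,n\}$ if $m\neq n$ or $0\le d<m=n$, $\operatorname{Sres}_d(f,g)(x)\in\mathbb{K}[x]$ is the determinant of the following square matrix of size $m+n-2d$ (coefficients with index outside the range are $0$): for $1\le i\le n-d$, row $i$ has entry $f_{m+i-j}$ in column $j$ for $1\le j\le m+n-2d-1$ and entry $x^{n-d-i}f(x)$ in the last column; for $1\le i\le m-d$, row $n-d+i$ has entry $g_{n+i-j}$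 in column $j$ for $1\le j\le m+n-2d-1$ and entry $x^{m-d-i}g(x)$ in the last column. Confluent Schur polynomials: for a multiset $X$ with distinct elements $x_1,\dots,x_{\overline r}$ of multiplicities $j_1,\dots,j_{\overline r}$, $r=j_1+\cdots+j_{\overline r}\le k$, let $V_k(X)=\big(V_k(x_1,j_1)\ \cdots\ V_k(x_{\overline r},j_{\overline r})\big)$ be the $k\times r$ confluent Vandermonde matrix, where $V_k(x_i,j)$ is the $k\times j$ matrix whose first column is $(x_i^{k-1},x_i^{k-2},\dots,x_i,1)^T$ and whose $(l+1)$-th column is the $l$-th derivative with respect to $x_i$ of the first one. Write $V(X):=V_r(X)$. For $R\subset\{1,\dots,k\}$ with $|R|=k-r$, $V_k^{(R)}(X)$ is the square matrix obtained from $V_k(X)$ by deleting the rows indexed by $R$, and $S_k^{(R)}(X):=\det(V_k^{(R)}(X))/\det(V(X))$. When $X$ consists of $r$ distinct indeterminates this is a symmetric polynomial with integer coefficients (a Schur polynomial), and for an arbitrary multiset $S_k^{(R)}(X)$ is the value of that polynomial at the elements of $X$ listed with multiplicity; this defines $S_k^{(R)}(X)$ over any field. ($S_k^{(R)}(X)=1$ for $X=\emptyset$.) Let $\overline m:=|\overline A|$, $\overline n:=|\overline B|$. Define $$\operatorname{SylM}_{d}(A,B)(x):=(-1)^{m'(m-d)}\sum(-1)^{\sigma_R}\frac{\mathcal{R}(A\backslash\overline A,\overline B\backslash B')\,\mathcal{R}(\overline A\backslash A',B\backslash B')\,\mathcal{R}(x,A')\,\mathcal{R}(x,B')}{\mathcal{R}(A',\overline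 A\backslash A')\,\mathcal{R}(B',\overline B\backslash B')}\cdot S_{d+1}^{(\widetilde R_1)}(A'\cup B'\cup\{x\})\,S_{m+n-d}^{(R_2)}((\overline A\backslash A')\cup B)\,S_{m+n-d}^{(R_3)}(A\cup(\overline B\backslash B')),$$ where the sum is over: all disjoint unions $R_1\sqcup R_2\sqcup R_3=\{1,\dots,m'+n'-d\}$ with $R_1\subset\{m+n-2d,\dots,m'+n'-d\}$, $|R_1|\le\max\{0,\,d-(\overline m+\overline n)+1\}$, $m'-d\le|R_2|\le m-d$, $n'-d\le|R_3|\le n-d$; all subsets $A'\subset\overline A$ with $|A'|=|R_2|+d-m'$; all subsets $B'\subset\overline B$ with $|B'|=|R_3|+\min\{m',d-n'\}$. Integer intervals $\{p,\dots,q\}$ with $p>q$ are empty. Here $\widetilde R_1:=\{i-(m+n-2d-1): i\in R_1\}$ and, with $r_i=|R_i|$ and $R=(R_1,R_2,R_3)$, $$(-1)^{\sigma_R}:=(-1)^{r_1(n-d+r_2+r_3)+r_2(\overline m-1)+r_3(m'+n'-d-1)+r_2r_3}\,\operatorname{sg}(R),$$ where $\operatorname{sg}(R)$ is the sign of the permutation of $\{1,\dots,m'+n'-d\}$ obtained by listing the elements of $R_1$ in increasing order, then those of $R_2$ in increasing order, then those of $R_3$ in increasing order. When $d\ge m'+n'$ one has $R_1=R_2=R_3=\emptyset$, $(-1)^{\sigma_R}=1$, and the three factors $S$ are taken equal to $1$. *)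

theory Defs
  imports
    "Subresultants.Subresultant"
    "Jordan_Normal_Form.DL_Submatrix"
    "HOL-Library.Poly_Mapping"
    "HOL-Combinatorics.Permutations"
begin

section \<open>Subresultants\<close>

text \<open>
  The matrix in \<^const>\<open>subresultant_mat\<close> is the transpose of the one in the classical row-wise
  definition of \<open>Sres\<^sub>d(f,g)\<close>. The next fact identifies \<^const>\<open>subresultant\<close> with the
  determinant of the latter, with 0-based row and column indices: the \<open>(i,j)\<close> entry is
  \<open>f\<^bsub>m+(i+1)-(j+1)\<^esub>\<close>, and the last column of row \<open>i\<close> is \<open>x\<^bsup>n-d-(i+1)\<^esup> f\<close>.
\<close>

lemma subresultant_row_form:
  fixes f g :: "'a::comm_ring_1 poly" and d :: nat
  defines "m \<equiv> degree f" and "n \<equiv> degree g"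
  defines "N \<equiv> (m - d) + (n - d)"
  shows "subresultant d f g = det (mat N N (\<lambda>(i, j).
    if i < n - d then
      (if j = N - 1 then monom 1 (n - d - 1 - i) * f
       else [: coeff_int f (int m + int i - int j) :])
    else let i' = i - (n - d) in
      (if j = N - 1 then monom 1 (m - d - 1 - i') * g
       else [: coeff_int g (int n + int i' - int j) :])))"
    (is "_ = det ?M")
proof -
  have c: "?M \<in> carrier_mat N N" by simp
  have "subresultant_mat d f g = transpose_mat ?M"
  proof (rule eq_matI)
    fix i j assume "i < dim_row (transpose_mat ?M)" "j < dim_col (transpose_mat ?M)"
    then have i: "i < N" and j: "j < N" by simp_all
    have shift: "int a + int b - int c = int a - int c + int b" for a b c :: nat by simp
    have "transpose_mat ?M $$ (i, j) = ?M $$ (j, i)" using i j by simp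
    then show "subresultant_mat d f g $$ (i, j) = transpose_mat ?M $$ (i, j)"
      unfolding index_mat(1)[OF j i] split
        subresultant_index_mat[of i f d g j, folded m_def n_def, folded N_def, OF i j] Let_def shift
      by simp
  qed (simp_all add: N_def m_def n_def)
  then show ?thesis
    unfolding subresultant_def using det_transpose[OF c] by simp
qed

section \<open>Schur polynomials of a multiset\<close>

text \<open>
  \<open>zmpoly\<close> is \<open>\<int>[X\<^sub>0,X\<^sub>1,\<dots>]\<close>: a polynomial maps exponent vectors to coefficients.
\<close>

type_synonym zmpoly = "(nat \<Rightarrow>\<^sub>0 nat) \<Rightarrow>\<^sub>0 int"

definition indet :: "nat \<Rightarrow> zmpoly" where
  "indet j = Poly_Mapping.single (Poly_Mapping.single j 1) 1"

definition eval_zmpoly :: "(nat \<Rightarrow> 'a::comm_ring_1) \<Rightarrow> zmpoly \<Rightarrow> 'a" where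
  "eval_zmpoly v p = (\<Sum>e\<in>Poly_Mapping.keys p.
     of_int (Poly_Mapping.lookup p e) *
     (\<Prod>j\<in>Poly_Mapping.keys e. v j ^ Poly_Mapping.lookup e j))"

definition vandermonde :: "nat \<Rightarrow> 'a::comm_ring_1 list \<Rightarrow> 'a mat" where
  "vandermonde k xs = mat k (length xs) (\<lambda>(i, j). (xs ! j) ^ (k - 1 - i))"

text \<open>\<open>R\<close> consists of 1-based row indices, as in the mathematical notation.\<close>

definition vandermonde_del :: "nat \<Rightarrow> nat set \<Rightarrow> 'a::comm_ring_1 list \<Rightarrow> 'a mat" where
  "vandermonde_del k R xs = submatrix (vandermonde k xs) {i. Suc i \<notin> R} UNIV"

text \<open>
  The quotient \<open>det V\<^sub>k\<^bsup>(R)\<^esup>(X) / det V(X)\<close> for \<open>X\<close> a set of \<open>r\<close> distinct indeterminates. All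
  multiplicities being 1, the confluent Vandermonde matrices are ordinary ones here. That the
  quotient exists in \<open>zmpoly\<close> and is unique is shown in \<open>schur_poly_ex1\<close> below.
\<close>

definition schur_poly :: "nat \<Rightarrow> nat set \<Rightarrow> nat \<Rightarrow> zmpoly" where
  "schur_poly k R r = (let X = map indet [0..<r] in
     THE p. p * det (vandermonde r X) = det (vandermonde_del k R X))"

text \<open>
  \<open>S\<^sub>k\<^bsup>(R)\<^esup>(X)\<close>: the value of the quotient at the elements of \<open>X\<close>, listed with multiplicity.
  The polynomial is symmetric, so the choice of the listing is immaterial.
\<close>

definition schur :: "nat \<Rightarrow> nat set \<Rightarrow> 'a::comm_ring_1 multiset \<Rightarrow> 'a" where
  "schur k R X = eval_zmpoly ((!) (SOME xs. mset xs = X)) (schur_poly k R (size X))"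

lemma inj_indet: "inj indet"
  by (rule injI)
     (metis indet_def lookup_single_eq lookup_single_not_eq one_neq_zero)

lemma det_vandermonde_nonzero:
  fixes xs :: "'a::idom list"
  assumes "distinct xs"
  shows "det (vandermonde (length xs) xs) \<noteq> 0"
proof
  let ?r = "length xs" and ?V = "vandermonde (length xs) xs"
  assume 0: "det ?V = 0"
  have V: "?V \<in> carrier_mat ?r ?r" by (simp add: vandermonde_def)
  then have VT: "transpose_mat ?V \<in> carrier_mat ?r ?r" by simp
  have "det (transpose_mat ?V) = 0" using 0 det_transpose[OF V] by simp
  then obtain v where v: "v \<in> carrier_vec ?r" "v \<noteq> 0\<^sub>v ?r" "transpose_mat ?V *\<^sub>v v = 0\<^sub>v ?r"
    using det_0_iff_vec_prod_zero[OF VT] by blast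
  define p where "p = (\<Sum>i<?r. monom (v $ i) (?r - 1 - i))"
  have root: "poly p (xs ! j) = 0" if j: "j < ?r" for j
  proof -
    have "0 = (transpose_mat ?V *\<^sub>v v) $ j" using v(3) j by simp
    also have "\<dots> = (\<Sum>i<?r. (xs ! j) ^ (?r - 1 - i) * v $ i)"
      using v(1) j by (simp add: scalar_prod_def vandermonde_def lessThan_atLeast0)
    finally show ?thesis by (simp add: p_def poly_sum poly_monom mult.commute)
  qed
  have "p = 0"
  proof (rule ccontr)
    assume "p \<noteq> 0"
    have r: "?r > 0" using \<open>p \<noteq> 0\<close> by (auto simp: p_def)
    have "set xs \<subseteq> {x. poly p x = 0}" using root by (auto simp: in_set_conv_nth)
    then have "?r \<le> card {x. poly p x = 0}"
      using poly_roots_finite[OF \<open>p \<noteq> 0\<close>] distinct_card[OF assms] by (metis card_mono)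
    also have "\<dots> \<le> degree p" by (rule card_poly_roots_bound[OF \<open>p \<noteq> 0\<close>])
    also have "degree p \<le> ?r - 1"
      unfolding p_def
      by (rule degree_sum_le) (auto intro: order_trans[OF degree_monom_le])
    finally show False using r by linarith
  qed
  have "v $ i = 0" if i: "i < ?r" for i
  proof -
    have "coeff p (?r - 1 - i) = (\<Sum>k<?r. if k = i then v $ k else 0)"
      unfolding p_def coeff_sum coeff_monom using i by (intro sum.cong) auto
    then show ?thesis using \<open>p = 0\<close> i by simp
  qed
  then have "v = 0\<^sub>v ?r" using v(1) by auto
  with v(2) show False by simp
qed

lemma det_vandermonde_dvd:
  fixes xs :: "'a::idom list"
  assumes "R \<subseteq> {1..k}" "card R + length xs = k"
  shows "det (vandermonde (length xs) xs) dvd det (vandermonde_del k R xs)"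
proof (cases "xs = []")
  case True
  then show ?thesis by (simp add: vandermonde_def)
next
  case False
  let ?r = "length xs" and ?I = "{i. Suc i \<notin> R}"
  let ?V = "vandermonde (length xs) xs"
  have r0: "?r > 0" using False by simp
  have fR: "finite R" using assms(1) finite_subset by blast
  have "card {i. i < k \<and> i \<in> ?I} = ?r"
  proof -
    have "bij_betw Suc {i. i < k \<and> i \<in> ?I} ({1..k} - R)"
      by (rule bij_betwI[where g = "\<lambda>i. i - 1"]) auto
    then have "card {i. i < k \<and> i \<in> ?I} = card ({1..k} - R)" by (rule bij_betw_same_card)
    also have "\<dots> = ?r" using assms fR by (simp add: card_Diff_subset)
    finally show ?thesis .
  qed
  then have cI: "card {i. i < dim_row (vandermonde k xs) \<and> i \<in> ?I} = ?r"
    by (simp add: vandermonde_def)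
  have cJ: "card {j. j < dim_col (vandermonde k xs) \<and> j \<in> UNIV} = ?r"
    by (simp add: vandermonde_def)
  define e where "e i = k - 1 - pick ?I i" for i
  have D: "vandermonde_del k R xs = mat ?r ?r (\<lambda>(i, j). (xs ! j) ^ e i)"
  proof (rule eq_matI)
    fix i j
    assume ij: "i < dim_row (mat ?r ?r (\<lambda>(i, j). (xs ! j) ^ e i))"
               "j < dim_col (mat ?r ?r (\<lambda>(i, j). (xs ! j) ^ e i))"
    have "pick ?I i < k"
      using pick_le[of i k ?I] ij cI by (simp add: vandermonde_def)
    then show "vandermonde_del k R xs $$ (i, j) = mat ?r ?r (\<lambda>(i, j). (xs ! j) ^ e i) $$ (i, j)"
      using ij cI cJ
      by (simp add: vandermonde_del_def submatrix_index vandermonde_def pick_UNIV e_def)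
  qed (use cI cJ in \<open>simp_all add: vandermonde_del_def dim_submatrix\<close>)
  define P where "P = (\<Prod>x\<leftarrow>xs. [:- x, 1:])"
  have lP: "lead_coeff P = 1" and dP: "degree P = ?r"
    and rP: "x \<in> set xs \<Longrightarrow> poly P x = 0" for x
  proof -
    show "lead_coeff P = 1" unfolding P_def by (induct xs) (simp_all add: lead_coeff_mult del: mult_pCons_left)
    have "P \<noteq> 0" "degree P = ?r" unfolding P_def
      by (induct xs) (simp_all add: degree_mult_eq del: mult_pCons_left)
    then show "degree P = ?r" by simp
    show "poly P x = 0" if "x \<in> set xs" unfolding P_def using that
      by (induct xs) auto
  qed
  define q where "q n = snd (pseudo_divmod (monom 1 n) P)" for n
  have P0: "P \<noteq> 0" using lP by auto
  have q: "poly (q n) x = x ^ n" if "x \<in> set xs" for n x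
  proof -
    have "monom 1 n = P * fst (pseudo_divmod (monom 1 n) P) + q n"
      using pseudo_divmod(1)[OF P0, of "monom 1 n"] lP unfolding q_def
      by (metis power_one prod.collapse smult_1_left)
    then have "poly (monom 1 n) x = poly P x * poly (fst (pseudo_divmod (monom 1 n) P)) x + poly (q n) x"
      by (metis poly_add poly_mult)
    then have "poly (monom 1 n) x = poly (q n) x" using rP[OF that] by simp
    then show ?thesis by (simp add: poly_monom)
  qed
  have dq: "degree (q n) < ?r" for n
    using pseudo_divmod(2)[OF P0, of "monom 1 n"] dP r0 unfolding q_def
    by (metis degree_0 prod.collapse)
  define C where "C = mat ?r ?r (\<lambda>(i, l). coeff (q (e i)) (?r - 1 - l))"
  have cC: "C \<in> carrier_mat ?r ?r" and cV: "?V \<in> carrier_mat ?r ?r"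
    by (simp_all add: C_def vandermonde_def)
  have "vandermonde_del k R xs = C * ?V"
    unfolding D
  proof (rule eq_matI)
    fix i j assume "i < dim_row (C * ?V)" "j < dim_col (C * ?V)"
    then have i: "i < ?r" and j: "j < ?r" using cC cV by auto
    have "(C * ?V) $$ (i, j) = (\<Sum>l<?r. coeff (q (e i)) (?r - 1 - l) * (xs ! j) ^ (?r - 1 - l))"
      using i j by (simp add: C_def vandermonde_def scalar_prod_def lessThan_atLeast0)
    also have "\<dots> = (\<Sum>l<?r. coeff (q (e i)) l * (xs ! j) ^ l)"
      using sum.nat_diff_reindex[where g = "\<lambda>l. coeff (q (e i)) l * (xs ! j) ^ l" and n = ?r]
      by simp
    also have "\<dots> = poly (q (e i)) (xs ! j)"
      unfolding poly_altdef using dq[of "e i"]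
      by (intro sum.mono_neutral_right) (auto simp: coeff_eq_0 not_le)
    also have "\<dots> = (xs ! j) ^ e i" using q j by simp
    finally show "mat ?r ?r (\<lambda>(i, j). (xs ! j) ^ e i) $$ (i, j) = (C * ?V) $$ (i, j)"
      using i j by simp
  qed (use cC cV in auto)
  then show ?thesis using det_mult[OF cC cV] by simp
qed

lemma schur_poly_ex1:
  assumes "R \<subseteq> {1..k}" "card R + r = k"
  shows "\<exists>!p :: zmpoly. p * det (vandermonde r (map indet [0..<r])) =
    det (vandermonde_del k R (map indet [0..<r]))"
proof -
  let ?X = "map indet [0..<r]"
  have "distinct ?X" using inj_on_subset[OF inj_indet subset_UNIV] by (simp add: distinct_map)
  then have nz: "det (vandermonde r ?X) \<noteq> 0"
    using det_vandermonde_nonzero[of ?X] by simp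
  have "det (vandermonde r ?X) dvd det (vandermonde_del k R ?X)"
    using det_vandermonde_dvd[of R k ?X] assms by simp
  then show ?thesis using nz by (auto simp: dvd_def mult.commute)
qed

section \<open>The multiset Sylvester sum\<close>

text \<open>The product \<open>\<R>(X,Y)\<close> of all differences.\<close>

definition diff_prod :: "'a::comm_ring_1 multiset \<Rightarrow> 'a multiset \<Rightarrow> 'a" where
  "diff_prod X Y = (\<Prod>x\<in>#X. \<Prod>y\<in>#Y. x - y)"

text \<open>
  The permutation of \<open>{1..N}\<close> sending \<open>i\<close> to the \<open>i\<close>-th entry of the listing of \<open>R\<^sub>1\<close>, then
  \<open>R\<^sub>2\<close>, then \<open>R\<^sub>3\<close>, each in increasing order, where \<open>{1..N}\<close> is their disjoint union.
\<close>

definition listing_perm :: "nat set \<Rightarrow> nat set \<Rightarrow> nat set \<Rightarrow> nat \<Rightarrow> nat" where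
  "listing_perm R1 R2 R3 =
    (let xs = sorted_list_of_set R1 @ sorted_list_of_set R2 @ sorted_list_of_set R3
     in (\<lambda>i. if i \<in> {1..length xs} then xs ! (i - 1) else i))"

text \<open>
  In what follows \<open>ma\<close>, \<open>nb\<close> stand for the cardinalities of the chosen sets \<open>Abar\<close>, \<open>Bbar\<close> of
  distinct roots, and \<open>m'\<close>, \<open>n'\<close> for \<open>m - ma\<close>, \<open>n - nb\<close>. Quantities that may be negative are
  integers; in particular the exponent of the sign involves \<open>ma - 1\<close>.
\<close>

definition index_triples ::
  "nat \<Rightarrow> nat \<Rightarrow> nat \<Rightarrow> nat \<Rightarrow> nat \<Rightarrow> (nat set \<times> nat set \<times> nat set) set" where
  "index_triples d m n ma nb = (let m' = m - ma; n' = n - nb in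
    {(R1, R2, R3).
       R1 \<union> R2 \<union> R3 = {1..m' + n' - d} \<and>
       R1 \<inter> R2 = {} \<and> R1 \<inter> R3 = {} \<and> R2 \<inter> R3 = {} \<and>
       R1 \<subseteq> {m + n - 2 * d..m' + n' - d} \<and>
       int (card R1) \<le> max 0 (int d - (int ma + int nb) + 1) \<and>
       int m' - int d \<le> int (card R2) \<and> int (card R2) \<le> int m - int d \<and>
       int n' - int d \<le> int (card R3) \<and> int (card R3) \<le> int n - int d})"

definition sigma_exponent ::
  "nat \<Rightarrow> nat \<Rightarrow> nat \<Rightarrow> nat \<Rightarrow> nat \<Rightarrow> nat set \<Rightarrow> nat set \<Rightarrow> nat set \<Rightarrow> int" where
  "sigma_exponent d m n ma nb R1 R2 R3 =
    (let m' = int m - int ma; n' = int n - int nb;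
         r1 = int (card R1); r2 = int (card R2); r3 = int (card R3)
     in r1 * (int n - int d + r2 + r3) + r2 * (int ma - 1) + r3 * (m' + n' - int d - 1) + r2 * r3)"

definition sigma_sign ::
  "nat \<Rightarrow> nat \<Rightarrow> nat \<Rightarrow> nat \<Rightarrow> nat \<Rightarrow> nat set \<Rightarrow> nat set \<Rightarrow> nat set \<Rightarrow> 'a::field" where
  "sigma_sign d m n ma nb R1 R2 R3 =
    (-1) powi sigma_exponent d m n ma nb R1 R2 R3 * of_int (sign (listing_perm R1 R2 R3))"

text \<open>
  A multiset of scalars, viewed in \<open>K[x]\<close>; the indeterminate \<open>x\<close> is \<open>[:0, 1:]\<close>.
\<close>

abbreviation const_mset :: "'a::comm_ring_1 multiset \<Rightarrow> 'a poly multiset" where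
  "const_mset X \<equiv> image_mset (\<lambda>a. [:a:]) X"

abbreviation x_mset :: "'a::comm_ring_1 poly multiset" where
  "x_mset \<equiv> {#[:0, 1:]#}"

text \<open>
  The product of the three Schur factors, which by convention is 1 for \<open>d \<ge> m' + n'\<close>. This has
  to be imposed: for \<open>d > m' + n'\<close> the last factor would have more arguments than rows.
\<close>

definition schur_factors ::
  "nat \<Rightarrow> 'a::field multiset \<Rightarrow> 'a set \<Rightarrow> 'a multiset \<Rightarrow> 'a set \<Rightarrow>
   nat set \<Rightarrow> nat set \<Rightarrow> nat set \<Rightarrow> 'a set \<Rightarrow> 'a set \<Rightarrow> 'a poly" where
  "schur_factors d A Abar B Bbar R1 R2 R3 A' B' =
    (let m = size A; n = size B; m' = m - card Abar; n' = n - card Bbar in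
     if m' + n' \<le> d then 1
     else smult
       (schur (m + n - d) R2 (mset_set (Abar - A') + B) *
        schur (m + n - d) R3 (A + mset_set (Bbar - B')))
       (schur (d + 1) ((\<lambda>i. i - (m + n - 2 * d - 1)) ` R1)
         (const_mset (mset_set A') + const_mset (mset_set B') + x_mset)))"

definition SylM ::
  "nat \<Rightarrow> 'a::field multiset \<Rightarrow> 'a set \<Rightarrow> 'a multiset \<Rightarrow> 'a set \<Rightarrow> 'a poly" where
  "SylM d A Abar B Bbar =
    (let m = size A; n = size B; ma = card Abar; nb = card Bbar; m' = m - ma; n' = n - nb in
     smult ((-1) ^ (m' * (m - d)))
      (\<Sum>(R1, R2, R3) \<in> index_triples d m n ma nb.
       \<Sum>A' \<in> {A'. A' \<subseteq> Abar \<and> int (card A') = int (card R2) + int d - int m'}.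
       \<Sum>B' \<in> {B'. B' \<subseteq> Bbar \<and> int (card B') = int (card R3) + min (int m') (int d - int n')}.
         smult
          (sigma_sign d m n ma nb R1 R2 R3 *
           (diff_prod (A - mset_set Abar) (mset_set (Bbar - B')) *
            diff_prod (mset_set (Abar - A')) (B - mset_set B')) /
           (diff_prod (mset_set A') (mset_set (Abar - A')) *
            diff_prod (mset_set B') (mset_set (Bbar - B'))))
          (diff_prod x_mset (const_mset (mset_set A')) *
           diff_prod x_mset (const_mset (mset_set B')) *
           schur_factors d A Abar B Bbar R1 R2 R3 A' B')))"

end

theory Submission
  imports Defs
begin

text \<open>
  The subresultant and the Sylvester sum are two evaluations of one determinant.

  Suppose first that \<open>Abar\<close> and \<open>Bbar\<close> are disjoint. Put \<open>L = max 0 (m' + n' - d)\<close>,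
  \<open>N = L + |Abar| + |Bbar|\<close>, \<open>k = m - d\<close> and \<open>t = N - m\<close>. Then \<open>t + k + (d + 1) = N + 1\<close>, and
  \<open>t = n - d\<close> unless \<open>d > m' + n'\<close>. Consider the \<open>N + 1\<close> polynomials
  \<open>f x\<^bsup>t-1\<^esup>, \<dots>, f\<close>, \<open>g x\<^bsup>k-1\<^esup>, \<dots>, g\<close>, \<open>x\<^bsup>d\<^esup>, \<dots>, 1\<close>, all of degree below \<open>N\<close>. They index the rows.
  The columns are \<open>N\<close> linear functionals applied to them, namely the coefficients of
  \<open>x\<^bsup>N-1\<^esup>, \<dots>, x\<^bsup>N-L\<^esup>\<close> and the evaluations at the points of \<open>Abar\<close> and of \<open>Bbar\<close>, together with one more column,
  which evaluates at \<open>x\<close> the polynomials of the third group and is zero on the others.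

  On the one hand, expressing the \<open>N\<close> functionals by the coefficients of \<open>x\<^bsup>N-1\<^esup>, \<dots>, 1\<close> splits off
  the Vandermonde determinant of \<open>Abar\<close> followed by \<open>Bbar\<close>, and column operations turn the
  remaining determinant into \<open>\<plusminus> Sres\<^sub>d(f,g)(x)\<close> (\<open>coldet_full_basis\<close>).

  On the other hand, each column is the sum of its restrictions to the three groups of rows. A
  coefficient functional lives in all three groups; evaluation at a root of \<open>f\<close> vanishes on the
  first, evaluation at a root of \<open>g\<close> on the second. Expanding multilinearly
  (\<open>sres_val_expansion\<close>), a choice of one group for each column is a partition
  \<open>R\<^sub>1 \<squnion> R\<^sub>2 \<squnion> R\<^sub>3\<close> of \<open>{1..L}\<close> and subsets \<open>A' \<subseteq> Abar\<close>, \<open>B' \<subseteq> Bbar\<close>. Its contribution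
  is a block diagonal determinant. It vanishes unless the cardinalities fit and \<open>R\<^sub>1\<close> avoids the
  coefficients of degree above \<open>d\<close>, which are exactly the conditions on the index set of the
  Sylvester sum; otherwise it is a product of three determinants. Each of these is a Schur value times Vandermonde determinants and a product of
  differences (\<open>schur_coldet_eq\<close>). The factors collect to one factor common to all terms, the
  Vandermonde determinant found above, times the term of the Sylvester sum
  (\<open>split_term_value\<close>). For \<open>d \<ge> m' + n'\<close> there are no coefficient functionals and no Schur factors,
  but the same computation applies; for \<open>d > m' + n'\<close>, \<open>t\<close> exceeds \<open>n - d\<close>, and the extra multiples of \<open>f\<close> contribute a
  unitriangular block.

  The common factor can only be cancelled if it is nonzero, which fails when \<open>Abar\<close> and \<open>Bbar\<close>
  meet. Therefore the identity is proved over \<open>K[x][s]\<close> for the roots of \<open>f\<close> and the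
  roots of \<open>g\<close> shifted by \<open>s\<close>, which never coincide, and then specialized at \<open>s = 0\<close>. The shift
  leaves the differences within \<open>B\<close> unchanged, so the denominators stay invertible constants.
  The same idea, with all relevant elements perturbed by different powers of \<open>s\<close>, reduces
  statements on multisets to lists of distinct elements.
\<close>

section \<open>Alternating functions of lists\<close>

definition alternating :: "('c list \<Rightarrow> 'b::comm_ring_1) \<Rightarrow> bool" where
  "alternating F \<longleftrightarrow> (\<forall>us vs x y. F (us @ x # y # vs) = - F (us @ y # x # vs))"

lemma alternatingD: "alternating F \<Longrightarrow> F (us @ x # y # vs) = - F (us @ y # x # vs)"
  unfolding alternating_def by blast

lemma alternating_context: "alternating F \<Longrightarrow> alternating (\<lambda>zs. F (us @ map h zs @ vs))"
proof -
  assume F: "alternating F"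
  show ?thesis unfolding alternating_def
  proof (intro allI)
    fix zs ws x y
    from alternatingD[OF F, of "us @ map h zs" "h x" "h y" "map h ws @ vs"]
    show "F (us @ map h (zs @ x # y # ws) @ vs) = - F (us @ map h (zs @ y # x # ws) @ vs)" by simp
  qed
qed

lemma alternating_move:
  assumes "alternating F"
  shows "F (us @ x # vs @ ws) = (-1) ^ length vs * F (us @ vs @ x # ws)"
proof (induction vs arbitrary: us)
  case (Cons v vs)
  have "F (us @ x # (v # vs) @ ws) = - F ((us @ [v]) @ x # vs @ ws)"
    using alternatingD[OF assms, of us x v "vs @ ws"] by simp
  then show ?case using Cons.IH[of "us @ [v]"] by simp
qed simp

lemma alternating_swap_blocks:
  assumes "alternating F"
  shows "F (us @ vs @ ws @ zs) = (-1) ^ (length vs * length ws) * F (us @ ws @ vs @ zs)"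
proof (induction vs arbitrary: us)
  case (Cons v vs)
  have "F (us @ (v # vs) @ ws @ zs) = (-1) ^ (length vs * length ws) * F (us @ v # ws @ vs @ zs)"
    using Cons.IH[of "us @ [v]"] by simp
  also have "F (us @ v # ws @ vs @ zs) = (-1) ^ length ws * F (us @ ws @ (v # vs) @ zs)"
    using alternating_move[OF assms, of us v ws "vs @ zs"] by simp
  finally show ?case by (simp add: power_add mult_ac)
qed simp

text \<open>
  The sign is the same for all alternating functions. This lets one
  reorder the columns of a determinant and the arguments of a Vandermonde determinant at once,
  without naming the sign of the permutation: it cancels.
\<close>

lemma alternating_mset:
  assumes "mset xs = mset ys"
  shows "\<exists>k::nat. \<forall>F :: 'c list \<Rightarrow> 'b::comm_ring_1. alternating F \<longrightarrow> F xs = (-1) ^ k * F ys"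
  using assms
proof (induction xs arbitrary: ys)
  case Nil
  then show ?case by (intro exI[of _ 0]) simp
next
  case (Cons x xs)
  then have "x \<in> set ys" by (metis list.set_intros(1) mset_eq_setD)
  then obtain y1 y2 where ys: "ys = y1 @ x # y2" by (meson split_list)
  with Cons.prems have "mset xs = mset (y1 @ y2)" by simp
  from Cons.IH[OF this] obtain k :: nat where
    k: "\<And>F :: 'c list \<Rightarrow> 'b. alternating F \<Longrightarrow> F xs = (-1) ^ k * F (y1 @ y2)" by blast
  have "F (x # xs) = (-1) ^ (k + length y1) * F ys" if F: "alternating F" for F :: "'c list \<Rightarrow> 'b"
  proof -
    have "alternating (\<lambda>zs. F (x # zs))" using alternating_context[OF F, of "[x]" id "[]"] by simp
    from k[OF this] have "F (x # xs) = (-1) ^ k * F (x # y1 @ y2)" by simp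
    also have "F (x # y1 @ y2) = (-1) ^ length y1 * F ys"
      using alternating_move[OF F, of "[]" x y1 y2] ys by simp
    finally show ?thesis by (simp add: power_add mult_ac)
  qed
  then show ?case by blast
qed

text \<open>
  Moving the elements of \<open>R\<close> to the front one after the other, the element \<open>i\<close> passes the
  smaller elements outside \<open>R\<close>.
\<close>

lemma alternating_upt_split:
  assumes "alternating F"
  shows "F [0..<N] = (-1) ^ (\<Sum>i\<in>{i\<in>R. i < N}. card {j. j < i \<and> j \<notin> R})
    * F (filter (\<lambda>i. i \<in> R) [0..<N] @ filter (\<lambda>i. i \<notin> R) [0..<N])"
  using assms
proof (induction N arbitrary: F)
  case (Suc N)
  let ?e = "\<Sum>i\<in>{i\<in>R. i < N}. card {j. j < i \<and> j \<notin> R}"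
  let ?i = "filter (\<lambda>i. i \<in> R) [0..<N]" and ?o = "filter (\<lambda>i. i \<notin> R) [0..<N]"
  have "alternating (\<lambda>zs. F (zs @ [N]))" using alternating_context[OF Suc.prems, of "[]" id "[N]"] by simp
  from Suc.IH[OF this] have 1: "F [0..<Suc N] = (-1) ^ ?e * F (?i @ ?o @ [N])" by simp
  show ?case
  proof (cases "N \<in> R")
    case True
    have "length ?o = card (set ?o)" by (simp add: distinct_card del: set_filter)
    also have "set ?o = {j. j < N \<and> j \<notin> R}" by auto
    finally have l: "length ?o = card {j. j < N \<and> j \<notin> R}" .
    have "{i\<in>R. i < Suc N} = insert N {i\<in>R. i < N}" using True by auto
    then have s: "(\<Sum>i\<in>{i\<in>R. i < Suc N}. card {j. j < i \<and> j \<notin> R}) = length ?o + ?e"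
      using l by simp
    have "F (?i @ N # ?o) = (-1) ^ length ?o * F (?i @ ?o @ [N])"
      using alternating_move[OF Suc.prems, of ?i N ?o "[]"] by simp
    then have "F (?i @ ?o @ [N]) = (-1) ^ length ?o * F (?i @ N # ?o)"
      by simp
    then show ?thesis using True 1 s by (simp add: power_add mult_ac)
  next
    case False
    then have "{i\<in>R. i < Suc N} = {i\<in>R. i < N}" by (auto simp: less_Suc_eq)
    then show ?thesis using False 1 by simp
  qed
qed simp

section \<open>Determinants with a given list of columns\<close>

text \<open>
  Columns are functions of the row index, of which only the values below the number of columns
  matter. In this form columns can be restricted to some rows, shifted and permuted as list entries.
\<close>

definition coldet :: "(nat \<Rightarrow> 'a::comm_ring_1) list \<Rightarrow> 'a" where
  "coldet us = det (mat (length us) (length us) (\<lambda>(i, j). (us ! j) i))"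

lemma coldet_cong:
  assumes "length us = length vs" "\<And>i j. i < length us \<Longrightarrow> j < length us \<Longrightarrow> (us ! j) i = (vs ! j) i"
  shows "coldet us = coldet vs"
proof -
  have "mat (length us) (length us) (\<lambda>(i, j). (us ! j) i) = mat (length vs) (length vs) (\<lambda>(i, j). (vs ! j) i)"
    by (rule eq_matI) (use assms in auto)
  then show ?thesis unfolding coldet_def by simp
qed

lemma coldet_transpose:
  "coldet us = coldet (map (\<lambda>i j. (us ! j) i) [0..<length us])"
proof -
  let ?n = "length us" and ?A = "mat (length us) (length us) (\<lambda>(i, j). (us ! j) i)"
  have "coldet us = det (transpose_mat ?A)"
    unfolding coldet_def by (subst det_transpose[of _ ?n]) auto
  also have "transpose_mat ?A = mat ?n ?n (\<lambda>(i, j). (map (\<lambda>i j. (us ! j) i) [0..<?n] ! j) i)"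
    by (rule eq_matI) auto
  finally show ?thesis by (simp add: coldet_def)
qed

lemma alternating_coldet: "alternating (coldet :: _ \<Rightarrow> 'a::comm_ring_1)"
  unfolding alternating_def
proof (intro allI)
  fix us vs :: "(nat \<Rightarrow> 'a) list" and x y
  let ?k = "length us" and ?us = "us @ y # x # vs"
  let ?n = "length ?us"
  let ?A = "mat ?n ?n (\<lambda>(i, j). (?us ! j) i)"
  have "mat ?n ?n (\<lambda>(i, j). ((us @ x # y # vs) ! j) i) = swapcols ?k (Suc ?k) ?A"
    by (rule eq_matI) (auto simp: nth_append nth_Cons')
  moreover have "det (swapcols ?k (Suc ?k) ?A) = - det ?A"
    by (rule det_swapcols[of _ ?n]) auto
  ultimately show "coldet (us @ x # y # vs) = - coldet (us @ y # x # vs)"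
    by (simp add: coldet_def)
qed

lemma coldet_linear_column:
  obtains C where "\<And>u. coldet (us @ u # vs) = (\<Sum>i\<le>length us + length vs. u i * C i)"
proof -
  let ?n = "Suc (length us + length vs)" and ?k = "length us"
  define A where "A u = mat ?n ?n (\<lambda>(i, j). ((us @ u # vs) ! j) i)" for u
  have cof: "cofactor (A u) i ?k = cofactor (A (\<lambda>_. 0)) i ?k" for u i
  proof -
    have "mat_delete (A u) i ?k = mat_delete (A (\<lambda>_. 0)) i ?k"
      by (rule eq_matI) (auto simp: mat_delete_def A_def nth_append nth_Cons')
    then show ?thesis by (simp add: cofactor_def)
  qed
  have "coldet (us @ u # vs) = (\<Sum>i\<le>length us + length vs. u i * cofactor (A (\<lambda>_. 0)) i ?k)" for u
  proof -
    have "coldet (us @ u # vs) = det (A u)" by (simp add: coldet_def A_def)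
    also have "\<dots> = (\<Sum>i<?n. A u $$ (i, ?k) * cofactor (A u) i ?k)"
      by (rule laplace_expansion_column) (auto simp: A_def)
    also have "\<dots> = (\<Sum>i<?n. u i * cofactor (A (\<lambda>_. 0)) i ?k)"
      unfolding cof[of u] by (intro sum.cong) (auto simp: A_def)
    finally show ?thesis unfolding lessThan_Suc_atMost .
  qed
  then show thesis by (rule that)
qed

lemma coldet_add:
  "coldet (us @ (\<lambda>i. p i + q i) # vs) = coldet (us @ p # vs) + coldet (us @ q # vs)"
proof -
  obtain C where C: "\<And>u. coldet (us @ u # vs) = (\<Sum>i\<le>length us + length vs. u i * C i)"
    using coldet_linear_column[of us vs] by blast
  show ?thesis unfolding C by (simp add: distrib_right sum.distrib)
qed

lemma coldet_scale:
  "coldet (us @ (\<lambda>i. c * u i) # vs) = c * coldet (us @ u # vs)"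
proof -
  obtain C where C: "\<And>u. coldet (us @ u # vs) = (\<Sum>i\<le>length us + length vs. u i * C i)"
    using coldet_linear_column[of us vs] by blast
  show ?thesis unfolding C by (simp add: sum_distrib_left mult.assoc)
qed

lemma coldet_scale_columns:
  "coldet (us @ map (\<lambda>x i. c x * h x i) xs) = prod_list (map c xs) * coldet (us @ map h xs)"
proof (induction xs arbitrary: us)
  case (Cons x xs)
  have "coldet (us @ map (\<lambda>x i. c x * h x i) (x # xs)) =
      c x * coldet ((us @ [h x]) @ map (\<lambda>x i. c x * h x i) xs)"
    by (simp add: coldet_scale)
  then show ?case using Cons.IH[of "us @ [h x]"] by (simp add: mult.assoc)
qed simp

text \<open>
  Multiplicativity of the determinant: \<open>ws\<close> holds the coefficients that express the columns \<open>us\<close>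
  by the columns \<open>vs\<close>.
\<close>

lemma coldet_combination:
  assumes "length us = n" "length vs = n"
    and "\<And>i j. i < n \<Longrightarrow> j < n \<Longrightarrow> (us ! j) i = (\<Sum>c<n. (vs ! c) i * (ws ! j) c)"
    and "length ws = n"
  shows "coldet us = coldet vs * coldet ws"
proof -
  let ?M = "\<lambda>us. mat n n (\<lambda>(i, j). (us ! j) i)"
  have "?M us = ?M vs * ?M ws"
    by (rule eq_matI) (use assms in \<open>auto simp: scalar_prod_def lessThan_atLeast0\<close>)
  then have "det (?M us) = det (?M vs) * det (?M ws)"
    by (simp add: det_mult[of _ n])
  then show ?thesis using assms by (simp add: coldet_def)
qed

lemma coldet_block_lower_zero:
  fixes us vs :: "(nat \<Rightarrow> 'a::idom) list"
  assumes "length us = k" "\<And>u i. u \<in> set us \<Longrightarrow> k \<le> i \<Longrightarrow> i < k + length vs \<Longrightarrow> u i = 0"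
  shows "coldet (us @ vs) = coldet us * coldet (map (\<lambda>v i. v (k + i)) vs)"
proof -
  let ?n = "length vs"
  have "mat (k + ?n) (k + ?n) (\<lambda>(i, j). ((us @ vs) ! j) i) =
      four_block_mat (mat k k (\<lambda>(i, j). (us ! j) i)) (mat k ?n (\<lambda>(i, j). (vs ! j) i))
        (0\<^sub>m ?n k) (mat ?n ?n (\<lambda>(i, j). (vs ! j) (k + i)))"
    by (rule eq_matI) (use assms in \<open>auto simp: nth_append\<close>)
  then have "coldet (us @ vs) = det (mat k k (\<lambda>(i, j). (us ! j) i)) * det (mat ?n ?n (\<lambda>(i, j). (vs ! j) (k + i)))"
    using assms(1) by (simp add: coldet_def det_four_block_mat_lower_left_zero[of _ k _ ?n])
  moreover have "mat ?n ?n (\<lambda>(i, j). (vs ! j) (k + i)) = mat ?n ?n (\<lambda>(i, j). (map (\<lambda>v i. v (k + i)) vs ! j) i)"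
    by (rule eq_matI) auto
  ultimately show ?thesis using assms(1) by (simp add: coldet_def)
qed

lemma coldet_block_upper_zero:
  fixes us vs :: "(nat \<Rightarrow> 'a::idom) list"
  assumes "length us = k" "\<And>v i. v \<in> set vs \<Longrightarrow> i < k \<Longrightarrow> v i = 0"
  shows "coldet (us @ vs) = coldet us * coldet (map (\<lambda>v i. v (k + i)) vs)"
proof -
  let ?n = "length vs"
  have "mat (k + ?n) (k + ?n) (\<lambda>(i, j). ((us @ vs) ! j) i) =
      four_block_mat (mat k k (\<lambda>(i, j). (us ! j) i)) (0\<^sub>m k ?n)
        (mat ?n k (\<lambda>(i, j). (us ! j) (k + i))) (mat ?n ?n (\<lambda>(i, j). (vs ! j) (k + i)))"
    by (rule eq_matI) (use assms in \<open>auto simp: nth_append\<close>)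
  then have "coldet (us @ vs) = det (mat k k (\<lambda>(i, j). (us ! j) i)) * det (mat ?n ?n (\<lambda>(i, j). (vs ! j) (k + i)))"
    using assms(1) by (simp add: coldet_def det_four_block_mat_upper_right_zero[of _ k _ ?n])
  moreover have "mat ?n ?n (\<lambda>(i, j). (vs ! j) (k + i)) = mat ?n ?n (\<lambda>(i, j). (map (\<lambda>v i. v (k + i)) vs ! j) i)"
    by (rule eq_matI) auto
  ultimately show ?thesis using assms(1) by (simp add: coldet_def)
qed

lemma coldet_unit [simp]: "coldet (map (\<lambda>r i. if i = r then 1 else 0) [0..<n]) = 1"
proof -
  have "mat n n (\<lambda>(i, j). (map (\<lambda>r i. if i = r then 1 else 0) [0..<n] ! j) i) = (1\<^sub>m n :: 'a mat)"
    by (rule eq_matI) auto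
  then show ?thesis by (simp add: coldet_def)
qed

text \<open>
  No permutation can send \<open>card J\<close> columns into fewer rows.
\<close>

lemma coldet_pigeonhole:
  assumes "J \<subseteq> {..<length us}" "finite I" "card I < card J"
    and "\<And>i j. j \<in> J \<Longrightarrow> i < length us \<Longrightarrow> i \<notin> I \<Longrightarrow> (us ! j) i = 0"
  shows "coldet us = 0"
proof -
  let ?n = "length us"
  have "(\<Prod>i = 0..<?n. (us ! p i) i) = 0" if p: "p permutes {0..<?n}" for p
  proof -
    have "\<exists>j\<in>J. inv_into UNIV p j \<notin> I"
    proof (rule ccontr)
      assume "\<not> ?thesis"
      then have "inv_into UNIV p ` J \<subseteq> I" by auto
      moreover have "inj_on (inv_into UNIV p) J" using permutes_inj[OF permutes_inv[OF p]] by (rule inj_on_subset) simp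
      ultimately have "card J \<le> card I" using assms(2) by (metis card_image card_mono)
      then show False using assms(3) by simp
    qed
    then obtain j where j: "j \<in> J" "inv_into UNIV p j \<notin> I" by blast
    have jn: "j < ?n" using j(1) assms(1) by auto
    then have i: "inv_into UNIV p j < ?n" using permutes_in_image[OF permutes_inv[OF p], of j] by simp
    have "(us ! p (inv_into UNIV p j)) (inv_into UNIV p j) = 0"
      using assms(4)[OF j(1) i j(2)] permutes_inverses(1)[OF p] by simp
    then show ?thesis using i by (intro prod_zero) auto
  qed
  moreover have "(\<Prod>i = 0..<?n. mat ?n ?n (\<lambda>(i, j). (us ! j) i) $$ (i, p i)) = (\<Prod>i = 0..<?n. (us ! p i) i)"
    if p: "p permutes {0..<?n}" for p
    using permutes_in_image[OF p] by (intro prod.cong) auto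
  ultimately show ?thesis
    unfolding coldet_def by (subst det_def'[of _ ?n]) (auto intro!: sum.neutral)
qed

text \<open>
  If the three groups of columns do not have the sizes of their row blocks, one of them has too
  many columns and the pigeonhole principle applies.
\<close>

lemma coldet_three_blocks:
  fixes us vs ws :: "(nat \<Rightarrow> 'a::idom) list"
  assumes len: "length us + length vs + length ws = k + l + n"
    and us: "\<And>u i. u \<in> set us \<Longrightarrow> k \<le> i \<Longrightarrow> i < k + l + n \<Longrightarrow> u i = 0"
    and vs: "\<And>u i. u \<in> set vs \<Longrightarrow> i < k \<or> k + l \<le> i \<and> i < k + l + n \<Longrightarrow> u i = 0"
    and ws: "\<And>u i. u \<in> set ws \<Longrightarrow> i < k + l \<Longrightarrow> u i = 0"
  shows "coldet (us @ vs @ ws) = (if length us = k \<and> length vs = l \<and> length ws = n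
    then coldet us * coldet (map (\<lambda>v i. v (k + i)) vs) * coldet (map (\<lambda>v i. v (k + l + i)) ws) else 0)"
proof (cases "length us = k \<and> length vs = l \<and> length ws = n")
  case True
  have "coldet (us @ vs @ ws) = coldet us * coldet (map (\<lambda>v i. v (k + i)) vs @ map (\<lambda>v i. v (k + i)) ws)"
    using coldet_block_lower_zero[of us k "vs @ ws"] us True by (simp add: add.assoc)
  also have "coldet (map (\<lambda>v i. v (k + i)) vs @ map (\<lambda>v i. v (k + i)) ws)
      = coldet (map (\<lambda>v i. v (k + i)) vs) * coldet (map (\<lambda>v i. v (k + l + i)) ws)"
    using True vs by (subst coldet_block_lower_zero[of _ l]) (auto simp: o_def add.assoc)
  finally show ?thesis using True by (simp add: mult.assoc)
next
  case False
  let ?us = "us @ vs @ ws"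
  have "coldet ?us = 0"
  proof -
    consider "length us > k" | "length vs > l" | "length ws > n" using len False by linarith
    then show ?thesis
    proof cases
      case 1
      show ?thesis
        by (rule coldet_pigeonhole[of "{..<length us}" _ "{..<k}"])
           (use 1 us len in \<open>auto simp: nth_append\<close>)
    next
      case 2
      show ?thesis
      proof (rule coldet_pigeonhole[of "{length us..<length us + length vs}" _ "{k..<k+l}"])
        fix i j assume j: "j \<in> {length us..<length us + length vs}" "i < length ?us" "i \<notin> {k..<k+l}"
        then have "?us ! j \<in> set vs" by (auto simp: nth_append)
        then show "(?us ! j) i = 0" using vs j len by auto
      qed (use 2 in auto)
    next
      case 3
      show ?thesis
      proof (rule coldet_pigeonhole[of "{length us + length vs..<length us + length vs + length ws}" _ "{k+l..<k+l+n}"])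
        fix i j assume j: "j \<in> {length us + length vs..<length us + length vs + length ws}"
          "i < length ?us" "i \<notin> {k+l..<k+l+n}"
        then have "?us ! j \<in> set ws" by (auto simp: nth_append)
        then show "(?us ! j) i = 0" using ws j len by auto
      qed (use 3 in auto)
    qed
  qed
  then show ?thesis using False by auto
qed

lemma coldet_split_columns:
  assumes "distinct xs"
  shows "coldet (us @ map (\<lambda>x i. p x i + q x i) xs @ vs) =
    (\<Sum>S | S \<subseteq> set xs. coldet (us @ map (\<lambda>x. if x \<in> S then p x else q x) xs @ vs))"
  using assms
proof (induction xs arbitrary: us)
  case Nil
  then show ?case by simp
next
  case (Cons x xs)
  let ?f = "\<lambda>S. coldet (us @ map (\<lambda>x. if x \<in> S then p x else q x) (x # xs) @ vs)"
  have x: "x \<notin> set xs" and d: "distinct xs" using Cons.prems by auto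
  have "coldet (us @ map (\<lambda>x i. p x i + q x i) (x # xs) @ vs) =
    coldet ((us @ [p x]) @ map (\<lambda>x i. p x i + q x i) xs @ vs) + coldet ((us @ [q x]) @ map (\<lambda>x i. p x i + q x i) xs @ vs)"
    by (simp add: coldet_add)
  also have "\<dots> = (\<Sum>S\<in>Pow (set xs). ?f (insert x S)) + (\<Sum>S\<in>Pow (set xs). ?f S)"
  proof -
    have 1: "?f (insert x S) = coldet ((us @ [p x]) @ map (\<lambda>x. if x \<in> S then p x else q x) xs @ vs)"
      and 2: "?f S = coldet ((us @ [q x]) @ map (\<lambda>x. if x \<in> S then p x else q x) xs @ vs)"
      if "S \<in> Pow (set xs)" for S
    proof -
      show "?f (insert x S) = coldet ((us @ [p x]) @ map (\<lambda>x. if x \<in> S then p x else q x) xs @ vs)"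
        using x by (auto intro!: arg_cong[of _ _ coldet])
      have "x \<notin> S" using x that by auto
      then show "?f S = coldet ((us @ [q x]) @ map (\<lambda>x. if x \<in> S then p x else q x) xs @ vs)" by simp
    qed
    show ?thesis unfolding Cons.IH[OF d] Pow_def[symmetric] using 1 2 by simp
  qed
  also have "(\<Sum>S\<in>Pow (set xs). ?f (insert x S)) = sum ?f (insert x ` Pow (set xs))"
    by (rule sum.reindex_cong[symmetric, of "insert x"]) (use x in \<open>auto simp: inj_on_def\<close>)
  also have "sum ?f (insert x ` Pow (set xs)) + sum ?f (Pow (set xs)) = sum ?f (Pow (set (x # xs)))"
    unfolding list.simps(15) Pow_insert
    by (subst sum.union_disjoint) (use x in \<open>auto simp: add.commute\<close>)
  finally show ?case unfolding Pow_def .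
qed

definition tripartitions :: "'c set \<Rightarrow> ('c set \<times> 'c set \<times> 'c set) set" where
  "tripartitions X = {(R1, R2, R3). R1 \<union> R2 \<union> R3 = X \<and> R1 \<inter> R2 = {} \<and> R1 \<inter> R3 = {} \<and> R2 \<inter> R3 = {}}"

lemma finite_tripartitions: "finite X \<Longrightarrow> finite (tripartitions X)"
  by (rule finite_subset[of _ "Pow X \<times> Pow X \<times> Pow X"]) (auto simp: tripartitions_def)

text \<open>
  Multilinearity, where each column of the group is a sum of three. This and its analogue for
  sums of two columns produce the index set of the Sylvester sum.
\<close>

lemma coldet_split3_columns:
  fixes xs :: "'c list"
  assumes "distinct xs"
  shows "coldet (us @ map (\<lambda>x i. p x i + q x i + r x i) xs @ vs) =
    (\<Sum>(R1, R2, R3)\<in>tripartitions (set xs).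
      coldet (us @ map (\<lambda>x. if x \<in> R1 then p x else if x \<in> R2 then q x else r x) xs @ vs))"
  using assms
proof (induction xs arbitrary: us)
  case Nil
  have "tripartitions ({}::'c set) = {({}, {}, {})}" by (auto simp: tripartitions_def)
  then show ?case by simp
next
  case (Cons x xs)
  let ?c = "\<lambda>(R1, R2, R3::'c set) x. if x \<in> R1 then p x else if x \<in> R2 then q x else r x"
  let ?f = "\<lambda>T. coldet (us @ map (?c T) (x # xs) @ vs)"
  let ?i1 = "\<lambda>(R1, R2, R3). (insert x R1, R2, R3)" and ?i2 = "\<lambda>(R1, R2, R3). (R1, insert x R2, R3)"
    and ?i3 = "\<lambda>(R1, R2, R3). (R1, R2, insert x R3)"
  let ?T = "tripartitions (set xs)"
  have x: "x \<notin> set xs" and d: "distinct xs" using Cons.prems by auto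
  have eq: "tripartitions (set (x # xs)) = ?i1 ` ?T \<union> ?i2 ` ?T \<union> ?i3 ` ?T" (is "?L = ?R")
  proof
    show "?R \<subseteq> ?L" using x by (fastforce simp: tripartitions_def)
    show "?L \<subseteq> ?R"
    proof
      fix t assume "t \<in> ?L"
      then obtain R1 R2 R3 where t: "t = (R1, R2, R3)" and u: "R1 \<union> R2 \<union> R3 = insert x (set xs)"
        and dj: "R1 \<inter> R2 = {}" "R1 \<inter> R3 = {}" "R2 \<inter> R3 = {}" by (auto simp: tripartitions_def)
      let ?t = "(R1 - {x}, R2 - {x}, R3 - {x})"
      have t': "?t \<in> ?T" using u dj x by (auto simp: tripartitions_def)
      consider "x \<in> R1" | "x \<in> R2" | "x \<in> R3" using u by blast
      then show "t \<in> ?R"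
      proof cases
        case 1 then have "t = ?i1 ?t" using t dj by auto
        then show ?thesis using t' by blast
      next
        case 2 then have "t = ?i2 ?t" using t dj by auto
        then show ?thesis using t' by blast
      next
        case 3 then have "t = ?i3 ?t" using t dj by auto
        then show ?thesis using t' by blast
      qed
    qed
  qed
  have fin: "finite ?T" by (simp add: finite_tripartitions)
  have notin: "x \<notin> R1 \<and> x \<notin> R2 \<and> x \<notin> R3" if "(R1, R2, R3) \<in> ?T" for R1 R2 R3
    using that x by (auto simp: tripartitions_def)
  have col: "map (?c (?i1 T)) (x # xs) = p x # map (?c T) xs"
    "map (?c (?i2 T)) (x # xs) = q x # map (?c T) xs"
    "map (?c (?i3 T)) (x # xs) = r x # map (?c T) xs" if "T \<in> ?T" for T
    using x that notin by (cases T; auto)+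
  have "sum ?f (?i1 ` ?T) = (\<Sum>T\<in>?T. ?f (?i1 T))"
    by (rule sum.reindex_cong[of ?i1]) (auto simp: inj_on_def dest!: notin intro: insert_ident[THEN iffD1])
  moreover have "sum ?f (?i2 ` ?T) = (\<Sum>T\<in>?T. ?f (?i2 T))"
    by (rule sum.reindex_cong[of ?i2]) (auto simp: inj_on_def dest!: notin intro: insert_ident[THEN iffD1])
  moreover have "sum ?f (?i3 ` ?T) = (\<Sum>T\<in>?T. ?f (?i3 T))"
    by (rule sum.reindex_cong[of ?i3]) (auto simp: inj_on_def dest!: notin intro: insert_ident[THEN iffD1])
  moreover have "?f (?i1 T) = coldet ((us @ [p x]) @ map (?c T) xs @ vs)" if "T \<in> ?T" for T
    unfolding col(1)[OF that] by simp
  moreover have "?f (?i2 T) = coldet ((us @ [q x]) @ map (?c T) xs @ vs)" if "T \<in> ?T" for T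
    unfolding col(2)[OF that] by simp
  moreover have "?f (?i3 T) = coldet ((us @ [r x]) @ map (?c T) xs @ vs)" if "T \<in> ?T" for T
    unfolding col(3)[OF that] by simp
  moreover have "sum ?f (tripartitions (set (x # xs))) = sum ?f (?i1 ` ?T) + sum ?f (?i2 ` ?T) + sum ?f (?i3 ` ?T)"
    unfolding eq using fin
    by (subst sum.union_disjoint, simp, simp, use notin in fastforce)+ simp
  ultimately have "sum ?f (tripartitions (set (x # xs))) =
      (\<Sum>T\<in>?T. coldet ((us @ [p x]) @ map (?c T) xs @ vs)) +
      (\<Sum>T\<in>?T. coldet ((us @ [q x]) @ map (?c T) xs @ vs)) +
      (\<Sum>T\<in>?T. coldet ((us @ [r x]) @ map (?c T) xs @ vs))" by simp
  moreover have "coldet (us @ map (\<lambda>x i. p x i + q x i + r x i) (x # xs) @ vs) =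
    coldet ((us @ [p x]) @ map (\<lambda>x i. p x i + q x i + r x i) xs @ vs) +
    coldet ((us @ [q x]) @ map (\<lambda>x i. p x i + q x i + r x i) xs @ vs) +
    coldet ((us @ [r x]) @ map (\<lambda>x i. p x i + q x i + r x i) xs @ vs)"
    by (simp add: coldet_add)
  ultimately show ?case unfolding Cons.IH[OF d] by (simp add: case_prod_unfold)
qed

section \<open>Schur polynomials of multisets\<close>

lemma eval_monomial_superset:
  fixes v :: "nat \<Rightarrow> 'a::comm_ring_1"
  assumes "finite S" "Poly_Mapping.keys e \<subseteq> S"
  shows "(\<Prod>j\<in>Poly_Mapping.keys e. v j ^ Poly_Mapping.lookup e j) = (\<Prod>j\<in>S. v j ^ Poly_Mapping.lookup e j)"
  by (rule prod.mono_neutral_left) (use assms in \<open>auto simp: in_keys_iff\<close>)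

lemma eval_monomial_add:
  fixes v :: "nat \<Rightarrow> 'a::comm_ring_1"
  shows "(\<Prod>j\<in>Poly_Mapping.keys (e + e'). v j ^ Poly_Mapping.lookup (e + e') j) =
    (\<Prod>j\<in>Poly_Mapping.keys e. v j ^ Poly_Mapping.lookup e j) *
    (\<Prod>j\<in>Poly_Mapping.keys e'. v j ^ Poly_Mapping.lookup e' j)"
proof -
  let ?S = "Poly_Mapping.keys e \<union> Poly_Mapping.keys e'"
  have "Poly_Mapping.keys (e + e') \<subseteq> ?S" by (rule keys_add)
  then show ?thesis
    using eval_monomial_superset[of ?S "e + e'" v] eval_monomial_superset[of ?S e v]
      eval_monomial_superset[of ?S e' v]
    by (simp add: lookup_add power_add prod.distrib)
qed

lemma eval_zmpoly_add: "eval_zmpoly v (p + q) = eval_zmpoly v p + eval_zmpoly v q"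
  unfolding eval_zmpoly_def by (rule setsum_keys_plus_distrib) (simp_all add: distrib_right)

lemma eval_zmpoly_0 [simp]: "eval_zmpoly v 0 = 0"
  by (simp add: eval_zmpoly_def)

lemma eval_zmpoly_sum: "eval_zmpoly v (sum f S) = (\<Sum>x\<in>S. eval_zmpoly v (f x))"
  by (induction S rule: infinite_finite_induct) (simp_all add: eval_zmpoly_add)

lemma eval_zmpoly_single: "eval_zmpoly v (Poly_Mapping.single e c) =
    of_int c * (\<Prod>j\<in>Poly_Mapping.keys e. v j ^ Poly_Mapping.lookup e j)"
  by (cases "c = 0") (simp_all add: eval_zmpoly_def)

lemma poly_mapping_sum_single:
  fixes p :: "'c \<Rightarrow>\<^sub>0 int"
  shows "p = (\<Sum>e\<in>Poly_Mapping.keys p. Poly_Mapping.single e (Poly_Mapping.lookup p e))"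
proof (rule poly_mapping_eqI)
  fix k
  have "(\<Sum>e\<in>Poly_Mapping.keys p. Poly_Mapping.lookup (Poly_Mapping.single e (Poly_Mapping.lookup p e)) k)
      = (\<Sum>e\<in>Poly_Mapping.keys p. if k = e then Poly_Mapping.lookup p e else 0)"
    by (intro sum.cong) (auto simp: lookup_single)
  also have "\<dots> = Poly_Mapping.lookup p k" by (auto simp: in_keys_iff)
  finally show "Poly_Mapping.lookup p k = Poly_Mapping.lookup
      (\<Sum>e\<in>Poly_Mapping.keys p. Poly_Mapping.single e (Poly_Mapping.lookup p e)) k"
    by (simp add: lookup_sum)
qed

lemma eval_zmpoly_mult: "eval_zmpoly v (p * q) = eval_zmpoly v p * eval_zmpoly v q"
proof -
  let ?s = "\<lambda>p e. Poly_Mapping.single e (Poly_Mapping.lookup p e)"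
  have "p * q = (\<Sum>e\<in>Poly_Mapping.keys p. \<Sum>e'\<in>Poly_Mapping.keys q. ?s p e * ?s q e')"
    by (simp only: poly_mapping_sum_single[symmetric] sum_product[symmetric])
  then have "eval_zmpoly v (p * q) =
      (\<Sum>e\<in>Poly_Mapping.keys p. \<Sum>e'\<in>Poly_Mapping.keys q. eval_zmpoly v (?s p e) * eval_zmpoly v (?s q e'))"
    by (simp add: eval_zmpoly_sum mult_single eval_zmpoly_single eval_monomial_add mult_ac)
  also have "\<dots> = eval_zmpoly v (sum (?s p) (Poly_Mapping.keys p)) * eval_zmpoly v (sum (?s q) (Poly_Mapping.keys q))"
    by (simp only: eval_zmpoly_sum sum_product)
  finally show ?thesis by (simp only: poly_mapping_sum_single[symmetric])
qed

lemma eval_zmpoly_one: "eval_zmpoly v 1 = 1"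
  using eval_zmpoly_single[of v 0 1] by simp

lemma eval_zmpoly_indet: "eval_zmpoly v (indet j) = v j"
  by (simp add: indet_def eval_zmpoly_single)

lemma comm_ring_hom_eval_zmpoly: "comm_ring_hom (eval_zmpoly v)"
  by unfold_locales (simp_all add: eval_zmpoly_add eval_zmpoly_mult eval_zmpoly_one)

lemma (in comm_ring_hom) hom_eval_zmpoly:
  "hom (eval_zmpoly v p) = eval_zmpoly (\<lambda>j. hom (v j)) p"
  by (simp add: eval_zmpoly_def hom_distribs)

text \<open>
  Submatrices are defined through \<open>pick\<close>; lists of rows are easier to permute.
\<close>

lemma nth_filter_upt_eq_pick:
  assumes "i < length (filter (\<lambda>j. j \<in> I) [0..<k])"
  shows "filter (\<lambda>j. j \<in> I) [0..<k] ! i = pick I i"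
proof -
  let ?xs = "filter (\<lambda>j. j \<in> I) [0..<k]"
  have s: "sorted_wrt (<) ?xs" by (rule sorted_wrt_filter) simp
  have "?xs ! i \<in> set ?xs" using assms by (rule nth_mem)
  then have I: "?xs ! i \<in> I" and lt: "?xs ! i < k" by auto
  have "{a\<in>I. a < ?xs ! i} = (!) ?xs ` {..<i}"
  proof
    show "(!) ?xs ` {..<i} \<subseteq> {a\<in>I. a < ?xs ! i}"
    proof
      fix a assume "a \<in> (!) ?xs ` {..<i}"
      then obtain l where l: "l < i" "a = ?xs ! l" by auto
      then have "a \<in> set ?xs" using assms nth_mem[of l ?xs] by simp
      moreover have "a < ?xs ! i" using sorted_wrt_nth_less[OF s l(1) assms] l by simp
      ultimately show "a \<in> {a\<in>I. a < ?xs ! i}" by auto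
    qed
    show "{a\<in>I. a < ?xs ! i} \<subseteq> (!) ?xs ` {..<i}"
    proof
      fix a assume a: "a \<in> {a\<in>I. a < ?xs ! i}"
      then have "a \<in> set ?xs" using lt by auto
      then obtain l where l: "l < length ?xs" "a = ?xs ! l" by (metis in_set_conv_nth)
      have "l < i"
      proof (rule ccontr)
        assume "\<not> l < i"
        then have "?xs ! i \<le> ?xs ! l"
          using sorted_wrt_nth_less[OF s, of i l] l(1) by (cases "l = i") auto
        then show False using a l by auto
      qed
      then show "a \<in> (!) ?xs ` {..<i}" using l by auto
    qed
  qed
  moreover have "inj_on ((!) ?xs) {..<i}"
    using assms by (auto intro!: inj_on_nth)
  ultimately have "card {a\<in>I. a < ?xs ! i} = i" by (simp add: card_image)
  then show ?thesis using pick_card_in_set[OF I] by simp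
qed

abbreviation kept_rows :: "nat \<Rightarrow> nat set \<Rightarrow> nat list" where
  "kept_rows k R \<equiv> filter (\<lambda>i. Suc i \<notin> R) [0..<k]"

lemma length_kept_rows:
  assumes "R \<subseteq> {1..k}"
  shows "card R + length (kept_rows k R) = k"
proof -
  have "length (kept_rows k R) = card (set (kept_rows k R))" by (simp add: distinct_card del: set_filter)
  also have "set (kept_rows k R) = {i. i < k \<and> Suc i \<notin> R}" by auto
  also have "card \<dots> = card (Suc ` {i. i < k \<and> Suc i \<notin> R})" by (simp add: card_image)
  also have "Suc ` {i. i < k \<and> Suc i \<notin> R} = {1..k} - R"
  proof -
    have "x \<in> Suc ` {i. i < k \<and> Suc i \<notin> R}" if "x \<in> {1..k} - R" for x
      using that by (intro image_eqI[of _ _ "x - 1"]) auto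
    then show ?thesis by auto
  qed
  also have "card \<dots> = k - card R" using assms by (simp add: card_Diff_subset finite_subset)
  finally show ?thesis using card_mono[OF _ assms] by simp
qed

lemma vandermonde_del_eq_mat:
  assumes "R \<subseteq> {1..k}" "card R + length xs = k"
  shows "vandermonde_del k R xs =
    mat (length xs) (length xs) (\<lambda>(i, j). (xs ! j) ^ (k - 1 - kept_rows k R ! i))"
proof -
  have l: "length (kept_rows k R) = length xs" using length_kept_rows[OF assms(1)] assms(2) by simp
  have c: "card {i. i < k \<and> Suc i \<notin> R} = length xs"
  proof -
    have "length (kept_rows k R) = card (set (kept_rows k R))" by (simp add: distinct_card del: set_filter)
    also have "set (kept_rows k R) = {i. i < k \<and> Suc i \<notin> R}" by auto
    finally show ?thesis using l by simp
  qed
  show ?thesis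
  proof (rule eq_matI)
    fix i j assume "i < dim_row (mat (length xs) (length xs) (\<lambda>(i, j). (xs ! j) ^ (k - 1 - kept_rows k R ! i)))"
      "j < dim_col (mat (length xs) (length xs) (\<lambda>(i, j). (xs ! j) ^ (k - 1 - kept_rows k R ! i)))"
    then have i: "i < length xs" and j: "j < length xs" by simp_all
    have p: "kept_rows k R ! i = pick {i. Suc i \<notin> R} i"
      using nth_filter_upt_eq_pick[of i "{i. Suc i \<notin> R}" k] i l by simp
    have "pick {i. Suc i \<notin> R} i < k"
      using pick_le[of i k "{i. Suc i \<notin> R}"] i c by simp
    then show "vandermonde_del k R xs $$ (i, j) =
        mat (length xs) (length xs) (\<lambda>(i, j). (xs ! j) ^ (k - 1 - kept_rows k R ! i)) $$ (i, j)"
      using i j c p by (simp add: vandermonde_del_def submatrix_index vandermonde_def pick_UNIV)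
  qed (use c in \<open>simp_all add: vandermonde_del_def dim_submatrix vandermonde_def\<close>)
qed

lemma det_vandermonde_del_coldet:
  assumes "R \<subseteq> {1..k}" "card R + length xs = k"
  shows "det (vandermonde_del k R xs) = coldet (map (\<lambda>x i. x ^ (k - 1 - kept_rows k R ! i)) xs)"
proof -
  have "mat (length xs) (length xs) (\<lambda>(i, j). (xs ! j) ^ (k - 1 - kept_rows k R ! i)) =
    mat (length xs) (length xs) (\<lambda>(i, j). (map (\<lambda>x i. x ^ (k - 1 - kept_rows k R ! i)) xs ! j) i)"
    by (rule eq_matI) auto
  then show ?thesis by (simp add: vandermonde_del_eq_mat[OF assms] coldet_def)
qed

lemma det_vandermonde_coldet:
  "det (vandermonde (length xs) xs) = coldet (map (\<lambda>x i. x ^ (length xs - 1 - i)) xs)"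
proof -
  have "vandermonde (length xs) xs =
    mat (length xs) (length xs) (\<lambda>(i, j). (map (\<lambda>x i. x ^ (length xs - 1 - i)) xs ! j) i)"
    unfolding vandermonde_def by (rule eq_matI) auto
  then show ?thesis by (simp add: coldet_def)
qed

text \<open>
  The value of the Schur polynomial under an assignment of its variables. Total assignments
  commute with ring homomorphisms, whereas lists leave the variables beyond their end unassigned.
\<close>

definition schur_val :: "nat \<Rightarrow> nat set \<Rightarrow> nat \<Rightarrow> (nat \<Rightarrow> 'a::comm_ring_1) \<Rightarrow> 'a" where
  "schur_val k R r v = eval_zmpoly v (schur_poly k R r)"

lemma (in comm_ring_hom) hom_schur_val: "hom (schur_val k R r v) = schur_val k R r (\<lambda>j. hom (v j))"
  by (simp add: schur_val_def hom_eval_zmpoly)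

lemma schur_val_mult:
  assumes "R \<subseteq> {1..k}" "card R + r = k"
  shows "schur_val k R r v * det (vandermonde r (map v [0..<r])) = det (vandermonde_del k R (map v [0..<r]))"
proof -
  interpret comm_ring_hom "eval_zmpoly v" by (rule comm_ring_hom_eval_zmpoly)
  let ?X = "map indet [0..<r]"
  have "schur_poly k R r * det (vandermonde r ?X) = det (vandermonde_del k R ?X)"
    unfolding schur_poly_def Let_def using theI'[OF schur_poly_ex1[OF assms]] .
  then have "schur_val k R r v * det (map_mat (eval_zmpoly v) (vandermonde r ?X)) =
      det (map_mat (eval_zmpoly v) (vandermonde_del k R ?X))"
    unfolding schur_val_def hom_det by (metis hom_mult)
  moreover have "map_mat (eval_zmpoly v) (vandermonde r ?X) = vandermonde r (map v [0..<r])"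
    by (rule eq_matI) (auto simp: vandermonde_def hom_power eval_zmpoly_indet)
  moreover have "map_mat (eval_zmpoly v) (vandermonde_del k R ?X) = vandermonde_del k R (map v [0..<r])"
    using assms by (subst (1 2) vandermonde_del_eq_mat) (auto simp: hom_power eval_zmpoly_indet)
  ultimately show ?thesis by simp
qed

lemma comm_ring_hom_poly: "comm_ring_hom (\<lambda>p. poly p x)"
  by unfold_locales auto

text \<open>
  For distinct arguments the value is a quotient of two determinants that change sign together
  under a transposition. Arbitrary arguments are made distinct by adding to the \<open>j\<close>-th
  one \<open>s\<^bsup>j+1\<^esup>\<close>, and \<open>s = 0\<close> gives back the original ones. The same argument shows
  that assignments beyond the first \<open>r\<close> variables do not affect the value.
\<close>

lemma schur_val_symmetric:
  fixes v w :: "nat \<Rightarrow> 'a::idom"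
  assumes R: "R \<subseteq> {1..k}" "card R + r = k" and eq: "mset (map v [0..<r]) = mset (map w [0..<r])"
  shows "schur_val k R r v = schur_val k R r w"
proof -
  obtain \<pi> where \<pi>: "\<pi> permutes {..<r}" "permute_list \<pi> (map v [0..<r]) = map w [0..<r]"
    using mset_eq_permutation[OF eq[symmetric]] by auto
  have \<pi>r: "\<pi> j < r" if "j < r" for j using permutes_in_image[OF \<pi>(1), of j] that by simp
  have w: "w j = v (\<pi> j)" if "j < r" for j
    using arg_cong[OF \<pi>(2), of "\<lambda>l. l ! j"] that \<pi>r by (simp add: permute_list_def)
  define v' where "v' j = [:v j:] + monom 1 (Suc j)" for j
  define w' where "w' j = (if j < r then v' (\<pi> j) else [:w j:])" for j
  have inj: "inj v'"
  proof (rule injI, rule ccontr)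
    fix a b assume ab: "v' a = v' b" and ne: "a \<noteq> b"
    have "coeff (v' a) (Suc a) = coeff (v' b) (Suc a)" using ab by simp
    then show False using ne by (simp add: v'_def coeff_pCons)
  qed
  have ms: "mset (map w' [0..<r]) = mset (map v' [0..<r])"
  proof -
    have "permute_list \<pi> (map v' [0..<r]) = map w' [0..<r]"
      by (rule nth_equalityI) (auto simp: permute_list_def w'_def \<pi>r)
    moreover have "mset (permute_list \<pi> (map v' [0..<r])) = mset (map v' [0..<r])"
      using \<pi>(1) by (intro mset_permute_list) simp
    ultimately show ?thesis by simp
  qed
  obtain s :: nat where s: "\<And>F :: 'a poly list \<Rightarrow> 'a poly. alternating F \<Longrightarrow>
      F (map w' [0..<r]) = (-1) ^ s * F (map v' [0..<r])"
    using alternating_mset[OF ms] by blast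
  have alt: "alternating (\<lambda>zs. coldet (map h zs))" for h :: "'a poly \<Rightarrow> nat \<Rightarrow> 'a poly"
    using alternating_context[OF alternating_coldet, of "[]" h "[]"] by simp
  let ?V = "det (vandermonde r (map v' [0..<r]))" and ?W = "det (vandermonde r (map w' [0..<r]))"
  have W: "?W = (-1) ^ s * ?V"
    using det_vandermonde_coldet[of "map v' [0..<r]"] det_vandermonde_coldet[of "map w' [0..<r]"]
      s[OF alt[of "\<lambda>x i. x ^ (r - 1 - i)"]] by simp
  have "det (vandermonde_del k R (map w' [0..<r])) = (-1) ^ s * det (vandermonde_del k R (map v' [0..<r]))"
    using R s[OF alt[of "\<lambda>x i. x ^ (k - 1 - kept_rows k R ! i)"]]
    by (simp add: det_vandermonde_del_coldet del: map_map)
  then have "schur_val k R r w' * ?W = (-1) ^ s * (schur_val k R r v' * ?V)"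
    unfolding schur_val_mult[OF R] .
  then have "schur_val k R r w' * ?V = schur_val k R r v' * ?V"
    unfolding W by (simp add: mult.left_commute)
  moreover have "?V \<noteq> 0"
    using det_vandermonde_nonzero[of "map v' [0..<r]"] inj by (simp add: distinct_map inj_on_subset)
  ultimately have e: "schur_val k R r w' = schur_val k R r v'" by simp
  note hom = comm_ring_hom.hom_schur_val[OF comm_ring_hom_poly[of "0::'a"]]
  have "(\<lambda>j. poly (v' j) 0) = v" by (rule ext) (simp add: v'_def poly_monom)
  moreover have "(\<lambda>j. poly (w' j) 0) = w" by (rule ext) (simp add: w'_def v'_def w poly_monom)
  ultimately show ?thesis using arg_cong[OF e, of "\<lambda>p. poly p 0"] by (simp add: hom)
qed

lemma schur_eq_val:
  fixes v :: "nat \<Rightarrow> 'a::idom"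
  assumes R: "R \<subseteq> {1..k}" "card R + r = k" and X: "mset (map v [0..<r]) = X"
  shows "schur k R X = schur_val k R r v"
proof -
  let ?ys = "SOME xs. mset xs = X"
  have ys: "mset ?ys = X" using X by (rule someI)
  have size: "size X = r" "length ?ys = r" using ys X by (auto dest: arg_cong[of _ _ size])
  have "map ((!) ?ys) [0..<r] = ?ys" using size by (metis map_nth)
  then have "schur_val k R r ((!) ?ys) = schur_val k R r v"
    using R X ys by (intro schur_val_symmetric) simp_all
  then show ?thesis unfolding schur_def schur_val_def using size by simp
qed

text \<open>
  The defining property of the Schur value, valid also for repeated elements, where both
  determinants vanish.
\<close>

lemma schur_mult_vandermonde:
  fixes xs :: "'a::idom list"
  assumes "R \<subseteq> {1..k}" "card R + length xs = k"
  shows "schur k R (mset xs) * det (vandermonde (length xs) xs) = det (vandermonde_del k R xs)"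
proof -
  have "schur k R (mset xs) = schur_val k R (length xs) ((!) xs)"
    by (rule schur_eq_val[OF assms]) (simp add: map_nth)
  then show ?thesis using schur_val_mult[OF assms, of "(!) xs"] by (simp add: map_nth)
qed

lemma hom_schur:
  fixes h :: "'a::idom \<Rightarrow> 'b::idom"
  assumes h: "comm_ring_hom h" and R: "R \<subseteq> {1..k}" "card R + size X = k"
  shows "h (schur k R X) = schur k R (image_mset h X)"
proof -
  interpret comm_ring_hom h by (rule h)
  obtain xs where xs: "mset xs = X" using ex_mset by blast
  then have R': "card R + length xs = k" using R by auto
  have "schur k R X = schur_val k R (length xs) ((!) xs)"
    by (rule schur_eq_val[OF R(1) R']) (simp add: map_nth xs)
  moreover have "schur k R (image_mset h X) = schur_val k R (length xs) (\<lambda>j. h (xs ! j))"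
  proof (rule schur_eq_val[OF R(1) R'])
    have "map (\<lambda>j. h (xs ! j)) [0..<length xs] = map h xs" by (rule nth_equalityI) auto
    then show "mset (map (\<lambda>j. h (xs ! j)) [0..<length xs]) = image_mset h X" by (simp add: xs[symmetric])
  qed
  ultimately show ?thesis by (simp add: hom_schur_val)
qed

section \<open>Unit columns and linear functionals\<close>

text \<open>
  Any alternating function sees the same sign when \<open>1, \<dots>, L\<close> is reordered, so it suffices to
  compute the sign for unit columns, whose determinant is that of a permutation matrix.
\<close>

lemma alternating_listing_perm:
  fixes F :: "nat list \<Rightarrow> 'b::comm_ring_1"
  assumes F: "alternating F" and T: "(R1, R2, R3) \<in> tripartitions {1..L}"
  shows "F [1..<Suc L] = of_int (sign (listing_perm R1 R2 R3)) *
    F (sorted_list_of_set R1 @ sorted_list_of_set R2 @ sorted_list_of_set R3)"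
proof -
  let ?xs = "sorted_list_of_set R1 @ sorted_list_of_set R2 @ sorted_list_of_set R3"
  let ?p = "listing_perm R1 R2 R3" and ?n = "Suc L"
  have un: "R1 \<union> R2 \<union> R3 = {1..L}" and dj: "R1 \<inter> R2 = {}" "R1 \<inter> R3 = {}" "R2 \<inter> R3 = {}"
    using T by (auto simp: tripartitions_def)
  have fin: "finite R1" "finite R2" "finite R3" using un by (metis finite_Un finite_atLeastAtMost)+
  have set: "set ?xs = {1..L}" using fin un by auto
  have dist: "distinct ?xs" using fin dj by auto
  have len: "length ?xs = L" using distinct_card[OF dist] set by simp
  have p: "?p i = ?xs ! (i - 1)" if "i \<in> {1..L}" for i
    using that len unfolding listing_perm_def Let_def by simp
  have pout: "?p i = i" if "i \<notin> {1..L}" for i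
    using that len unfolding listing_perm_def Let_def by auto
  have "bij_betw ?p {1..L} {1..L}"
  proof -
    have "bij_betw (\<lambda>i. ?xs ! i) {..<L} {1..L}"
      using bij_betw_nth[OF dist _ set[symmetric]] len by auto
    moreover have "bij_betw (\<lambda>i. i - 1) {1..L} {..<L}"
      by (rule bij_betwI[where g = Suc]) auto
    ultimately have "bij_betw ((\<lambda>i. ?xs ! i) \<circ> (\<lambda>i. i - 1)) {1..L} {1..L}"
      by (rule bij_betw_trans[rotated])
    then show ?thesis by (rule bij_betw_cong[THEN iffD1, rotated]) (simp add: p)
  qed
  then have "?p permutes {1..L}" by (rule bij_imp_permutes) (rule pout)
  then have perm: "?p permutes {0..<?n}" by (rule permutes_subset) auto
  have ms: "mset [1..<?n] = mset ?xs"
    using dist set by (intro set_eq_iff_mset_eq_distinct[THEN iffD1]) auto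
  obtain k :: nat where k: "\<And>F :: nat list \<Rightarrow> 'b. alternating F \<Longrightarrow> F [1..<?n] = (-1) ^ k * F ?xs"
    using alternating_mset[OF ms] by blast
  \<comment> \<open>The column in front makes the listing a permutation of \<open>{0..L}\<close>, which is how rows are counted.\<close>
  define G :: "nat list \<Rightarrow> 'b" where "G zs = coldet (map (\<lambda>r i. if i = r then 1 else 0) (0 # zs))" for zs
  have "alternating G" unfolding G_def
    using alternating_context[OF alternating_coldet, of "[\<lambda>i. if i = 0 then 1 else 0]" "\<lambda>r i. if i = r then 1 else 0" "[]"]
    by simp
  then have "G [1..<?n] = (-1) ^ k * G ?xs" by (rule k)
  moreover have "G [1..<?n] = 1"
  proof -
    have "0 # [1..<?n] = [0..<?n]" by (simp add: upt_conv_Cons del: upt_Suc)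
    then show ?thesis unfolding G_def by (simp only: coldet_unit)
  qed
  moreover have "G ?xs = of_int (sign ?p)"
  proof -
    have p': "(0 # ?xs) ! j = ?p j" if "j < ?n" for j
      using that p[of j] pout[of j] by (cases j) auto
    have "G ?xs = coldet (map (\<lambda>i j. (map (\<lambda>r i. if i = r then 1 else 0) (0 # ?xs) ! j) i) [0..<?n])"
    proof -
      have "length (map (\<lambda>r i. if i = r then 1 else (0::'b)) (0 # ?xs)) = ?n" using len by simp
      then show ?thesis
        unfolding G_def using coldet_transpose[of "map (\<lambda>r i. if i = r then 1 else (0::'b)) (0 # ?xs)"] by metis
    qed
    also have "\<dots> = det (mat ?n ?n (\<lambda>(i, j). (1\<^sub>m ?n) $$ (?p i, j)))"
    proof -
      have "mat ?n ?n (\<lambda>(i, j). (map (\<lambda>i j. (map (\<lambda>r i. if i = r then 1 else 0) (0 # ?xs) ! j) i) [0..<?n] ! j) i) =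
        mat ?n ?n (\<lambda>(i, j). (1\<^sub>m ?n :: 'b mat) $$ (?p i, j))"
      proof (rule eq_matI)
        fix i j assume "i < dim_row (mat ?n ?n (\<lambda>(i, j). (1\<^sub>m ?n :: 'b mat) $$ (?p i, j)))"
          "j < dim_col (mat ?n ?n (\<lambda>(i, j). (1\<^sub>m ?n :: 'b mat) $$ (?p i, j)))"
        then have i: "i < ?n" and j: "j < ?n" by auto
        have "?p i < ?n" using permutes_in_image[OF perm, of i] i by simp
        moreover have "map (\<lambda>r i. if i = r then 1 else 0) (0 # ?xs) ! i = (\<lambda>j. if j = (0 # ?xs) ! i then 1 else (0::'b))"
          using i len by (subst nth_map) auto
        ultimately show "mat ?n ?n (\<lambda>(i, j). (map (\<lambda>i j. (map (\<lambda>r i. if i = r then 1 else 0) (0 # ?xs) ! j) i) [0..<?n] ! j) i) $$ (i, j)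
          = mat ?n ?n (\<lambda>(i, j). (1\<^sub>m ?n :: 'b mat) $$ (?p i, j)) $$ (i, j)"
          using i j p'[OF i] by (simp del: upt_Suc list.map)
      qed auto
      then show ?thesis by (simp add: coldet_def del: upt_Suc)
    qed
    also have "\<dots> = of_int (sign ?p)"
      by (subst det_permute_rows[OF _ perm]) auto
    finally show ?thesis .
  qed
  ultimately have "(-1) ^ k * of_int (sign ?p) = (1 :: 'b)" by simp
  then have "(-1) ^ k = (of_int (sign ?p) :: 'b)"
    by (cases ?p rule: sign_cases) (simp_all, metis minus_minus)
  then show ?thesis using k[OF F] by simp
qed

text \<open>
  The number of inversions created by moving the elements of \<open>R\<close> in front of the other positive
  integers.
\<close>

definition displacement :: "nat set \<Rightarrow> nat" where
  "displacement R = (\<Sum>r\<in>R. card ({1..<r} - R))"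

text \<open>
  The \<open>j\<close>-th smallest element \<open>r\<close> of \<open>R\<close> passes \<open>r - j\<close> elements.
\<close>

lemma displacement_eq:
  assumes "finite R" "0 \<notin> R"
  shows "displacement R + card R * (card R + 1) div 2 = \<Sum>R"
  using assms
proof (induction R rule: finite_linorder_max_induct)
  case (insert b A)
  have b: "b \<notin> A" using insert.hyps(2) by blast
  have A: "A \<subseteq> {1..<b}" using insert.hyps(2) insert.prems by (auto simp: Suc_le_eq intro: gr0I)
  have "card ({1..<r} - insert b A) = card ({1..<r} - A)" if "r \<in> A" for r
    using that insert.hyps(2) by (intro arg_cong[of _ _ card]) auto
  moreover have "{1..<b} - insert b A = {1..<b} - A" by auto
  moreover have "card ({1..<b} - A) = b - 1 - card A"
    using A insert.hyps(1) by (simp add: card_Diff_subset)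
  ultimately have "displacement (insert b A) = (b - 1 - card A) + displacement A"
    unfolding displacement_def using insert.hyps(1) b by simp
  moreover have "card A \<le> b - 1" using card_mono[OF _ A] by simp
  moreover have "b > 0" using insert.prems by auto
  moreover have "(card A + 1) * (card A + 1 + 1) div 2 = card A * (card A + 1) div 2 + (card A + 1)"
    by (simp add: algebra_simps)
  ultimately show ?case using insert.IH insert.prems insert.hyps(1) b by simp
qed (simp add: displacement_def)

text \<open>
  Deleting the rows in \<open>R\<close> amounts to adjoining the unit columns of these rows in front. Rows are
  counted from 1 in \<open>R\<close> and from 0 in the matrix.
\<close>

lemma coldet_unit_columns:
  fixes cols :: "(nat \<Rightarrow> 'a::idom) list"
  assumes R: "R \<subseteq> {1..N}" and N: "card R + length cols = N"
  shows "coldet (map (\<lambda>r i. if Suc i = r then 1 else 0) (sorted_list_of_set R) @ cols) =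
    (-1) ^ displacement R * coldet (map (\<lambda>c i. c (kept_rows N R ! i)) cols)"
proof -
  let ?es = "map (\<lambda>r i. if Suc i = r then 1 else 0) (sorted_list_of_set R) :: (nat \<Rightarrow> 'a) list"
  let ?us = "?es @ cols" and ?r = "card R"
  have fR: "finite R" using R finite_subset by blast
  have len: "length ?us = N" using N fR by simp
  define F where "F zs = coldet (map (\<lambda>i j. (?us ! j) i) zs)" for zs
  have alt: "alternating F" unfolding F_def
    using alternating_context[OF alternating_coldet, of "[]" "\<lambda>i j. (?us ! j) i" "[]"] by simp
  let ?in = "filter (\<lambda>i. i \<in> {i. Suc i \<in> R}) [0..<N]" and ?out = "filter (\<lambda>i. i \<notin> {i. Suc i \<in> R}) [0..<N]"
  have out: "?out = kept_rows N R" by simp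
  have pos: "Suc (r - Suc 0) = r" "r - Suc 0 < N" if "r \<in> R" for r
    using subsetD[OF R that] by auto
  have lout: "length ?out = length cols" using length_kept_rows[OF R] N by simp
  have smap: "map Suc ?in = sorted_list_of_set R"
  proof (rule sorted_distinct_set_unique)
    show "sorted (map Suc ?in)" by (simp add: sorted_map sorted_wrt_filter)
    have "x \<in> Suc ` {i. i < N \<and> Suc i \<in> R}" if "x \<in> R" for x
    proof (rule image_eqI[of _ _ "x - 1"])
      have "x \<in> {1..N}" using that R by blast
      then show "x = Suc (x - 1)" "x - 1 \<in> {i. i < N \<and> Suc i \<in> R}" using that by auto
    qed
    then show "set (map Suc ?in) = set (sorted_list_of_set R)" using R fR by auto
  qed (simp_all add: distinct_map)
  have lin: "length ?in = ?r" using arg_cong[OF smap, of length] fR by simp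
  have disp: "(\<Sum>i\<in>{i\<in>{i. Suc i \<in> R}. i < N}. card {j. j < i \<and> j \<notin> {i. Suc i \<in> R}}) = displacement R"
    unfolding displacement_def
  proof (rule sum.reindex_bij_witness[of _ "\<lambda>r. r - 1" Suc])
    fix a assume "a \<in> {i\<in>{i. Suc i \<in> R}. i < N}"
    have "{1..<Suc a} - R = Suc ` {j. j < a \<and> j \<notin> {i. Suc i \<in> R}}"
    proof -
      have "x \<in> Suc ` {j. j < a \<and> j \<notin> {i. Suc i \<in> R}}" if "x \<in> {1..<Suc a} - R" for x
        using that by (intro image_eqI[of _ _ "x - 1"]) auto
      then show ?thesis by auto
    qed
    then show "card ({1..<Suc a} - R) = card {j. j < a \<and> j \<notin> {i. Suc i \<in> R}}"
      by (simp add: card_image)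
  qed (use pos in auto)
  let ?zs = "?in @ ?out"
  have lz: "length ?zs = N" using lin lout N by simp
  have "coldet ?us = F [0..<N]"
    unfolding F_def using coldet_transpose[of ?us] len by simp
  also have "\<dots> = (-1) ^ displacement R * F ?zs"
    using alternating_upt_split[OF alt, of N "{i. Suc i \<in> R}"] unfolding disp .
  also have "F ?zs = coldet (map (\<lambda>u j. u (?zs ! j)) ?us)"
    unfolding F_def
    by (subst coldet_transpose, rule coldet_cong) (use lz len in \<open>auto simp del: map_append\<close>)
  also have "\<dots> = coldet (map (\<lambda>u j. u (?zs ! j)) ?es) *
      coldet (map (\<lambda>v i. v (?r + i)) (map (\<lambda>u j. u (?zs ! j)) cols))"
    unfolding map_append
  proof (rule coldet_block_lower_zero)
    show "length (map (\<lambda>u j. u (?zs ! j)) ?es) = ?r" using fR by simp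
    fix u i assume "u \<in> set (map (\<lambda>u j. u (?zs ! j)) ?es)"
      and i: "?r \<le> i" "i < ?r + length (map (\<lambda>u j. u (?zs ! j)) cols)"
    then obtain r where r: "r \<in> R" "u = (\<lambda>j. if Suc (?zs ! j) = r then 1 else 0)" using fR by auto
    have "?zs ! i = ?out ! (i - ?r)" using i lin by (simp add: nth_append)
    moreover have "?out ! (i - ?r) \<in> set ?out" using i lout by (intro nth_mem) simp
    ultimately show "u i = 0" using r by auto
  qed
  also have "coldet (map (\<lambda>u j. u (?zs ! j)) ?es) = 1"
  proof -
    have "coldet (map (\<lambda>u j. u (?zs ! j)) ?es) = coldet (map (\<lambda>r i. if i = r then 1 else 0) [0..<?r])"
    proof (rule coldet_cong)
      fix i j assume "i < length (map (\<lambda>u j. u (?zs ! j)) ?es)" "j < length (map (\<lambda>u j. u (?zs ! j)) ?es)"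
      then have i: "i < ?r" and j: "j < ?r" using fR by auto
      have "Suc (?zs ! i) = sorted_list_of_set R ! i"
        using arg_cong[OF smap, of "\<lambda>l. l ! i"] i lin by (simp add: nth_append)
      moreover have "sorted_list_of_set R ! i = sorted_list_of_set R ! j \<longleftrightarrow> i = j"
        using i j fR by (intro nth_eq_iff_index_eq) auto
      ultimately show "(map (\<lambda>u j. u (?zs ! j)) ?es ! j) i = (map (\<lambda>r i. if i = r then 1 else 0) [0..<?r] ! j) i"
        using i j fR by simp
    qed (use fR in simp)
    then show ?thesis by simp
  qed
  also have "coldet (map (\<lambda>v i. v (?r + i)) (map (\<lambda>u j. u (?zs ! j)) cols)) =
      coldet (map (\<lambda>c i. c (kept_rows N R ! i)) cols)"
    by (rule coldet_cong) (use lin in \<open>auto simp: nth_append\<close>)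
  finally show ?thesis by simp
qed

definition linear_functional :: "('a::comm_ring_1 poly \<Rightarrow> 'a) \<Rightarrow> bool" where
  "linear_functional \<phi> \<longleftrightarrow> (\<forall>p q. \<phi> (p + q) = \<phi> p + \<phi> q) \<and> (\<forall>c p. \<phi> (smult c p) = c * \<phi> p)"

lemma linear_functional_expand:
  assumes \<phi>: "linear_functional \<phi>" and p: "\<And>c. c \<ge> N \<Longrightarrow> coeff p c = 0"
  shows "\<phi> p = (\<Sum>c<N. coeff p c * \<phi> (monom 1 c))"
proof -
  have add: "\<phi> (p + q) = \<phi> p + \<phi> q" and smult: "\<phi> (smult c p) = c * \<phi> p" for p q c
    using \<phi> by (auto simp: linear_functional_def)
  have zero: "\<phi> 0 = 0" using smult[of 0 0] by simp
  have sum: "\<phi> (sum f S) = (\<Sum>x\<in>S. \<phi> (f x))" if "finite S" for f and S :: "nat set"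
    using that by (induction S) (simp_all add: add zero)
  have "p = (\<Sum>c<N. smult (coeff p c) (monom 1 c))"
    by (rule poly_eqI) (auto simp: coeff_sum smult_monom p not_less)
  then have "\<phi> p = \<phi> (\<Sum>c<N. smult (coeff p c) (monom 1 c))" by simp
  then show ?thesis by (simp add: sum smult)
qed

lemma linear_functional_coeff: "linear_functional (\<lambda>p. coeff p c)"
  by (simp add: linear_functional_def)

lemma linear_functional_eval: "linear_functional (\<lambda>p. poly p x)"
  by (simp add: linear_functional_def)

text \<open>
  A linear functional on polynomials of degree below \<open>N\<close> is a combination of the coefficient
  functionals, its values on the monomials being the weights. The columns \<open>es\<close> are carried along unchanged.
\<close>

lemma coldet_functionals:
  fixes ps :: "'a::idom poly list"
  assumes ps: "\<And>p c. p \<in> set ps \<Longrightarrow> c \<ge> N \<Longrightarrow> coeff p c = 0" "length ps = N + length es"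
    and \<Phi>: "length \<Phi> = N" "\<And>\<phi>. \<phi> \<in> set \<Phi> \<Longrightarrow> linear_functional \<phi>"
  shows "coldet (map (\<lambda>\<phi> i. \<phi> (ps ! i)) \<Phi> @ es) =
    coldet (map (\<lambda>c i. coeff (ps ! i) (N - 1 - c)) [0..<N] @ es) * coldet (map (\<lambda>\<phi> i. \<phi> (monom 1 (N - 1 - i))) \<Phi>)"
proof -
  let ?l = "length es"
  let ?vs = "map (\<lambda>c i. coeff (ps ! i) (N - 1 - c)) [0..<N] @ es"
  let ?w1 = "map (\<lambda>\<phi> c. if c < N then \<phi> (monom 1 (N - 1 - c)) else 0) \<Phi>"
  let ?w2 = "map (\<lambda>l c. if c = N + l then 1 else (0::'a)) [0..<?l]"
  let ?us = "map (\<lambda>\<phi> i. \<phi> (ps ! i)) \<Phi> @ es"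
  have "coldet ?us = coldet ?vs * coldet (?w1 @ ?w2)"
  proof (rule coldet_combination)
    fix i j assume i: "i < N + ?l" and j: "j < N + ?l"
    show "(?us ! j) i = (\<Sum>c<N + ?l. (?vs ! c) i * ((?w1 @ ?w2) ! j) c)"
    proof (cases "j < N")
      case True
      have "ps ! i \<in> set ps" using i ps(2) by simp
      moreover have "\<Phi> ! j \<in> set \<Phi>" using True \<Phi>(1) by simp
      ultimately have "(\<Phi> ! j) (ps ! i) = (\<Sum>c<N. coeff (ps ! i) c * (\<Phi> ! j) (monom 1 c))"
        by (intro linear_functional_expand \<Phi> ps)
      also have "\<dots> = (\<Sum>c<N. coeff (ps ! i) (N - 1 - c) * (\<Phi> ! j) (monom 1 (N - 1 - c)))"
        using sum.nat_diff_reindex[of "\<lambda>c. coeff (ps ! i) c * (\<Phi> ! j) (monom 1 c)" N] by simp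
      also have "\<dots> = (\<Sum>c<N. (?vs ! c) i * ((?w1 @ ?w2) ! j) c)"
        by (rule sum.cong) (use True \<Phi>(1) in \<open>auto simp: nth_append\<close>)
      also have "\<dots> = (\<Sum>c<N + ?l. (?vs ! c) i * ((?w1 @ ?w2) ! j) c)"
        by (rule sum.mono_neutral_left) (use True \<Phi>(1) in \<open>auto simp: nth_append\<close>)
      finally show ?thesis using True \<Phi>(1) by (simp add: nth_append)
    next
      case False
      have "(\<Sum>c<N + ?l. (?vs ! c) i * ((?w1 @ ?w2) ! j) c) = (\<Sum>c<N + ?l. if c = j then (?vs ! c) i else 0)"
        by (rule sum.cong) (use False j \<Phi>(1) in \<open>auto simp: nth_append\<close>)
      also have "\<dots> = (?vs ! j) i" using j by simp
      finally show ?thesis using False j \<Phi>(1) by (simp add: nth_append)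
    qed
  qed (use \<Phi>(1) in auto)
  also have "coldet (?w1 @ ?w2) = coldet ?w1 * coldet (map (\<lambda>v i. v (N + i)) ?w2)"
    by (rule coldet_block_lower_zero) (use \<Phi>(1) in auto)
  also have "coldet (map (\<lambda>v i. v (N + i)) ?w2) = 1"
  proof -
    have "map (\<lambda>v i. v (N + i)) ?w2 = map (\<lambda>r i. if i = r then 1 else (0::'a)) [0..<?l]" by auto
    then show ?thesis by (simp only: coldet_unit)
  qed
  also have "coldet ?w1 = coldet (map (\<lambda>\<phi> i. \<phi> (monom 1 (N - 1 - i))) \<Phi>)"
    by (rule coldet_cong) (use \<Phi>(1) in auto)
  finally show ?thesis by simp
qed

lemma coldet_unitriangular:
  assumes "\<And>i j. j < i \<Longrightarrow> i < length us \<Longrightarrow> (us ! j) i = 0" "\<And>i. i < length us \<Longrightarrow> (us ! i) i = 1"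
  shows "coldet us = 1"
proof -
  let ?A = "mat (length us) (length us) (\<lambda>(i, j). (us ! j) i)"
  have "det ?A = prod_list (diag_mat ?A)"
    by (rule det_upper_triangular) (use assms(1) in auto)
  also have "diag_mat ?A = replicate (length us) 1"
    by (rule nth_equalityI) (auto simp: diag_mat_def assms(2))
  finally show ?thesis by (simp add: coldet_def)
qed

section \<open>Schur polynomials as determinants of functionals on multiples of a polynomial\<close>

definition root_poly :: "'a::comm_ring_1 multiset \<Rightarrow> 'a poly" where
  "root_poly B = (\<Prod>b\<in>#B. [:- b, 1:])"

abbreviation vdm :: "'a::comm_ring_1 list \<Rightarrow> 'a" where
  "vdm xs \<equiv> det (vandermonde (length xs) xs)"

lemma root_poly_monic:
  fixes B :: "'a::idom multiset"
  shows "degree (root_poly B) = size B" "coeff (root_poly B) (size B) = 1"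
proof -
  have "degree (root_poly B) = size B \<and> lead_coeff (root_poly B) = 1"
  proof (induction B)
    case (add b B)
    have "root_poly B \<noteq> 0" using add by auto
    then have "degree (root_poly (add_mset b B)) = size (add_mset b B)"
      using add unfolding root_poly_def
      by (simp add: degree_mult_eq del: mult_pCons_left)
    moreover have "lead_coeff (root_poly (add_mset b B)) = 1"
    proof -
      have 1: "lead_coeff [:- b, 1:] = 1" by simp
      have 2: "lead_coeff (root_poly B) = 1" using add by (rule conjunct2)
      have "root_poly (add_mset b B) = [:- b, 1:] * root_poly B" by (simp add: root_poly_def)
      then have "lead_coeff (root_poly (add_mset b B)) = lead_coeff [:- b, 1:] * lead_coeff (root_poly B)"
        by (simp only: lead_coeff_mult)
      then show ?thesis by (simp only: 1 2 mult_1_left)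
    qed
    ultimately show ?case by simp
  qed (simp add: root_poly_def)
  then show "degree (root_poly B) = size B" "coeff (root_poly B) (size B) = 1" by metis+
qed

lemma poly_root_poly: "poly (root_poly B) x = (\<Prod>b\<in>#B. x - b)"
  by (induction B) (auto simp: root_poly_def algebra_simps)

lemma diff_prod_eq_poly: "diff_prod X B = (\<Prod>x\<in>#X. poly (root_poly B) x)"
  by (simp add: diff_prod_def poly_root_poly)

lemma diff_prod_simps [simp]:
  "diff_prod {#} Y = 1" "diff_prod X {#} = 1"
  by (simp_all add: diff_prod_def)

lemma diff_prod_add_left: "diff_prod (X + X') Y = diff_prod X Y * diff_prod X' Y"
  by (simp add: diff_prod_def)

lemma diff_prod_add_right: "diff_prod X (Y + Y') = diff_prod X Y * diff_prod X Y'"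
  by (simp add: diff_prod_def prod_mset.distrib)

lemma diff_prod_swap: "diff_prod X Y = (-1) ^ (size X * size Y) * diff_prod Y X"
proof (induction X)
  case (add x X)
  have 1: "diff_prod {#x#} Y = (-1) ^ size Y * diff_prod Y {#x#}" for x
  proof (induction Y)
    case (add y Y)
    then show ?case
      using diff_prod_add_right[of "{#x#}" "{#y#}" Y] by (simp add: diff_prod_def algebra_simps)
  qed simp
  have "diff_prod Y (add_mset x X) = diff_prod Y {#x#} * diff_prod Y X"
    using diff_prod_add_right[of Y "{#x#}" X] by simp
  moreover have "diff_prod (add_mset x X) Y = diff_prod {#x#} Y * diff_prod X Y"
    using diff_prod_add_left[of "{#x#}" X Y] by simp
  ultimately show ?case using add 1[of x] by (simp add: power_add mult_ac)
qed simp

lemma (in comm_ring_hom) hom_diff_prod: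
  "hom (diff_prod X Y) = diff_prod (image_mset hom X) (image_mset hom Y)"
  by (simp add: diff_prod_def hom_prod_mset hom_distribs image_mset.compositionality o_def)

lemma root_poly_add_mset: "root_poly (add_mset b B) = [:- b, 1:] * root_poly B"
  by (simp add: root_poly_def)

lemma (in comm_ring_hom) map_poly_hom_mult:
  "map_poly hom (p * q) = map_poly hom p * map_poly hom q"
  by (induction p) (auto simp: hom_distribs)

lemma (in comm_ring_hom) hom_root_poly:
  "map_poly hom (root_poly B) = root_poly (image_mset hom B)"
proof (induction B)
  case (add b B)
  have "map_poly hom [:- b, 1:] = [:- hom b, 1:]" by (simp add: hom_distribs)
  then show ?case
    by (simp only: root_poly_add_mset map_poly_hom_mult image_mset_add_mset add.IH)
qed (simp add: root_poly_def)

lemma (in comm_ring_hom) hom_coldet: "hom (coldet us) = coldet (map (\<lambda>u i. hom (u i)) us)"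
proof -
  have "map_mat hom (mat (length us) (length us) (\<lambda>(i, j). (us ! j) i)) =
    mat (length us) (length us) (\<lambda>(i, j). (map (\<lambda>u i. hom (u i)) us ! j) i)"
    by (rule eq_matI) auto
  then show ?thesis by (simp add: coldet_def flip: hom_det)
qed

lemma (in comm_ring_hom) hom_vandermonde: "hom (vdm xs) = vdm (map hom xs)"
proof -
  have "map_mat hom (vandermonde (length xs) xs) = vandermonde (length xs) (map hom xs)"
    by (rule eq_matI) (auto simp: vandermonde_def hom_power)
  then show ?thesis by (simp flip: hom_det)
qed

text \<open>
  The determinant of coefficient functionals and evaluations on the multiples
  \<open>x\<^bsup>k-1\<^esup>g, \<dots>, x g, g\<close> of the polynomial \<open>g\<close> with roots \<open>B\<close>.
\<close>

definition schur_coldet :: "nat \<Rightarrow> nat \<Rightarrow> nat set \<Rightarrow> 'a multiset \<Rightarrow> 'a list \<Rightarrow> 'a::comm_ring_1" where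
  "schur_coldet N k R B xs = coldet
    (map (\<lambda>r i. coeff (monom 1 (k - 1 - i) * root_poly B) (N - r)) (sorted_list_of_set R) @
     map (\<lambda>x i. poly (monom 1 (k - 1 - i) * root_poly B) x) xs)"

lemma hom_schur_coldet:
  assumes "comm_ring_hom h"
  shows "h (schur_coldet N k R B xs) = schur_coldet N k R (image_mset h B) (map h xs)"
proof -
  interpret comm_ring_hom h by (rule assms)
  have m: "monom 1 e * root_poly (image_mset h B) = map_poly h (monom 1 e * root_poly B)" for e
    by (simp add: map_poly_hom_mult hom_root_poly)
  show ?thesis
    unfolding schur_coldet_def hom_coldet m
    by (intro arg_cong[of _ _ coldet]) (simp add: o_def)
qed

text \<open>
  Together with \<open>x\<^bsup>n-1\<^esup>, \<dots>, 1\<close>, the multiples of \<open>g\<close> form a basis of the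
  polynomials of degree below \<open>N\<close> which is unitriangular over the monomials. On the monomials
  the functionals give the Vandermonde matrix with unit columns in front. On this basis the evaluations at the roots of \<open>g\<close> vanish on
  the multiples of \<open>g\<close>, so the determinant is block triangular.
\<close>

lemma schur_coldet_mult_vandermonde:
  fixes xs bs :: "'a::idom list"
  assumes R: "R \<subseteq> {1..N}" and k: "card R + length xs = k" and N: "N = k + length bs"
  shows "schur_coldet N k R (mset bs) xs * vdm bs = (-1) ^ displacement R * det (vandermonde_del N R (xs @ bs))"
proof -
  let ?g = "root_poly (mset bs)" and ?n = "length bs"
  let ?es = "\<lambda>r p. coeff p (N - r)" and ?ev = "\<lambda>x p. poly p x"
  let ?Rs = "sorted_list_of_set R"
  have fR: "finite R" using R finite_subset by blast
  define \<Phi> where "\<Phi> = map ?es ?Rs @ map ?ev (xs @ bs)"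
  define ps where "ps = map (\<lambda>i. monom 1 (k - 1 - i) * ?g) [0..<k] @ map (\<lambda>i. monom 1 (?n - 1 - i)) [0..<?n]"
  have l\<Phi>: "length \<Phi> = N" using k N fR by (simp add: \<Phi>_def)
  have lps: "length ps = N" using N by (simp add: ps_def)
  have ps1: "ps ! i = monom 1 (k - 1 - i) * ?g" if "i < k" for i
    using that by (simp add: ps_def nth_append)
  have ps2: "ps ! i = monom 1 (N - 1 - i)" if "k \<le> i" "i < N" for i
  proof -
    have "i - k < ?n" "?n - 1 - (i - k) = N - 1 - i" using that N by auto
    then show ?thesis using that by (simp add: ps_def nth_append)
  qed
  have deg: "degree (ps ! i) \<le> N - 1 - i \<and> coeff (ps ! i) (N - 1 - i) = 1" if i: "i < N" for i
  proof (cases "i < k")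
    case True
    have "coeff (ps ! i) c = 0" if "c > N - 1 - i" for c
    proof -
      have "c - (k - 1 - i) > degree ?g" using that True N root_poly_monic(1)[of "mset bs"] by simp
      then show ?thesis unfolding ps1[OF True] by (simp add: coeff_monom_mult coeff_eq_0)
    qed
    moreover have "N - 1 - i - (k - 1 - i) = size (mset bs)" using True N by simp
    then have "coeff (ps ! i) (N - 1 - i) = 1"
      unfolding ps1[OF True] using True N root_poly_monic(2)[of "mset bs"] by (simp add: coeff_monom_mult)
    ultimately show ?thesis by (metis degree_le)
  next
    case False
    then show ?thesis using ps2[of i] i by (simp add: degree_monom_le)
  qed
  have "coldet (map (\<lambda>\<phi> i. \<phi> (ps ! i)) \<Phi> @ []) =
    coldet (map (\<lambda>c i. coeff (ps ! i) (N - 1 - c)) [0..<N] @ []) * coldet (map (\<lambda>\<phi> i. \<phi> (monom 1 (N - 1 - i))) \<Phi>)"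
  proof (rule coldet_functionals)
    fix p c assume "p \<in> set ps" "N \<le> c"
    then obtain i where i: "i < N" "p = ps ! i" using lps by (metis in_set_conv_nth)
    have "degree (ps ! i) \<le> N - 1 - i" using deg[OF i(1)] by (rule conjunct1)
    then have "degree (ps ! i) < c" using i(1) \<open>N \<le> c\<close> by linarith
    then show "coeff p c = 0" unfolding i(2) by (rule coeff_eq_0)
  next
    fix \<phi> assume "\<phi> \<in> set \<Phi>"
    then show "linear_functional \<phi>"
      by (auto simp: \<Phi>_def linear_functional_coeff linear_functional_eval)
  qed (use lps l\<Phi> in auto)
  also have "coldet (map (\<lambda>c i. coeff (ps ! i) (N - 1 - c)) [0..<N] @ []) = 1"
  proof (rule coldet_unitriangular)
    fix i j assume "j < i" "i < length (map (\<lambda>c i. coeff (ps ! i) (N - 1 - c)) [0..<N] @ [])"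
    then show "((map (\<lambda>c i. coeff (ps ! i) (N - 1 - c)) [0..<N] @ []) ! j) i = 0"
      using deg[of i] by (auto intro!: coeff_eq_0)
  qed (use deg in auto)
  also have "coldet (map (\<lambda>\<phi> i. \<phi> (monom 1 (N - 1 - i))) \<Phi>) =
     coldet (map (\<lambda>r i. if Suc i = r then 1 else 0) ?Rs @ map (\<lambda>x i. x ^ (N - 1 - i)) (xs @ bs))"
  proof (rule coldet_cong)
    fix i j assume "i < length (map (\<lambda>\<phi> i. \<phi> (monom 1 (N - 1 - i))) \<Phi>)" "j < length (map (\<lambda>\<phi> i. \<phi> (monom 1 (N - 1 - i))) \<Phi>)"
    then have i: "i < N" and j: "j < N" using l\<Phi> by auto
    show "(map (\<lambda>\<phi> i. \<phi> (monom 1 (N - 1 - i))) \<Phi> ! j) i =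
      ((map (\<lambda>r i. if Suc i = r then 1 else 0) ?Rs @ map (\<lambda>x i. x ^ (N - 1 - i)) (xs @ bs)) ! j) i"
    proof (cases "j < card R")
      case True
      then have "?Rs ! j \<in> R" using fR by (metis nth_mem length_sorted_list_of_set set_sorted_list_of_set)
      then have "1 \<le> ?Rs ! j" "?Rs ! j \<le> N" using R by auto
      then have "N - 1 - i = N - ?Rs ! j \<longleftrightarrow> Suc i = ?Rs ! j" using i by auto
      then show ?thesis using True j l\<Phi> fR by (simp add: \<Phi>_def nth_append)
    next
      case False
      then show ?thesis using j l\<Phi> fR by (simp add: \<Phi>_def nth_append poly_monom)
    qed
  qed (use l\<Phi> k N fR in auto)
  also have "\<dots> = (-1) ^ displacement R * det (vandermonde_del N R (xs @ bs))"
    using R k N by (subst coldet_unit_columns, simp_all add: det_vandermonde_del_coldet o_def)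
  finally have "coldet (map (\<lambda>\<phi> i. \<phi> (ps ! i)) \<Phi>) = (-1) ^ displacement R * det (vandermonde_del N R (xs @ bs))"
    by simp
  moreover have "coldet (map (\<lambda>\<phi> i. \<phi> (ps ! i)) \<Phi>) = schur_coldet N k R (mset bs) xs * vdm bs"
  proof -
    let ?us = "map (\<lambda>\<phi> i. \<phi> (ps ! i)) (map ?es ?Rs @ map ?ev xs)" and ?vs = "map (\<lambda>b i. poly (ps ! i) b) bs"
    have "map (\<lambda>\<phi> i. \<phi> (ps ! i)) \<Phi> = ?us @ ?vs" by (simp add: \<Phi>_def)
    moreover have "coldet (?us @ ?vs) = coldet ?us * coldet (map (\<lambda>v i. v (k + i)) ?vs)"
    proof (rule coldet_block_upper_zero)
      fix v i assume "v \<in> set ?vs" "i < k"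
      then show "v i = 0" by (auto simp: ps1 poly_root_poly prod_mset_zero_iff)
    qed (use k fR in simp)
    moreover have "coldet ?us = schur_coldet N k R (mset bs) xs"
      unfolding schur_coldet_def
      by (rule coldet_cong) (use k fR in \<open>auto simp: nth_append ps1\<close>)
    moreover have "coldet (map (\<lambda>v i. v (k + i)) ?vs) = vdm bs"
      unfolding det_vandermonde_coldet
      by (rule coldet_cong) (auto simp: ps2 N poly_monom)
    ultimately show ?thesis by simp
  qed
  ultimately show ?thesis by simp
qed

lemma schur_coldet_empty:
  "schur_coldet N (length xs) {} B xs = vdm xs * diff_prod (mset xs) B"
proof -
  let ?k = "length xs"
  have "schur_coldet N ?k {} B xs =
      coldet ([] @ map (\<lambda>x i. poly (root_poly B) x * x ^ (?k - 1 - i)) xs)"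
    by (simp add: schur_coldet_def poly_monom mult.commute)
  also have "\<dots> = prod_list (map (poly (root_poly B)) xs) * coldet ([] @ map (\<lambda>x i. x ^ (?k - 1 - i)) xs)"
    by (rule coldet_scale_columns)
  also have "prod_list (map (poly (root_poly B)) xs) = diff_prod (mset xs) B"
    by (simp add: diff_prod_eq_poly flip: prod_mset_prod_list)
  finally show ?thesis by (simp add: det_vandermonde_coldet mult.commute)
qed

text \<open>
  The case of no coefficient functionals: evaluating a multiple of \<open>g\<close> at a point scales its
  column by the value of \<open>g\<close> there.
\<close>

lemma vandermonde_append:
  fixes xs ys :: "'a::idom list"
  shows "vdm (xs @ ys) = vdm xs * diff_prod (mset xs) (mset ys) * vdm ys"
proof -
  let ?N = "length xs + length ys"
  have "vandermonde_del ?N {} (xs @ ys) = vandermonde ?N (xs @ ys)"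
    by (rule eq_matI) (auto simp: vandermonde_del_eq_mat vandermonde_def)
  then have "schur_coldet ?N (length xs) {} (mset ys) xs * vdm ys = vdm (xs @ ys)"
    using schur_coldet_mult_vandermonde[of "{}" ?N xs "length xs" ys] by (simp add: displacement_def)
  then show ?thesis by (simp add: schur_coldet_empty)
qed

lemma schur_coldet_eq_distinct:
  fixes xs bs :: "'a::idom list"
  assumes R: "R \<subseteq> {1..N}" and k: "card R + length xs = k" and N: "N = k + length bs" and "distinct bs"
  shows "schur_coldet N k R (mset bs) xs =
    (-1) ^ displacement R * schur N R (mset (xs @ bs)) * vdm xs * diff_prod (mset xs) (mset bs)"
proof -
  have "schur_coldet N k R (mset bs) xs * vdm bs =
      (-1) ^ displacement R * (schur N R (mset (xs @ bs)) * vdm (xs @ bs))"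
    using schur_coldet_mult_vandermonde[OF R k N] schur_mult_vandermonde[OF R, of "xs @ bs"] k N by simp
  also have "\<dots> = ((-1) ^ displacement R * schur N R (mset (xs @ bs)) * vdm xs * diff_prod (mset xs) (mset bs)) * vdm bs"
    by (simp only: vandermonde_append mult_ac)
  finally show ?thesis using det_vandermonde_nonzero[OF \<open>distinct bs\<close>] by simp
qed

text \<open>
  This is how the Schur factors of the Sylvester sum arise. For distinct elements of \<open>B\<close> cancel
  the Vandermonde determinant of \<open>B\<close> in \<open>schur_coldet_mult_vandermonde\<close>; otherwise separate them
  by different powers of an indeterminate.
\<close>

lemma schur_coldet_eq:
  fixes xs :: "'a::idom list"
  assumes R: "R \<subseteq> {1..N}" and k: "card R + length xs = k" and N: "N = k + size B"
  shows "schur_coldet N k R B xs =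
    (-1) ^ displacement R * schur N R (mset xs + B) * vdm xs * diff_prod (mset xs) B"
proof -
  obtain bs where bs: "mset bs = B" using ex_mset by blast
  \<comment> \<open>Only \<open>B\<close> has to be perturbed, since only its Vandermonde determinant is cancelled.\<close>
  define xs' where "xs' = map (\<lambda>x. [:x:]) xs"
  define bs' where "bs' = map (\<lambda>i. [:bs ! i:] + monom 1 (Suc i)) [0..<length bs]"
  have lb: "length bs' = length bs" "length bs = size B" using bs by (auto simp: bs'_def)
  have "distinct bs'"
  proof -
    have "inj (\<lambda>i. [:bs ! i:] + monom (1::'a) (Suc i))"
    proof (rule injI, rule ccontr)
      fix a b assume ab: "[:bs ! a:] + monom (1::'a) (Suc a) = [:bs ! b:] + monom 1 (Suc b)" and ne: "a \<noteq> b"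
      have "coeff ([:bs ! a:] + monom (1::'a) (Suc a)) (Suc a) = coeff ([:bs ! b:] + monom 1 (Suc b)) (Suc a)"
        using ab by simp
      then show False using ne by (simp add: coeff_pCons)
    qed
    then show ?thesis by (auto simp: bs'_def distinct_map intro: inj_on_subset)
  qed
  then have eq: "schur_coldet N k R (mset bs') xs' =
      (-1) ^ displacement R * schur N R (mset (xs' @ bs')) * vdm xs' * diff_prod (mset xs') (mset bs')"
    using k N lb by (intro schur_coldet_eq_distinct[OF R]) (auto simp: xs'_def)
  let ?h = "\<lambda>p :: 'a poly. poly p 0"
  have h: "comm_ring_hom ?h" by (rule comm_ring_hom_poly)
  have hx: "map ?h xs' = xs" by (simp add: xs'_def o_def)
  have hb: "map ?h bs' = bs" by (rule nth_equalityI) (auto simp: bs'_def poly_monom)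
  have hmx: "image_mset ?h (mset xs') = mset xs" using hx by (metis mset_map)
  have hmb: "image_mset ?h (mset bs') = B" using hb bs by (metis mset_map)
  have "?h (schur_coldet N k R (mset bs') xs') = schur_coldet N k R B xs"
    using hom_schur_coldet[OF h, of N k R "mset bs'" xs'] unfolding hmb hx .
  moreover have "?h (schur N R (mset (xs' @ bs'))) = schur N R (mset xs + B)"
    using hom_schur[OF h R, of "mset (xs' @ bs')"] k N lb hmx hmb by (simp add: xs'_def)
  moreover have "?h (vdm xs') = vdm xs"
    using comm_ring_hom.hom_vandermonde[OF h, of xs'] unfolding hx .
  moreover have "?h (diff_prod (mset xs') (mset bs')) = diff_prod (mset xs) B"
    using comm_ring_hom.hom_diff_prod[OF h, of "mset xs'" "mset bs'"] unfolding hmx hmb .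
  ultimately show ?thesis using arg_cong[OF eq, of ?h] by simp
qed

section \<open>The subresultant as a value of the large determinant\<close>

text \<open>
  The polynomials \<open>x\<^bsup>t-1\<^esup>f, \<dots>, f, x\<^bsup>k-1\<^esup>g, \<dots>, g\<close>, the rows of a Sylvester matrix.
\<close>

definition sylvester_basis :: "nat \<Rightarrow> nat \<Rightarrow> 'a::comm_ring_1 poly \<Rightarrow> 'a poly \<Rightarrow> 'a poly list" where
  "sylvester_basis t k f g = map (\<lambda>i. monom 1 (t - 1 - i) * f) [0..<t] @ map (\<lambda>i. monom 1 (k - 1 - i) * g) [0..<k]"

text \<open>
  The value of the subresultant at \<open>x\<close>, over the ring that contains \<open>x\<close>.
\<close>

definition sres_val :: "nat \<Rightarrow> nat \<Rightarrow> nat \<Rightarrow> 'a::comm_ring_1 poly \<Rightarrow> 'a poly \<Rightarrow> 'a \<Rightarrow> 'a" where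
  "sres_val d m n f g x =
    (let ps = sylvester_basis (n - d) (m - d) f g in
     coldet (map (\<lambda>c i. coeff (ps ! i) (m + n - d - 1 - c)) [0..<m + n - 2 * d - 1] @ [\<lambda>i. poly (ps ! i) x]))"

lemma length_sylvester_basis [simp]: "length (sylvester_basis t k f g) = t + k"
  by (simp add: sylvester_basis_def)

lemma sylvester_basis_nth1: "i < t \<Longrightarrow> sylvester_basis t k f g ! i = monom 1 (t - 1 - i) * f"
  by (simp add: sylvester_basis_def nth_append)

lemma sylvester_basis_nth2: "i < k \<Longrightarrow> sylvester_basis t k f g ! (t + i) = monom 1 (k - 1 - i) * g"
  by (simp add: sylvester_basis_def nth_append)

lemma coeff_monom_mult_eq_0:
  fixes p :: "'a::comm_ring_1 poly"
  assumes "degree p \<le> m" "c > m + e"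
  shows "coeff (monom 1 e * p) c = 0"
  using assms by (simp add: coeff_monom_mult coeff_eq_0)

lemma coeff_sylvester_basis_eq_0:
  assumes "degree f \<le> m" "degree g \<le> n" "t + m \<le> N" "k + n \<le> N" "i < t + k" "c \<ge> N"
  shows "coeff (sylvester_basis t k f g ! i) c = 0"
proof (cases "i < t")
  case True
  then show ?thesis unfolding sylvester_basis_nth1[OF True]
    using assms by (intro coeff_monom_mult_eq_0[of _ m]) auto
next
  case False
  then have i: "t + (i - t) = i" "i - t < k" using assms by auto
  have eq: "sylvester_basis t k f g ! i = monom 1 (k - 1 - (i - t)) * g"
    using sylvester_basis_nth2[OF i(2), of t f g] unfolding i(1) .
  have "c > n + (k - 1 - (i - t))" using i(2) assms by linarith
  then show ?thesis unfolding eq using assms by (intro coeff_monom_mult_eq_0[of _ n]) auto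
qed

text \<open>
  The \<open>t - (n - d)\<close> extra multiples of \<open>f\<close> on top are monic of degrees exceeding those of all other rows,
  so they contribute a unitriangular block.
\<close>

lemma sres_val_extended:
  fixes f g :: "'a::idom poly"
  assumes f: "degree f = m" "coeff f m = 1" and g: "degree g \<le> n"
    and d: "d \<le> m" "d \<le> n" "m + n - 2 * d \<ge> 1" and t: "n - d \<le> t" and N: "N = t + m" and k: "k = m - d"
  shows "coldet (map (\<lambda>c i. coeff (sylvester_basis t k f g ! i) (N - 1 - c)) [0..<t + k - 1] @
      [\<lambda>i. poly (sylvester_basis t k f g ! i) x]) = sres_val d m n f g x"
proof -
  \<comment> \<open>The number of extra multiples of \<open>f\<close>.\<close>
  define l where "l = t - (n - d)"
  let ?ps = "sylvester_basis t k f g" and ?qs = "sylvester_basis (n - d) k f g"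
  let ?C = "\<lambda>c i. coeff (?ps ! i) (N - 1 - c)"
  have tl: "t = l + (n - d)" using t by (simp add: l_def)
  have "[0..<t + k - 1] = [0..<l] @ [l..<t + k - 1]"
  proof -
    have "n - d + k \<ge> 1" using d(3) k by linarith
    then have "l \<le> t + k - 1" unfolding tl by linarith
    then have "l + (t + k - 1 - l) = t + k - 1" by simp
    then show ?thesis using upt_add_eq_append[of 0 l "t + k - 1 - l"] by simp
  qed
  then have "map ?C [0..<t + k - 1] @ [\<lambda>i. poly (?ps ! i) x] =
      map ?C [0..<l] @ (map ?C [l..<t + k - 1] @ [\<lambda>i. poly (?ps ! i) x])" by simp
  moreover have "coldet (map ?C [0..<l] @ (map ?C [l..<t + k - 1] @ [\<lambda>i. poly (?ps ! i) x])) = coldet (map ?C [0..<l]) *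
      coldet (map (\<lambda>v i. v (l + i)) (map ?C [l..<t + k - 1] @ [\<lambda>i. poly (?ps ! i) x]))"
  proof (rule coldet_block_lower_zero)
    fix u i assume "u \<in> set (map ?C [0..<l])" and
      i: "l \<le> i" "i < l + length (map ?C [l..<t + k - 1] @ [\<lambda>i. poly (?ps ! i) x])"
    then obtain c where c: "c < l" "u = ?C c" by auto
    have it: "i < t + k" using i tl d k by auto
    show "u i = 0"
    proof (cases "i < t")
      case True
      then show ?thesis unfolding c(2) sylvester_basis_nth1[OF True]
        using c(1) i N f by (intro coeff_monom_mult_eq_0[of _ m]) auto
    next
      case False
      then have i': "t + (i - t) = i" "i - t < k" using it by auto
      have eq: "?ps ! i = monom 1 (k - 1 - (i - t)) * g"
        using sylvester_basis_nth2[OF i'(2), of t f g] unfolding i'(1) .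
      have "N = l + (n + k)" using N k d tl by simp
      then have "n + k \<le> N - 1 - c" using c(1) by simp
      moreover have "k - 1 - (i - t) < k" using i'(2) by simp
      ultimately have "N - 1 - c > n + (k - 1 - (i - t))" by linarith
      then show ?thesis unfolding c(2) eq using g by (intro coeff_monom_mult_eq_0[of _ n])
    qed
  qed simp
  moreover have "coldet (map ?C [0..<l]) = 1"
  proof (rule coldet_unitriangular)
    fix i j assume ij: "j < i" "i < length (map ?C [0..<l])"
    then have it: "i < t" using tl by simp
    have "N - 1 - j > m + (t - 1 - i)" using ij(1) it N by simp
    then have "coeff (?ps ! i) (N - 1 - j) = 0"
      unfolding sylvester_basis_nth1[OF it] using f by (intro coeff_monom_mult_eq_0[of _ m]) auto
    then show "(map ?C [0..<l] ! j) i = 0" using ij by simp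
  next
    fix i assume i: "i < length (map ?C [0..<l])"
    then have it: "i < t" using tl by simp
    have "N - 1 - i - (t - 1 - i) = m" "\<not> N - 1 - i < t - 1 - i" using N it by auto
    then show "(map ?C [0..<l] ! i) i = 1"
      using i it f(2) by (simp add: sylvester_basis_nth1 coeff_monom_mult)
  qed
  moreover have "coldet (map (\<lambda>v i. v (l + i)) (map ?C [l..<t + k - 1] @ [\<lambda>i. poly (?ps ! i) x])) =
     coldet (map (\<lambda>c i. coeff (?qs ! i) (m + n - d - 1 - c)) [0..<m + n - 2 * d - 1] @ [\<lambda>i. poly (?qs ! i) x])"
  proof -
    have nth: "?ps ! (l + i) = ?qs ! i" if "i < n - d + k" for i
    proof (cases "i < n - d")
      case True
      have "t - 1 - (l + i) = n - d - 1 - i" using tl by simp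
      then show ?thesis using True tl by (simp add: sylvester_basis_nth1)
    next
      case False
      then have "l + i = t + (i - (n - d))" "i - (n - d) < k" "i = n - d + (i - (n - d))" using that tl by auto
      then show ?thesis using sylvester_basis_nth2 by metis
    qed
    have len: "t + k - 1 - l = m + n - 2 * d - 1" using tl k d by simp
    show ?thesis
    proof (rule coldet_cong)
      fix i j assume "i < length (map (\<lambda>v i. v (l + i)) (map ?C [l..<t + k - 1] @ [\<lambda>i. poly (?ps ! i) x]))"
        "j < length (map (\<lambda>v i. v (l + i)) (map ?C [l..<t + k - 1] @ [\<lambda>i. poly (?ps ! i) x]))"
      then have i: "i < n - d + k" and j: "j \<le> m + n - 2 * d - 1" using len k d by auto
      have "N - 1 - (l + j) = m + n - d - 1 - j" using N tl d by auto
      then show "(map (\<lambda>v i. v (l + i)) (map ?C [l..<t + k - 1] @ [\<lambda>i. poly (?ps ! i) x]) ! j) i =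
        ((map (\<lambda>c i. coeff (?qs ! i) (m + n - d - 1 - c)) [0..<m + n - 2 * d - 1] @ [\<lambda>i. poly (?qs ! i) x]) ! j) i"
        using j len nth[OF i] by (cases "j < m + n - 2 * d - 1") (auto simp: nth_append)
    qed (use len in simp)
  qed
  ultimately show ?thesis unfolding sres_val_def Let_def k by (simp only: mult_1_left)
qed

definition full_basis :: "nat \<Rightarrow> nat \<Rightarrow> nat \<Rightarrow> 'a::comm_ring_1 poly \<Rightarrow> 'a poly \<Rightarrow> 'a poly list" where
  "full_basis t k d f g = sylvester_basis t k f g @ map (\<lambda>i. monom 1 (d - i)) [0..<Suc d]"

text \<open>
  The first evaluation of the large determinant. The functionals are expressed by the coefficient functionals,
  at the cost of the Vandermonde determinant of \<open>xs\<close>. Subtracting from the last column the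
  combination of the others that evaluates at \<open>x\<close> replaces it by minus the evaluation of the
  first two groups of rows. The monomials \<open>x\<^bsup>d\<^esup>, \<dots>, 1\<close> then split off an identity block,
  which the last column has to pass.
\<close>

lemma coldet_full_basis:
  fixes f g :: "'a::idom poly"
  assumes f: "degree f = m" "coeff f m = 1" and g: "degree g \<le> n"
    and d: "d \<le> m" "d \<le> n" "m + n - 2 * d \<ge> 1" and t: "n - d \<le> t" and N: "N = t + m" and k: "k = m - d"
    and xs: "L + length xs = N"
  defines "ps \<equiv> full_basis t k d f g"
  shows "coldet (map (\<lambda>\<phi> i. \<phi> (ps ! i)) (map (\<lambda>r p. coeff p (N - r)) [1..<Suc L] @ map (\<lambda>x p. poly p x) xs) @
      [\<lambda>i. if t + k \<le> i then poly (ps ! i) x else 0]) = (-1) ^ d * vdm xs * sres_val d m n f g x"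
proof -
  let ?\<Phi> = "map (\<lambda>r p. coeff p (N - r)) [1..<Suc L] @ map (\<lambda>x p. poly p x) xs :: ('a poly \<Rightarrow> 'a) list"
  let ?xi = "\<lambda>i. if t + k \<le> i then poly (ps ! i) x else 0"
  let ?eta = "\<lambda>i. if i < t + k then poly (ps ! i) x else 0"
  let ?C = "\<lambda>c i. coeff (ps ! i) (N - 1 - c)"
  have Ntkd: "N = t + k + d" using N k d by simp
  have tk: "t + k \<ge> 1" using t k d by linarith
  have kn: "k + n \<le> N" using N k d t by linarith
  have lps: "length ps = Suc N" by (simp add: ps_def full_basis_def Ntkd)
  have ps1: "ps ! i = sylvester_basis t k f g ! i" if "i < t + k" for i
    using that by (simp add: ps_def full_basis_def nth_append)
  have ps2: "ps ! i = monom 1 (d - (i - (t + k)))" if "t + k \<le> i" "i \<le> N" for i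
  proof -
    have "i - (t + k) < Suc d" using that Ntkd by simp
    then show ?thesis using that by (simp add: ps_def full_basis_def nth_append del: upt_Suc)
  qed
  have deg: "coeff (ps ! i) c = 0" if "i \<le> N" "c \<ge> N" for i c
  proof (cases "i < t + k")
    case True
    then show ?thesis unfolding ps1[OF True]
      using f g N kn that by (intro coeff_sylvester_basis_eq_0[of _ m _ n]) auto
  next
    case False
    then show ?thesis using ps2[of i] that Ntkd tk by auto
  qed
  have "coldet (map (\<lambda>\<phi> i. \<phi> (ps ! i)) ?\<Phi> @ [?xi]) =
    coldet (map ?C [0..<N] @ [?xi]) * coldet (map (\<lambda>\<phi> i. \<phi> (monom 1 (N - 1 - i))) ?\<Phi>)"
  proof (rule coldet_functionals)
    fix p c assume "p \<in> set ps" "N \<le> c"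
    then show "coeff p c = 0" using deg lps by (metis in_set_conv_nth less_Suc_eq_le)
  next
    fix \<phi> assume "\<phi> \<in> set ?\<Phi>"
    then show "linear_functional \<phi>" by (auto simp: linear_functional_coeff linear_functional_eval)
  qed (use lps xs in auto)
  moreover have "coldet (map (\<lambda>\<phi> i. \<phi> (monom 1 (N - 1 - i))) ?\<Phi>) = vdm xs"
  proof -
    let ?us = "map (\<lambda>r i. coeff (monom 1 (N - 1 - i)) (N - r)) [1..<Suc L] :: (nat \<Rightarrow> 'a) list" and
      ?vs = "map (\<lambda>x i. x ^ (N - 1 - i)) xs"
    have "map (\<lambda>\<phi> i. \<phi> (monom 1 (N - 1 - i))) ?\<Phi> = ?us @ ?vs"
      by (simp add: poly_monom o_def del: upt_Suc)
    moreover have "coldet (?us @ ?vs) = coldet ?us * coldet (map (\<lambda>v i. v (L + i)) ?vs)"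
    proof (rule coldet_block_lower_zero)
      fix u i assume "u \<in> set ?us" and i: "L \<le> i" "i < L + length ?vs"
      then obtain r where "1 \<le> r" "r \<le> L" "u = (\<lambda>i. coeff (monom 1 (N - 1 - i)) (N - r))" by auto
      then show "u i = 0" using i xs by auto
    qed simp
    moreover have "coldet ?us = 1"
      by (rule coldet_unitriangular) (use xs in \<open>auto simp del: upt_Suc\<close>)
    moreover have "coldet (map (\<lambda>v i. v (L + i)) ?vs) = vdm xs"
      unfolding det_vandermonde_coldet
      by (rule coldet_cong) (use xs in \<open>auto simp: diff_diff_left[symmetric]\<close>)
    ultimately show ?thesis by (simp only: mult_1_left)
  qed
  moreover have "coldet (map ?C [0..<N] @ [?xi]) = coldet (map ?C [0..<N] @ [\<lambda>i. (-1) * ?eta i])"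
  proof -
    let ?ws = "map (\<lambda>r i. if i = r then 1 else 0) [0..<N] @ [\<lambda>c. if c < N then x ^ (N - 1 - c) else 1]"
    have "coldet (map ?C [0..<N] @ [?xi]) = coldet (map ?C [0..<N] @ [\<lambda>i. (-1) * ?eta i]) * coldet ?ws"
    proof (rule coldet_combination)
      fix i j assume i: "i < Suc N" and j: "j < Suc N"
      let ?vs = "map ?C [0..<N] @ [\<lambda>i. (-1) * ?eta i]"
      show "((map ?C [0..<N] @ [?xi]) ! j) i = (\<Sum>c<Suc N. (?vs ! c) i * (?ws ! j) c)"
      proof (cases "j < N")
        case True
        then have "(\<Sum>c<Suc N. (?vs ! c) i * (?ws ! j) c) = (\<Sum>c<Suc N. if c = j then (?vs ! c) i else 0)"
          by (intro sum.cong) (auto simp: nth_append)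
        then show ?thesis using True by (simp add: nth_append)
      next
        case False
        then have j: "j = N" using j by simp
        have "poly (ps ! i) x = (\<Sum>c<N. coeff (ps ! i) c * poly (monom 1 c) x)"
          using deg i by (intro linear_functional_expand[OF linear_functional_eval]) auto
        also have "\<dots> = (\<Sum>c<N. ?C c i * x ^ (N - 1 - c))"
          using sum.nat_diff_reindex[of "\<lambda>c. coeff (ps ! i) c * x ^ c" N] by (simp add: poly_monom)
        also have "\<dots> = (\<Sum>c<N. (?vs ! c) i * (?ws ! j) c)"
          using j by (intro sum.cong) (auto simp: nth_append)
        finally have "(\<Sum>c<Suc N. (?vs ! c) i * (?ws ! j) c) = poly (ps ! i) x - ?eta i"
          using j by (simp add: nth_append)
        also have "\<dots> = ?xi i" by simp
        finally show ?thesis using j by (simp add: nth_append)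
      qed
    qed auto
    also have "coldet ?ws = 1"
      by (rule coldet_unitriangular) (auto simp: nth_append)
    finally show ?thesis by simp
  qed
  moreover have "coldet (map ?C [0..<N] @ [\<lambda>i. (-1) * ?eta i]) = - coldet (map ?C [0..<N] @ [?eta])"
    by (subst coldet_scale) simp
  moreover have "coldet (map ?C [0..<N] @ [?eta]) = (-1) ^ Suc d * sres_val d m n f g x"
  proof -
    let ?c1 = "map ?C [0..<t + k - 1]" and ?c2 = "map ?C [t + k - 1..<N]"
    have "[0..<N] = [0..<t + k - 1] @ [t + k - 1..<N]"
    proof -
      have e: "t + k - 1 + Suc d = N" using Ntkd tk by simp
      show ?thesis using upt_add_eq_append[of 0 "t + k - 1" "Suc d"] unfolding e by simp
    qed
    then have "coldet (map ?C [0..<N] @ [?eta]) = coldet (?c1 @ ?c2 @ [?eta] @ [])" by simp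
    also have "\<dots> = (-1) ^ (length ?c2 * length [?eta]) * coldet (?c1 @ [?eta] @ ?c2 @ [])"
      by (rule alternating_swap_blocks[OF alternating_coldet])
    also have "length ?c2 * length [?eta] = Suc d" using Ntkd tk by simp
    also have "coldet (?c1 @ [?eta] @ ?c2 @ []) = coldet ((?c1 @ [?eta]) @ ?c2)" by simp
    also have "\<dots> = coldet (?c1 @ [?eta]) * coldet (map (\<lambda>v i. v (t + k + i)) ?c2)"
    proof (rule coldet_block_lower_zero)
      fix u i assume u: "u \<in> set (?c1 @ [?eta])" and i: "t + k \<le> i" "i < t + k + length ?c2"
      have iN: "i \<le> N" using i Ntkd tk by simp
      from u consider c where "c < t + k - 1" "u = ?C c" | "u = ?eta" by auto
      then show "u i = 0"
      proof cases
        case 1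
        then show ?thesis using ps2[OF i(1) iN] Ntkd by auto
      qed (use i in auto)
    qed (use tk in simp)
    also have "coldet (map (\<lambda>v i. v (t + k + i)) ?c2) = coldet (map (\<lambda>r i. if i = r then 1 else 0) [0..<Suc d])"
    proof (rule coldet_cong)
      show l: "length (map (\<lambda>v i. v (t + k + i)) ?c2) = length (map (\<lambda>r i. if i = r then 1 else 0) [0..<Suc d])"
        using Ntkd tk by simp
      fix i j assume "i < length (map (\<lambda>v i. v (t + k + i)) ?c2)" "j < length (map (\<lambda>v i. v (t + k + i)) ?c2)"
      then have i: "i \<le> d" and j: "j \<le> d" using l by simp_all
      have "N - 1 - (t + k - 1 + j) = d - j" using Ntkd tk by simp
      moreover have "ps ! (t + k + i) = monom 1 (d - i)" using ps2[of "t + k + i"] i Ntkd by simp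
      moreover have "d - i = d - j \<longleftrightarrow> i = j" using i j by auto
      ultimately show "(map (\<lambda>v i. v (t + k + i)) ?c2 ! j) i = (map (\<lambda>r i. if i = r then 1 else 0) [0..<Suc d] ! j) i"
        using i j Ntkd tk by (simp del: upt_Suc)
    qed
    also have "coldet (?c1 @ [?eta]) = coldet (map (\<lambda>c i. coeff (sylvester_basis t k f g ! i) (N - 1 - c)) [0..<t + k - 1] @
      [\<lambda>i. poly (sylvester_basis t k f g ! i) x])"
      by (rule coldet_cong) (use tk in \<open>auto simp: nth_append ps1\<close>)
    also have "\<dots> = sres_val d m n f g x"
      by (rule sres_val_extended[OF f g d t N k])
    finally show ?thesis by (simp del: upt_Suc)
  qed
  ultimately show ?thesis by simp
qed

section \<open>Signs, and the block of low monomials\<close>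

lemma alternating_regroup:
  assumes F: "alternating F"
  shows "F (p1 @ p2 @ p3 @ a1 @ a2 @ b1 @ b2 @ z) =
    (-1) ^ ((length p1 + length p2) * length p3 +
      (length p1 + length p2 + length a1 + length a2 + length b1) * length b2 +
      length p1 * length p2 + (length p1 + length a1) * length a2) *
    F (p3 @ b2 @ p2 @ a2 @ p1 @ a1 @ b1 @ z)"
proof -
  note swap = alternating_swap_blocks[OF F]
  have "F (p1 @ p2 @ p3 @ a1 @ a2 @ b1 @ b2 @ z) =
      (-1) ^ ((length p1 + length p2) * length p3) * F (p3 @ p1 @ p2 @ a1 @ a2 @ b1 @ b2 @ z)"
    using swap[of "[]" "p1 @ p2" p3 "a1 @ a2 @ b1 @ b2 @ z"] by simp
  moreover have "F (p3 @ p1 @ p2 @ a1 @ a2 @ b1 @ b2 @ z) =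
      (-1) ^ ((length p1 + length p2 + length a1 + length a2 + length b1) * length b2) *
        F (p3 @ b2 @ p1 @ p2 @ a1 @ a2 @ b1 @ z)"
    using swap[of p3 "p1 @ p2 @ a1 @ a2 @ b1" b2 z] by (simp add: add.assoc)
  moreover have "F (p3 @ b2 @ p1 @ p2 @ a1 @ a2 @ b1 @ z) =
      (-1) ^ (length p1 * length p2) * F (p3 @ b2 @ p2 @ p1 @ a1 @ a2 @ b1 @ z)"
    using swap[of "p3 @ b2" p1 p2 "a1 @ a2 @ b1 @ z"] by simp
  moreover have "F (p3 @ b2 @ p2 @ p1 @ a1 @ a2 @ b1 @ z) =
      (-1) ^ ((length p1 + length a1) * length a2) * F (p3 @ b2 @ p2 @ a2 @ p1 @ a1 @ b1 @ z)"
    using swap[of "p3 @ b2 @ p2" "p1 @ a1" a2 "b1 @ z"] by simp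
  ultimately show ?thesis by (simp only: power_add mult.assoc)
qed

lemma alternating_vandermonde:
  fixes h :: "'c \<Rightarrow> 'a::comm_ring_1"
  shows "alternating (\<lambda>zs. vdm (map h zs))"
  unfolding alternating_def
proof (intro allI)
  fix us vs :: "'c list" and x y
  let ?l = "length us + length vs + 2"
  let ?F = "\<lambda>zs. coldet (map (\<lambda>z i. h z ^ (?l - 1 - i)) zs)"
  have "alternating ?F"
    using alternating_context[OF alternating_coldet, of "[]" "\<lambda>z i. h z ^ (?l - 1 - i)" "[]"] by simp
  from alternatingD[OF this, of us x y vs]
  have F: "?F (us @ x # y # vs) = - ?F (us @ y # x # vs)" .
  have e: "vdm (map h zs) = ?F zs" if "length zs = ?l" for zs
    using det_vandermonde_coldet[of "map h zs"] that by (simp add: o_def)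
  have "length (us @ x # y # vs) = ?l" "length (us @ y # x # vs) = ?l" by simp_all
  then show "vdm (map h (us @ x # y # vs)) = - vdm (map h (us @ y # x # vs))"
    using F by (simp only: e)
qed

text \<open>
  The block of the monomials \<open>x\<^bsup>d\<^esup>, \<dots>, 1\<close>, which carries the first Schur factor. The coefficient of
  \<open>x\<^bsup>N-r\<^esup>\<close> vanishes on them if \<open>r < N - d\<close>, whence the lower bound
  imposed on the elements of \<open>R\<^sub>1\<close>.
\<close>

lemma coldet_low_monomials:
  fixes zs :: "'a::idom list"
  assumes R: "R \<subseteq> {1..N}" and len: "card R + length zs = Suc d" and N: "d < N"
  shows "coldet (map (\<lambda>r i. coeff (monom 1 (d - i)) (N - r)) (sorted_list_of_set R) @ map (\<lambda>z i. z ^ (d - i)) zs) =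
    (if R \<subseteq> {N - d..} then
      let R' = (\<lambda>i. i - (N - d - 1)) ` R in (-1) ^ displacement R' * schur (d + 1) R' (mset zs) * vdm zs
     else 0)"
proof (cases "R \<subseteq> {N - d..}")
  case True
  let ?q = "N - d - 1" let ?R = "(\<lambda>i. i - ?q) ` R"
  have fR: "finite R" using R finite_subset by blast
  have bounds: "?q < r" "r \<le> N" if "r \<in> R" for r using subsetD[OF True that] subsetD[OF R that] N by auto
  have inj: "inj_on (\<lambda>i. i - ?q) R"
    by (rule inj_onI) (use bounds in \<open>metis diff_is_0_eq' eq_diff_iff less_imp_le not_less\<close>)
  have R': "?R \<subseteq> {1..Suc d}"
  proof
    fix r' assume "r' \<in> ?R"
    then obtain r where "r \<in> R" "r' = r - ?q" by auto
    then show "r' \<in> {1..Suc d}" using bounds[of r] by auto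
  qed
  have slist: "sorted_list_of_set ?R = map (\<lambda>i. i - ?q) (sorted_list_of_set R)"
  proof (rule sorted_distinct_set_unique)
    have "sorted (sorted_list_of_set R)" by simp
    then show "sorted (map (\<lambda>i. i - ?q) (sorted_list_of_set R))"
      unfolding sorted_map by (rule sorted_wrt_mono_rel[rotated]) auto
  qed (use fR inj in \<open>auto simp: distinct_map\<close>)
  have "coldet (map (\<lambda>r i. coeff (monom 1 (d - i)) (N - r)) (sorted_list_of_set R) @ map (\<lambda>z i. z ^ (d - i)) zs) =
    schur_coldet (Suc d) (Suc d) ?R {#} zs"
  proof -
    have "coeff (monom 1 (d - i)) (N - r) = coeff (monom (1::'a) (d - i)) (Suc d - (r - ?q))" if "r \<in> R" for r i
    proof -
      have "N - r = Suc d - (r - ?q)" using bounds[OF that] N by linarith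
      then show ?thesis by simp
    qed
    then show ?thesis
      unfolding schur_coldet_def slist using fR
      by (intro arg_cong[of _ _ coldet]) (simp add: root_poly_def poly_monom)
  qed
  also have "\<dots> = (-1) ^ displacement ?R * schur (d + 1) ?R (mset zs) * vdm zs"
    using len card_image[OF inj] by (subst schur_coldet_eq[OF R']) simp_all
  finally show ?thesis using True by (simp add: Let_def)
next
  case False
  then obtain r where r: "r \<in> R" "r < N - d" by force
  have fR: "finite R" using R finite_subset by blast
  then obtain xs ys where "sorted_list_of_set R = xs @ r # ys"
    using r(1) by (metis set_sorted_list_of_set split_list)
  moreover have "(\<lambda>i. coeff (monom (1::'a) (d - i)) (N - r)) = (\<lambda>i. 0 * 0)" using r(2) by (intro ext) auto
  ultimately show ?thesis using False by (simp add: coldet_scale del: mult_zero_left mult_zero_right)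
     (simp add: coldet_scale[of _ 0 "\<lambda>_. 0", simplified])
qed

lemma triangle_add3:
  fixes a b c :: nat
  shows "(a + b + c) * (a + b + c + 1) div 2 =
    a * (a + 1) div 2 + b * (b + 1) div 2 + c * (c + 1) div 2 + (a * b + a * c + b * c)"
proof -
  have e: "2 * (x * (x + 1) div 2) = x * (x + 1)" for x :: nat by (intro dvd_mult_div_cancel) simp
  have "2 * ((a + b + c) * (a + b + c + 1) div 2) =
    2 * (a * (a + 1) div 2 + b * (b + 1) div 2 + c * (c + 1) div 2 + (a * b + a * c + b * c))"
    unfolding distrib_left[of 2] e by (simp add: algebra_simps)
  then show ?thesis by (rule mult_left_cancel[THEN iffD1, rotated]) simp
qed

text \<open>
  Sum the formula for the displacement over the three sets: the sums of elements add up to the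
  triangular number of \<open>L = r\<^sub>1 + r\<^sub>2 + r\<^sub>3\<close>, which exceeds the triangular numbers of the \<open>r\<^sub>i\<close> by
  \<open>r\<^sub>1r\<^sub>2 + r\<^sub>1r\<^sub>3 + r\<^sub>2r\<^sub>3\<close>.
\<close>

lemma displacement_tripartition:
  assumes T: "(R1, R2, R3) \<in> tripartitions {1..L}" and q: "\<And>r. r \<in> R1 \<Longrightarrow> q < r"
  shows "displacement ((\<lambda>i. i - q) ` R1) + displacement R2 + displacement R3 + card R1 * q =
    card R1 * card R2 + card R1 * card R3 + card R2 * card R3"
proof -
  have un: "R1 \<union> R2 \<union> R3 = {1..L}" and dj: "R1 \<inter> R2 = {}" "R1 \<inter> R3 = {}" "R2 \<inter> R3 = {}"
    using T by (auto simp: tripartitions_def)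
  have fin: "finite R1" "finite R2" "finite R3" using un by (metis finite_Un finite_atLeastAtMost)+
  have nz: "0 \<notin> R2" "0 \<notin> R3" using un by (metis Un_iff atLeastAtMost_iff not_one_le_zero)+
  let ?R = "(\<lambda>i. i - q) ` R1"
  have inj: "inj_on (\<lambda>i. i - q) R1"
    by (rule inj_onI) (use q in \<open>metis eq_diff_iff less_imp_le\<close>)
  have nz1: "0 \<notin> ?R" using q by fastforce
  have c: "card ?R = card R1" by (rule card_image[OF inj])
  have "\<Sum>?R = (\<Sum>r\<in>R1. r - q)" by (simp add: sum.reindex[OF inj])
  moreover have "(\<Sum>r\<in>R1. r - q) + card R1 * q = \<Sum>R1"
  proof -
    have "(\<Sum>r\<in>R1. (r - q) + q) = \<Sum>R1" using q by (intro sum.cong) (auto simp: less_imp_le)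
    then show ?thesis by (simp add: sum.distrib)
  qed
  ultimately have s1: "\<Sum>?R + card R1 * q = \<Sum>R1" by simp
  have cL: "card R1 + card R2 + card R3 = L"
  proof -
    have "card (R1 \<union> R2 \<union> R3) = card R1 + card R2 + card R3"
      using fin dj by (simp add: card_Un_disjoint Int_Un_distrib2)
    then show ?thesis using un by simp
  qed
  have "\<Sum>R1 + \<Sum>R2 + \<Sum>R3 = \<Sum>{1..L}"
    unfolding un[symmetric] using fin dj by (simp add: sum.union_disjoint Int_Un_distrib2)
  also have "\<Sum>{1..L} = L * (L + 1) div 2" using gauss_sum_from_Suc_0[of L, where 'a = nat] by simp
  also have "\<dots> = card R1 * (card R1 + 1) div 2 + card R2 * (card R2 + 1) div 2 + card R3 * (card R3 + 1) div 2
     + (card R1 * card R2 + card R1 * card R3 + card R2 * card R3)"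
    unfolding cL[symmetric] by (rule triangle_add3)
  finally show ?thesis
    using displacement_eq[OF _ nz1] displacement_eq[OF fin(2) nz(1)] displacement_eq[OF fin(3) nz(2)] s1 fin c
    by simp
qed

text \<open>
  All signs produced by the expansion, compared with the sign in the Sylvester sum, in the case
  \<open>d < m' + n'\<close>. Here \<open>a1\<close>, \<open>a2\<close>, \<open>b1\<close>, \<open>b2\<close> are the cardinalities of \<open>A'\<close>,
  \<open>Abar - A'\<close>, \<open>B'\<close>, \<open>Bbar - B'\<close>, and \<open>e\<close> is the sum of the displacements.
\<close>

lemma sign_parity_pos:
  fixes k d ma nb t r1 r2 r3 a1 a2 b1 b2 e m n m' n' :: int
  assumes "m = k + d" "n = t + d" "m' = m - ma" "n' = n - nb"
    "a2 = k - r2" "a1 = ma - a2" "b2 = t - r3" "b1 = nb - b2" "r1 = d - a1 - b1"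
    "e = r1 * r2 + r1 * r3 + r2 * r3 - r1 * (k + t - 1)"
  shows "even (e + ((r1 + r2) * r3 + (r1 + r2 + a1 + a2 + b1) * b2 + r1 * r2 + (r1 + a1) * a2) + b2 * m + a1 + b1 + d +
     (d * k + m' * k + (r1 * (n - d + r2 + r3) + r2 * (ma - 1) + r3 * (m' + n' - d - 1) + r2 * r3)))"
  unfolding assms
  by (cases "even k"; cases "even d"; cases "even ma"; cases "even nb"; cases "even t"; cases "even r2"; cases "even r3"; simp)

text \<open>
  The same comparison for \<open>d \<ge> m' + n'\<close>, where \<open>R\<^sub>1\<close>, \<open>R\<^sub>2\<close>, \<open>R\<^sub>3\<close> are empty.
\<close>

lemma sign_parity_zero:
  fixes k d ma nb t a1 a2 b1 b2 m m' :: int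
  assumes "m = k + d" "m' = nb - t" "a2 = k" "a1 = ma - k" "b2 = t" "b1 = nb - t" "d = a1 + b1"
  shows "even ((a1 + a2 + b1) * b2 + a1 * a2 + b2 * m + a1 + b1 + d + (d * k + m' * k))"
  unfolding assms
  by (cases "even k"; cases "even ma"; cases "even nb"; cases "even t"; simp)

section \<open>Laplace expansion of the large determinant\<close>

lemma mset_filter_distinct:
  "distinct xs \<Longrightarrow> S \<subseteq> set xs \<Longrightarrow> mset (filter (\<lambda>x. x \<in> S) xs) = mset_set S"
  "distinct xs \<Longrightarrow> mset (filter (\<lambda>x. x \<notin> S) xs) = mset_set (set xs - S)"
  by (subst mset_set_set[symmetric]; auto intro!: arg_cong[of _ _ mset_set])+

lemma length_filter_distinct:
  "distinct xs \<Longrightarrow> S \<subseteq> set xs \<Longrightarrow> length (filter (\<lambda>x. x \<in> S) xs) = card S"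
  "distinct xs \<Longrightarrow> S \<subseteq> set xs \<Longrightarrow> card S + length (filter (\<lambda>x. x \<notin> S) xs) = length xs"
proof -
  assume d: "distinct xs" and S: "S \<subseteq> set xs"
  show l: "length (filter (\<lambda>x. x \<in> S) xs) = card S"
    using arg_cong[OF mset_filter_distinct(1)[OF d S], of size] by (simp del: mset_filter)
  show "card S + length (filter (\<lambda>x. x \<notin> S) xs) = length xs"
    unfolding l[symmetric] by (rule sum_length_filter_compl)
qed

text \<open>
  The elements of \<open>Abar\<close> and \<open>Bbar\<close> are labels, which \<open>\<alpha>\<close> and \<open>\<beta>\<close> map to the roots; the remaining
  roots are \<open>A0\<close> and \<open>B0\<close>. In this way the index sets of the sums do not change when the
  roots are moved.
\<close>

locale sylvester_data =
  fixes as bs :: "'l list" and \<alpha> \<beta> :: "'l \<Rightarrow> 'a::idom" and A0 B0 :: "'a multiset" and d :: nat and x :: 'a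
  assumes distinct_as: "distinct as" and distinct_bs: "distinct bs"
    and inj_\<alpha>: "inj_on \<alpha> (set as)" and inj_\<beta>: "inj_on \<beta> (set bs)"
    and apart: "\<And>a b. a \<in> set as \<Longrightarrow> b \<in> set bs \<Longrightarrow> \<alpha> a \<noteq> \<beta> b"
    and d_le_m: "d \<le> size A0 + length as" and d_le_n: "d \<le> size B0 + length bs"
    and d_less: "2 * d < size A0 + length as + (size B0 + length bs)"
begin

abbreviation "m' \<equiv> size A0"
abbreviation "n' \<equiv> size B0"
abbreviation "ma \<equiv> length as"
abbreviation "nb \<equiv> length bs"
abbreviation "m \<equiv> m' + ma"
abbreviation "n \<equiv> n' + nb"

definition "A = image_mset \<alpha> (mset as) + A0"
definition "B = image_mset \<beta> (mset bs) + B0"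
text \<open>
  \<open>L\<close> is zero if \<open>d \<ge> m' + n'\<close>. The numbers \<open>t\<close> and \<open>k\<close> count the multiples of the two
  polynomials, and \<open>N\<close> bounds all degrees strictly.
\<close>

definition "L = m' + n' - d"
definition "N = L + ma + nb"
definition "t = N - m"
definition "k = m - d"

lemma size_A: "size A = m" and size_B: "size B = n"
  by (simp_all add: A_def B_def)

lemma dims: "t + m = N" "t + k + d = N" "n - d \<le> t" "k + d = m" "d < N"
  using d_le_m d_le_n d_less unfolding t_def N_def L_def k_def by linarith+

lemma dims_pos: "L > 0 \<Longrightarrow> t + d = n" "L > 0 \<Longrightarrow> N = k + n" "L > 0 \<Longrightarrow> L + d = m' + n'"
  using d_le_m d_le_n d_less unfolding t_def N_def L_def k_def by linarith+

lemma dims_zero: "L = 0 \<Longrightarrow> t + m' = nb" "L = 0 \<Longrightarrow> m' + n' \<le> d"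
  using d_le_m d_le_n d_less unfolding t_def N_def L_def k_def by linarith+

definition "ps = full_basis t k d (root_poly A) (root_poly B)"

text \<open>
  The column of a functional, restricted to one of the three groups of rows.
\<close>

definition block1 :: "('a poly \<Rightarrow> 'a) \<Rightarrow> nat \<Rightarrow> 'a" where
  "block1 \<phi> i = (if i < t then \<phi> (ps ! i) else 0)"
definition block2 :: "('a poly \<Rightarrow> 'a) \<Rightarrow> nat \<Rightarrow> 'a" where
  "block2 \<phi> i = (if t \<le> i \<and> i < t + k then \<phi> (ps ! i) else 0)"
definition block3 :: "('a poly \<Rightarrow> 'a) \<Rightarrow> nat \<Rightarrow> 'a" where
  "block3 \<phi> i = (if t + k \<le> i then \<phi> (ps ! i) else 0)"

abbreviation coeff_at :: "nat \<Rightarrow> 'a poly \<Rightarrow> 'a" where "coeff_at r \<equiv> (\<lambda>p. coeff p (N - r))"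
abbreviation eval_at :: "'a \<Rightarrow> 'a poly \<Rightarrow> 'a" where "eval_at y \<equiv> (\<lambda>p. poly p y)"

lemma ps1: "i < t \<Longrightarrow> ps ! i = monom 1 (t - 1 - i) * root_poly A"
  by (simp add: ps_def full_basis_def nth_append sylvester_basis_nth1)

lemma ps2: "i < k \<Longrightarrow> ps ! (t + i) = monom 1 (k - 1 - i) * root_poly B"
  by (simp add: ps_def full_basis_def nth_append sylvester_basis_nth2)

lemma ps3: "i \<le> d \<Longrightarrow> ps ! (t + k + i) = monom 1 (d - i)"
  by (simp add: ps_def full_basis_def nth_append del: upt_Suc)

definition "split_term R1 R2 R3 A' B' = coldet
  (map (\<lambda>r. if r \<in> R1 then block3 (coeff_at r) else if r \<in> R2 then block2 (coeff_at r) else block1 (coeff_at r)) [1..<Suc L] @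
   map (\<lambda>a. if a \<in> A' then block3 (eval_at (\<alpha> a)) else block2 (eval_at (\<alpha> a))) as @
   map (\<lambda>b. if b \<in> B' then block3 (eval_at (\<beta> b)) else block1 (eval_at (\<beta> b))) bs @
   [block3 (eval_at x)])"

text \<open>
  Evaluation at a root of the first polynomial vanishes on the first group of rows, evaluation at
  a root of the second one on the second group; so these columns split into two parts only.
\<close>

lemma sres_val_expansion:
  "(-1) ^ d * vdm (map \<alpha> as @ map \<beta> bs) * sres_val d m n (root_poly A) (root_poly B) x =
    (\<Sum>(R1, R2, R3)\<in>tripartitions {1..L}. \<Sum>A' | A' \<subseteq> set as. \<Sum>B' | B' \<subseteq> set bs. split_term R1 R2 R3 A' B')"
proof -
  let ?E = "map (\<lambda>r i. block3 (coeff_at r) i + block2 (coeff_at r) i + block1 (coeff_at r) i) [1..<Suc L]"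
  let ?E' = "\<lambda>R1 R2. map (\<lambda>r. if r \<in> R1 then block3 (coeff_at r) else if r \<in> R2 then block2 (coeff_at r) else block1 (coeff_at r)) [1..<Suc L]"
  let ?a = "map (\<lambda>a i. block3 (eval_at (\<alpha> a)) i + block2 (eval_at (\<alpha> a)) i) as"
  let ?a' = "\<lambda>A'. map (\<lambda>a. if a \<in> A' then block3 (eval_at (\<alpha> a)) else block2 (eval_at (\<alpha> a))) as"
  let ?b = "map (\<lambda>b i. block3 (eval_at (\<beta> b)) i + block1 (eval_at (\<beta> b)) i) bs"
  let ?xi = "[block3 (eval_at x)]"
  have "(-1) ^ d * vdm (map \<alpha> as @ map \<beta> bs) * sres_val d m n (root_poly A) (root_poly B) x =
    coldet (map (\<lambda>\<phi> i. \<phi> (full_basis t k d (root_poly A) (root_poly B) ! i))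
        (map (\<lambda>r p. coeff p (N - r)) [1..<Suc L] @ map (\<lambda>x p. poly p x) (map \<alpha> as @ map \<beta> bs)) @
      [\<lambda>i. if t + k \<le> i then poly (full_basis t k d (root_poly A) (root_poly B) ! i) x else 0])"
    by (rule coldet_full_basis[symmetric])
       (use root_poly_monic[of A] root_poly_monic[of B] dims d_le_m d_le_n d_less
         in \<open>auto simp: size_A size_B k_def N_def\<close>)
  also have "map (\<lambda>\<phi> i. \<phi> (full_basis t k d (root_poly A) (root_poly B) ! i))
        (map (\<lambda>r p. coeff p (N - r)) [1..<Suc L] @ map (\<lambda>x p. poly p x) (map \<alpha> as @ map \<beta> bs)) @
      [\<lambda>i. if t + k \<le> i then poly (full_basis t k d (root_poly A) (root_poly B) ! i) x else 0]
     = ?E @ ?a @ ?b @ ?xi"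
  proof -
    have 1: "(\<lambda>i. coeff (ps ! i) (N - r)) = (\<lambda>i. block3 (coeff_at r) i + block2 (coeff_at r) i + block1 (coeff_at r) i)" for r
      by (rule ext) (auto simp: block1_def block2_def block3_def)
    have 2: "(\<lambda>i. poly (ps ! i) (\<alpha> a)) = (\<lambda>i. block3 (eval_at (\<alpha> a)) i + block2 (eval_at (\<alpha> a)) i)"
      if "a \<in> set as" for a
    proof
      fix i
      have "poly (root_poly A) (\<alpha> a) = 0"
        unfolding poly_root_poly A_def using that by (auto simp: prod_mset_zero_iff)
      then show "poly (ps ! i) (\<alpha> a) = block3 (eval_at (\<alpha> a)) i + block2 (eval_at (\<alpha> a)) i"
        by (cases "i < t") (auto simp: block2_def block3_def ps1)
    qed
    have 3: "(\<lambda>i. poly (ps ! i) (\<beta> b)) = (\<lambda>i. block3 (eval_at (\<beta> b)) i + block1 (eval_at (\<beta> b)) i)"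
      if "b \<in> set bs" for b
    proof
      fix i
      have z: "poly (root_poly B) (\<beta> b) = 0"
        unfolding poly_root_poly B_def using that by (auto simp: prod_mset_zero_iff)
      show "poly (ps ! i) (\<beta> b) = block3 (eval_at (\<beta> b)) i + block1 (eval_at (\<beta> b)) i"
        using z ps2[of "i - t"] by (cases "t \<le> i \<and> i < t + k") (auto simp: block1_def block3_def)
    qed
    have 4: "(\<lambda>i. if t + k \<le> i then poly (ps ! i) x else 0) = block3 (eval_at x)"
      by (rule ext) (simp add: block3_def)
    show ?thesis
      unfolding ps_def[symmetric] 4 by (simp add: 1 2 3 o_def del: upt_Suc)
  qed
  also have "coldet (?E @ ?a @ ?b @ ?xi) =
      (\<Sum>(R1, R2, R3)\<in>tripartitions {1..L}. coldet (?E' R1 R2 @ ?a @ ?b @ ?xi))"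
    using coldet_split3_columns[of "[1..<Suc L]" "[]" "\<lambda>r. block3 (coeff_at r)" "\<lambda>r. block2 (coeff_at r)"
        "\<lambda>r. block1 (coeff_at r)" "?a @ ?b @ ?xi"]
    by (simp only: append_Nil set_upt atLeastLessThanSuc_atLeastAtMost distinct_upt simp_thms)
  also have "\<dots> = (\<Sum>(R1, R2, R3)\<in>tripartitions {1..L}. \<Sum>A' | A' \<subseteq> set as. \<Sum>B' | B' \<subseteq> set bs. split_term R1 R2 R3 A' B')"
  proof -
    have "coldet (?E' R1 R2 @ ?a @ ?b @ ?xi) =
      (\<Sum>A' | A' \<subseteq> set as. \<Sum>B' | B' \<subseteq> set bs. split_term R1 R2 R3 A' B')" for R1 R2 R3
    proof -
      have "coldet (?E' R1 R2 @ ?a @ (?b @ ?xi)) = (\<Sum>A' | A' \<subseteq> set as. coldet (?E' R1 R2 @ ?a' A' @ (?b @ ?xi)))"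
        by (rule coldet_split_columns[OF distinct_as])
      also have "\<dots> = (\<Sum>A' | A' \<subseteq> set as. \<Sum>B' | B' \<subseteq> set bs. split_term R1 R2 R3 A' B')"
      proof (intro sum.cong refl)
        fix A' :: "'l set"
        show "coldet (?E' R1 R2 @ ?a' A' @ (?b @ ?xi)) = (\<Sum>B' | B' \<subseteq> set bs. split_term R1 R2 R3 A' B')"
          using coldet_split_columns[OF distinct_bs, of "?E' R1 R2 @ ?a' A'" "\<lambda>b. block3 (eval_at (\<beta> b))"
              "\<lambda>b. block1 (eval_at (\<beta> b))" ?xi]
          unfolding split_term_def append_assoc .
      qed
      finally show ?thesis .
    qed
    then show ?thesis by (intro sum.cong refl) (auto split: prod.split simp del: upt_Suc)
  qed
  finally show ?thesis .
qed

abbreviation "in_list S xs \<equiv> filter (\<lambda>z. z \<in> S) xs"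
abbreviation "out_list S xs \<equiv> filter (\<lambda>z. z \<notin> S) xs"

definition "first_block R3 B' = coldet (map (\<lambda>\<phi> i. \<phi> (monom 1 (t - 1 - i) * root_poly A))
  (map coeff_at (sorted_list_of_set R3) @ map eval_at (map \<beta> (out_list B' bs))))"
definition "second_block R2 A' = coldet (map (\<lambda>\<phi> i. \<phi> (monom 1 (k - 1 - i) * root_poly B))
  (map coeff_at (sorted_list_of_set R2) @ map eval_at (map \<alpha> (out_list A' as))))"
definition "third_block R1 A' B' = coldet (map (\<lambda>\<phi> i. \<phi> (monom 1 (d - i)))
  (map coeff_at (sorted_list_of_set R1) @ map eval_at (map \<alpha> (in_list A' as) @ map \<beta> (in_list B' bs) @ [x])))"

text \<open>
  The inversions in regrouping columns \<open>R\<^sub>1, R\<^sub>2, R\<^sub>3, A', Abar - A', B', Bbar - B'\<close> by row blocks,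
  as \<open>R\<^sub>3, Bbar - B'; R\<^sub>2, Abar - A'; R\<^sub>1, A', B'\<close>.
\<close>

definition "inversions R1 R2 R3 A' B' = (card R1 + card R2) * card R3 +
  (card R1 + card R2 + card A' + (ma - card A') + card B') * (nb - card B') +
  card R1 * card R2 + (card R1 + card A') * (ma - card A')"

lemma coldet_blocks:
  assumes "length F1 + length F2 + length F3 = Suc N"
  shows "coldet (map block1 F1 @ map block2 F2 @ map block3 F3) =
    (if length F1 = t \<and> length F2 = k \<and> length F3 = Suc d then
      coldet (map (\<lambda>\<phi> i. \<phi> (monom 1 (t - 1 - i) * root_poly A)) F1) *
      coldet (map (\<lambda>\<phi> i. \<phi> (monom 1 (k - 1 - i) * root_poly B)) F2) *
      coldet (map (\<lambda>\<phi> i. \<phi> (monom 1 (d - i))) F3) else 0)"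
proof -
  have "coldet (map block1 F1 @ map block2 F2 @ map block3 F3) =
    (if length (map block1 F1) = t \<and> length (map block2 F2) = k \<and> length (map block3 F3) = Suc d
     then coldet (map block1 F1) * coldet (map (\<lambda>v i. v (t + i)) (map block2 F2)) *
       coldet (map (\<lambda>v i. v (t + k + i)) (map block3 F3)) else 0)"
    by (rule coldet_three_blocks) (use assms dims(2) in \<open>auto simp: block1_def block2_def block3_def\<close>)
  moreover have "coldet (map block1 F1) = coldet (map (\<lambda>\<phi> i. \<phi> (monom 1 (t - 1 - i) * root_poly A)) F1)" if "length F1 = t"
    by (rule coldet_cong) (use that in \<open>auto simp: block1_def ps1\<close>)
  moreover have "coldet (map (\<lambda>v i. v (t + i)) (map block2 F2)) =
      coldet (map (\<lambda>\<phi> i. \<phi> (monom 1 (k - 1 - i) * root_poly B)) F2)" if "length F2 = k"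
    by (rule coldet_cong) (use that in \<open>auto simp: block2_def ps2\<close>)
  moreover have "coldet (map (\<lambda>v i. v (t + k + i)) (map block3 F3)) =
      coldet (map (\<lambda>\<phi> i. \<phi> (monom 1 (d - i))) F3)" if "length F3 = Suc d"
    by (rule coldet_cong) (use that in \<open>auto simp: block3_def ps3\<close>)
  ultimately show ?thesis by auto
qed

text \<open>
  The signs \<open>(-1)\<^bsup>u\<^esup>\<close> and \<open>(-1)\<^bsup>v\<^esup>\<close> of the reorderings of \<open>as\<close> and \<open>bs\<close> remain unspecified;
  they cancel against those of the Vandermonde determinants.
\<close>

lemma split_term_blocks:
  assumes T: "(R1, R2, R3) \<in> tripartitions {1..L}" and A': "A' \<subseteq> set as" and B': "B' \<subseteq> set bs"
  obtains u v :: nat where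
    "split_term R1 R2 R3 A' B' = of_int (sign (listing_perm R1 R2 R3)) * ((-1) ^ u * ((-1) ^ v *
      ((-1) ^ inversions R1 R2 R3 A' B' *
       (if card R3 + (nb - card B') = t \<and> card R2 + (ma - card A') = k \<and> card R1 + card A' + card B' = d
        then first_block R3 B' * second_block R2 A' * third_block R1 A' B' else 0))))"
    "vdm (map \<alpha> as) = (-1) ^ u * vdm (map \<alpha> (in_list A' as @ out_list A' as))"
    "vdm (map \<beta> bs) = (-1) ^ v * vdm (map \<beta> (in_list B' bs @ out_list B' bs))"
proof -
  have un: "R1 \<union> R2 \<union> R3 = {1..L}" and dj: "R1 \<inter> R2 = {}" "R1 \<inter> R3 = {}" "R2 \<inter> R3 = {}"
    using T by (auto simp: tripartitions_def)
  have fin: "finite R1" "finite R2" "finite R3" using un by (metis finite_Un finite_atLeastAtMost)+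
  let ?s1 = "sorted_list_of_set R1" and ?s2 = "sorted_list_of_set R2" and ?s3 = "sorted_list_of_set R3"
  let ?hE = "\<lambda>r. if r \<in> R1 then block3 (coeff_at r) else if r \<in> R2 then block2 (coeff_at r) else block1 (coeff_at r)"
  let ?ha = "\<lambda>a. if a \<in> A' then block3 (eval_at (\<alpha> a)) else block2 (eval_at (\<alpha> a))"
  let ?hb = "\<lambda>b. if b \<in> B' then block3 (eval_at (\<beta> b)) else block1 (eval_at (\<beta> b))"
  let ?a1 = "in_list A' as" and ?a2 = "out_list A' as" and ?b1 = "in_list B' bs" and ?b2 = "out_list B' bs"
  let ?xi = "[block3 (eval_at x)]"
  note ctx = alternating_context[OF alternating_coldet]
  have la: "length ?a1 = card A'" "length ?a2 = ma - card A'" "card A' \<le> ma"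
    using length_filter_distinct[OF distinct_as A'] by auto
  have lb: "length ?b1 = card B'" "length ?b2 = nb - card B'" "card B' \<le> nb"
    using length_filter_distinct[OF distinct_bs B'] by auto
  have msa: "mset as = mset (?a1 @ ?a2)" and msb: "mset bs = mset (?b1 @ ?b2)" by (simp_all add: multiset_partition[symmetric])
  obtain u :: nat where u: "\<And>F :: 'l list \<Rightarrow> 'a. alternating F \<Longrightarrow> F as = (-1) ^ u * F (?a1 @ ?a2)"
    using alternating_mset[OF msa] by blast
  obtain v :: nat where v: "\<And>F :: 'l list \<Rightarrow> 'a. alternating F \<Longrightarrow> F bs = (-1) ^ v * F (?b1 @ ?b2)"
    using alternating_mset[OF msb] by blast
  have E: "map ?hE (?s1 @ ?s2 @ ?s3) = map block3 (map coeff_at ?s1) @ map block2 (map coeff_at ?s2) @ map block1 (map coeff_at ?s3)"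
    using fin dj by auto
  have a: "map ?ha (?a1 @ ?a2) = map block3 (map eval_at (map \<alpha> ?a1)) @ map block2 (map eval_at (map \<alpha> ?a2))" by auto
  have b: "map ?hb (?b1 @ ?b2) = map block3 (map eval_at (map \<beta> ?b1)) @ map block1 (map eval_at (map \<beta> ?b2))" by auto
  have "split_term R1 R2 R3 A' B' = of_int (sign (listing_perm R1 R2 R3)) *
      coldet (map ?hE (?s1 @ ?s2 @ ?s3) @ map ?ha as @ map ?hb bs @ ?xi)"
    unfolding split_term_def
    using alternating_listing_perm[OF ctx[of "[]" ?hE "map ?ha as @ map ?hb bs @ ?xi"] T]
    by (simp only: append_Nil)
  also have "coldet (map ?hE (?s1 @ ?s2 @ ?s3) @ map ?ha as @ map ?hb bs @ ?xi) =
      (-1) ^ u * coldet (map ?hE (?s1 @ ?s2 @ ?s3) @ map ?ha (?a1 @ ?a2) @ map ?hb bs @ ?xi)"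
    by (rule u[OF ctx[of "map ?hE (?s1 @ ?s2 @ ?s3)" ?ha "map ?hb bs @ ?xi"]])
  also have "coldet (map ?hE (?s1 @ ?s2 @ ?s3) @ map ?ha (?a1 @ ?a2) @ map ?hb bs @ ?xi) =
      (-1) ^ v * coldet (map ?hE (?s1 @ ?s2 @ ?s3) @ map ?ha (?a1 @ ?a2) @ map ?hb (?b1 @ ?b2) @ ?xi)"
    using v[OF ctx[of "map ?hE (?s1 @ ?s2 @ ?s3) @ map ?ha (?a1 @ ?a2)" ?hb ?xi]] by (simp only: append_assoc)
  also have "coldet (map ?hE (?s1 @ ?s2 @ ?s3) @ map ?ha (?a1 @ ?a2) @ map ?hb (?b1 @ ?b2) @ ?xi) =
      (-1) ^ inversions R1 R2 R3 A' B' * coldet (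
        map block1 (map coeff_at ?s3 @ map eval_at (map \<beta> ?b2)) @
        map block2 (map coeff_at ?s2 @ map eval_at (map \<alpha> ?a2)) @
        map block3 (map coeff_at ?s1 @ map eval_at (map \<alpha> ?a1 @ map \<beta> ?b1 @ [x])))"
    unfolding E a b append_assoc
    by (subst alternating_regroup[OF alternating_coldet])
       (simp add: inversions_def la lb fin)
  also have "coldet (
        map block1 (map coeff_at ?s3 @ map eval_at (map \<beta> ?b2)) @
        map block2 (map coeff_at ?s2 @ map eval_at (map \<alpha> ?a2)) @
        map block3 (map coeff_at ?s1 @ map eval_at (map \<alpha> ?a1 @ map \<beta> ?b1 @ [x]))) =
     (if card R3 + (nb - card B') = t \<and> card R2 + (ma - card A') = k \<and> card R1 + card A' + card B' = d
        then first_block R3 B' * second_block R2 A' * third_block R1 A' B' else 0)"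
  proof (subst coldet_blocks)
    have "card (R1 \<union> R2 \<union> R3) = card R1 + card R2 + card R3"
      using fin dj by (simp add: card_Un_disjoint Int_Un_distrib2)
    then have "card R1 + card R2 + card R3 = L" using un by simp
    then show "length (map coeff_at ?s3 @ map eval_at (map \<beta> ?b2)) + length (map coeff_at ?s2 @ map eval_at (map \<alpha> ?a2)) +
      length (map coeff_at ?s1 @ map eval_at (map \<alpha> ?a1 @ map \<beta> ?b1 @ [x])) = Suc N"
      using la lb by (simp add: N_def)
  qed (simp add: la lb first_block_def second_block_def third_block_def add.assoc)
  finally have 1: "split_term R1 R2 R3 A' B' = of_int (sign (listing_perm R1 R2 R3)) * ((-1) ^ u * ((-1) ^ v *
      ((-1) ^ inversions R1 R2 R3 A' B' *
       (if card R3 + (nb - card B') = t \<and> card R2 + (ma - card A') = k \<and> card R1 + card A' + card B' = d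
        then first_block R3 B' * second_block R2 A' * third_block R1 A' B' else 0))))" .
  show thesis
    by (rule that[OF 1 u[OF alternating_vandermonde[of \<alpha>]] v[OF alternating_vandermonde[of \<beta>]]])
qed

end

section \<open>The Sylvester sum over an integral domain with separated roots\<close>

lemma collect_signs:
  fixes a b c p q d :: nat and s :: int
  assumes "even (int a + int b + int c + int p + int q + int d + s)"
  shows "(-1) ^ b * (-1) ^ a * (-1) ^ c * (-1) ^ p * (-1) ^ q = (-1) ^ d * (if even s then 1 else (-1 :: 'a::comm_ring_1))"
  using assms
  by (cases "even a"; cases "even b"; cases "even c"; cases "even p"; cases "even q"; cases "even d"; cases "even s";
      simp add: minus_one_power_iff)

lemma regroup_factors:
  fixes X :: "'a::comm_ring_1"
  assumes "X = g * (U * (V * (I * (E * S * (v2 * (M * (q12 * q22 * q0))) * (w2 * (q21 * q22 * p0)) *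
    (w1 * (q11 * (e1 * x1)) * (v1 * (e2 * x2)))))))"
  shows "X * D1 * D2 = (I * E * M * e1 * e2) * (g * (q0 * (q22 * p0) * (x1 * x2 * S)) *
    (U * (w1 * D1 * w2) * (q11 * q12 * (q21 * q22)) * (V * (v1 * D2 * v2))))"
  unfolding assms by (simp only: mult_ac)

context sylvester_data
begin

abbreviation "\<alpha>s S \<equiv> image_mset \<alpha> (mset_set S)"
abbreviation "\<beta>s S \<equiv> image_mset \<beta> (mset_set S)"

definition "schur_product R1 R2 R3 A' B' = (if m' + n' \<le> d then 1 else
   schur (m + n - d) R2 (\<alpha>s (set as - A') + B) * schur (m + n - d) R3 (A + \<beta>s (set bs - B')) *
   schur (d + 1) ((\<lambda>i. i - (m + n - 2 * d - 1)) ` R1) (\<alpha>s A' + \<beta>s B' + {#x#}))"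

lemma mset_lists:
  assumes "A' \<subseteq> set as" "B' \<subseteq> set bs"
  shows "mset (map \<alpha> (in_list A' as)) = \<alpha>s A'" "mset (map \<alpha> (out_list A' as)) = \<alpha>s (set as - A')"
    "mset (map \<beta> (in_list B' bs)) = \<beta>s B'" "mset (map \<beta> (out_list B' bs)) = \<beta>s (set bs - B')"
  using mset_filter_distinct(1)[OF distinct_as assms(1)] mset_filter_distinct(2)[OF distinct_as]
    mset_filter_distinct(1)[OF distinct_bs assms(2)] mset_filter_distinct(2)[OF distinct_bs]
  by (simp_all only: mset_map)

lemma sum_card_tripartition:
  assumes "(R1, R2, R3) \<in> tripartitions {1..L}"
  shows "card R1 + card R2 + card R3 = L" "R1 \<subseteq> {1..L}" "R2 \<subseteq> {1..L}" "R3 \<subseteq> {1..L}"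
proof -
  have un: "R1 \<union> R2 \<union> R3 = {1..L}" and dj: "R1 \<inter> R2 = {}" "R1 \<inter> R3 = {}" "R2 \<inter> R3 = {}"
    using assms by (auto simp: tripartitions_def)
  have fin: "finite R1" "finite R2" "finite R3" using un by (metis finite_Un finite_atLeastAtMost)+
  have "card (R1 \<union> R2 \<union> R3) = card R1 + card R2 + card R3"
    using fin dj by (simp add: card_Un_disjoint Int_Un_distrib2)
  then show "card R1 + card R2 + card R3 = L" using un by simp
  show "R1 \<subseteq> {1..L}" "R2 \<subseteq> {1..L}" "R3 \<subseteq> {1..L}" using un by auto
qed

lemma third_block_eq_0:
  assumes T: "(R1, R2, R3) \<in> tripartitions {1..L}" and A': "A' \<subseteq> set as" and B': "B' \<subseteq> set bs"
    and c: "card R1 + card A' + card B' = d" and R1: "\<not> R1 \<subseteq> {m + n - 2 * d..}"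
  shows "third_block R1 A' B' = 0"
proof -
  let ?zs = "map \<alpha> (in_list A' as) @ map \<beta> (in_list B' bs) @ [x]"
  have L: "L > 0" using R1 sum_card_tripartition(2)[OF T] by (cases "L = 0") auto
  have Nd: "N - d = m + n - 2 * d" using dims_pos(2)[OF L] dims(4) by linarith
  have "third_block R1 A' B' = coldet (map (\<lambda>r i. coeff (monom 1 (d - i)) (N - r)) (sorted_list_of_set R1) @ map (\<lambda>z i. z ^ (d - i)) ?zs)"
    unfolding third_block_def by (intro arg_cong[of _ _ coldet]) (simp add: o_def poly_monom)
  also have "\<dots> = 0"
  proof (subst coldet_low_monomials)
    show "R1 \<subseteq> {1..N}" using sum_card_tripartition(2)[OF T] by (auto simp: N_def)
    show "card R1 + length ?zs = Suc d"
      using c length_filter_distinct(1)[OF distinct_as A'] length_filter_distinct(1)[OF distinct_bs B'] by simp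
  qed (use dims R1 Nd in auto)
  finally show ?thesis .
qed

lemma blocks_value:
  assumes T: "(R1, R2, R3) \<in> tripartitions {1..L}" and A': "A' \<subseteq> set as" and B': "B' \<subseteq> set bs"
    and c3: "card R3 + (nb - card B') = t" and c2: "card R2 + (ma - card A') = k"
    and c1: "card R1 + card A' + card B' = d" and R1: "R1 \<subseteq> {m + n - 2 * d..}"
  obtains e :: nat where
    "first_block R3 B' * second_block R2 A' * third_block R1 A' B' =
      (-1) ^ e * schur_product R1 R2 R3 A' B' *
      (vdm (map \<beta> (out_list B' bs)) * diff_prod (\<beta>s (set bs - B')) A) *
      (vdm (map \<alpha> (out_list A' as)) * diff_prod (\<alpha>s (set as - A')) B) *
      vdm (map \<alpha> (in_list A' as) @ map \<beta> (in_list B' bs) @ [x])"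
    "even (int e + int (inversions R1 R2 R3 A' B') + int ((nb - card B') * m) + int (card A') + int (card B') + int d +
      (sigma_exponent d m n ma nb R1 R2 R3 + int (d * (m - d) + m' * (m - d))))"
proof -
  let ?zs = "map \<alpha> (in_list A' as) @ map \<beta> (in_list B' bs) @ [x]"
  let ?a2 = "map \<alpha> (out_list A' as)" and ?b2 = "map \<beta> (out_list B' bs)"
  note ms = mset_lists[OF A' B']
  note cT = sum_card_tripartition[OF T]
  have la: "length (in_list A' as) = card A'" "length ?a2 = ma - card A'" "card A' \<le> ma"
    using length_filter_distinct[OF distinct_as A'] by auto
  have lb: "length (in_list B' bs) = card B'" "length ?b2 = nb - card B'" "card B' \<le> nb"
    using length_filter_distinct[OF distinct_bs B'] by auto
  have mz: "mset ?zs = \<alpha>s A' + \<beta>s B' + {#x#}" using ms by simp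
  have first: "first_block R3 B' = schur_coldet N t R3 A ?b2"
    unfolding first_block_def schur_coldet_def by (intro arg_cong[of _ _ coldet]) (simp add: o_def)
  have second: "second_block R2 A' = schur_coldet N k R2 B ?a2"
    unfolding second_block_def schur_coldet_def by (intro arg_cong[of _ _ coldet]) (simp add: o_def)
  have third: "third_block R1 A' B' = coldet (map (\<lambda>r i. coeff (monom 1 (d - i)) (N - r)) (sorted_list_of_set R1) @ map (\<lambda>z i. z ^ (d - i)) ?zs)"
    unfolding third_block_def by (intro arg_cong[of _ _ coldet]) (simp add: o_def poly_monom)
  show thesis
  proof (cases "L = 0")
    case True
    then have R: "R1 = {}" "R2 = {}" "R3 = {}" using cT by auto
    have "first_block R3 B' = vdm ?b2 * diff_prod (\<beta>s (set bs - B')) A"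
      using schur_coldet_empty[of N ?b2 A] c3 lb ms unfolding first unfolding R by simp
    moreover have "second_block R2 A' = vdm ?a2 * diff_prod (\<alpha>s (set as - A')) B"
      using schur_coldet_empty[of N ?a2 B] c2 la ms unfolding second unfolding R by simp
    moreover have "third_block R1 A' B' = vdm ?zs"
      unfolding third unfolding R using c1 R la lb det_vandermonde_coldet[of ?zs] by simp
    moreover have "schur_product R1 R2 R3 A' B' = 1"
      using dims_zero(2)[OF True] by (simp add: schur_product_def)
    ultimately have 1: "first_block R3 B' * second_block R2 A' * third_block R1 A' B' =
      (-1) ^ 0 * schur_product R1 R2 R3 A' B' *
      (vdm ?b2 * diff_prod (\<beta>s (set bs - B')) A) * (vdm ?a2 * diff_prod (\<alpha>s (set as - A')) B) * vdm ?zs"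
      by simp
    have even: "even ((int (card A') + int (ma - card A') + int (card B')) * int (nb - card B') +
        int (card A') * int (ma - card A') + int (nb - card B') * int m + int (card A') + int (card B') + int d +
        (int d * int k + int m' * int k))"
      by (rule sign_parity_zero[where nb = "int nb" and t = "int t" and ma = "int ma"])
         (use c1 c2 c3 R dims(4) dims_zero(1)[OF True] la lb in auto)
    have 2: "even (int 0 + int (inversions R1 R2 R3 A' B') + int ((nb - card B') * m) + int (card A') + int (card B') + int d +
      (sigma_exponent d m n ma nb R1 R2 R3 + int (d * (m - d) + m' * (m - d))))"
    proof -
      have s: "sigma_exponent d m n ma nb {} {} {} = 0" by (simp add: sigma_exponent_def)
      show ?thesis using even unfolding R s inversions_def card.empty k_def
        by (simp only: of_nat_add of_nat_mult of_nat_0 add_0_left add_0_right mult_zero_left mult_zero_right ac_simps)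
    qed
    show thesis by (rule that[OF 1 2])
  next
    case False
    then have L: "L > 0" by simp
    have N: "N = m + n - d" "N - d - 1 = m + n - 2 * d - 1" "N - d = m + n - 2 * d"
      using dims_pos(2)[OF L] dims(4) by linarith+
    have "{1..L} \<subseteq> {1..N}" by (simp add: N_def)
    then have RN: "R1 \<subseteq> {1..N}" "R2 \<subseteq> {1..N}" "R3 \<subseteq> {1..N}" using cT(2-4) by (meson order_trans)+
    have lz: "card R1 + length ?zs = Suc d" using c1 la(1) lb(1) by simp
    let ?R = "(\<lambda>i. i - (m + n - 2 * d - 1)) ` R1"
    let ?e = "displacement R3 + displacement R2 + displacement ?R"
    have "first_block R3 B' = (-1) ^ displacement R3 * schur N R3 (mset ?b2 + A) * vdm ?b2 * diff_prod (mset ?b2) A"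
      unfolding first
      by (rule schur_coldet_eq[OF RN(3)]) (simp_all only: c3 lb(2) dims(1) size_A)
    moreover have "second_block R2 A' = (-1) ^ displacement R2 * schur N R2 (mset ?a2 + B) * vdm ?a2 * diff_prod (mset ?a2) B"
      unfolding second
      by (rule schur_coldet_eq[OF RN(2)]) (simp_all only: c2 la(2) dims_pos(2)[OF L] size_B)
    moreover have "third_block R1 A' B' = (-1) ^ displacement ?R * schur (d + 1) ?R (mset ?zs) * vdm ?zs"
      using coldet_low_monomials[OF RN(1) lz dims(5)] R1 unfolding third N(2,3) Let_def by (simp only: if_True)
    moreover have "schur_product R1 R2 R3 A' B' = schur N R2 (mset ?a2 + B) * schur N R3 (mset ?b2 + A) * schur (d + 1) ?R (mset ?zs)"
      using dims_pos(3)[OF L] L unfolding schur_product_def mz ms N(1)[symmetric] by (simp add: add.commute)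
    ultimately have 1: "first_block R3 B' * second_block R2 A' * third_block R1 A' B' =
      (-1) ^ ?e * schur_product R1 R2 R3 A' B' *
      (vdm ?b2 * diff_prod (\<beta>s (set bs - B')) A) * (vdm ?a2 * diff_prod (\<alpha>s (set as - A')) B) * vdm ?zs"
      unfolding ms power_add by (simp only: mult_ac)
    have "displacement ?R + displacement R2 + displacement R3 + card R1 * (m + n - 2 * d - 1) =
        card R1 * card R2 + card R1 * card R3 + card R2 * card R3"
    proof (rule displacement_tripartition[OF T])
      fix r assume "r \<in> R1"
      then have "m + n - 2 * d \<le> r" using R1 by blast
      then show "m + n - 2 * d - 1 < r" using d_less by linarith
    qed
    from arg_cong[OF this, of int] have "int ?e + int (card R1) * int (m + n - 2 * d - 1) = int (card R1) * int (card R2) +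
        int (card R1) * int (card R3) + int (card R2) * int (card R3)"
      by (simp only: of_nat_add of_nat_mult ac_simps)
    moreover have "int (m + n - 2 * d - 1) = int k + int t - 1"
      using dims_pos(1)[OF L] dims(4) d_less by linarith
    ultimately have e: "int ?e = int (card R1) * int (card R2) + int (card R1) * int (card R3) +
        int (card R2) * int (card R3) - int (card R1) * (int k + int t - 1)" by simp
    have "even (int ?e + ((int (card R1) + int (card R2)) * int (card R3) +
        (int (card R1) + int (card R2) + int (card A') + int (ma - card A') + int (card B')) * int (nb - card B') +
        int (card R1) * int (card R2) + (int (card R1) + int (card A')) * int (ma - card A')) +
        int (nb - card B') * int m + int (card A') + int (card B') + int d +
        (int d * int k + int m' * int k + (int (card R1) * (int n - int d + int (card R2) + int (card R3)) +
         int (card R2) * (int ma - 1) + int (card R3) * (int m' + int n' - int d - 1) + int (card R2) * int (card R3))))"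
      by (rule sign_parity_pos[OF _ _ _ _ _ _ _ _ _ e, where nb = "int nb"])
         (insert c1 c2 c3 dims(4) dims_pos(1)[OF L] la(3) lb(3), linarith+)
    moreover have "sigma_exponent d m n ma nb R1 R2 R3 = int (card R1) * (int n - int d + int (card R2) + int (card R3)) +
         int (card R2) * (int ma - 1) + int (card R3) * (int m' + int n' - int d - 1) + int (card R2) * int (card R3)"
      by (simp add: sigma_exponent_def Let_def)
    ultimately have 2: "even (int ?e + int (inversions R1 R2 R3 A' B') + int ((nb - card B') * m) + int (card A') + int (card B') + int d +
      (sigma_exponent d m n ma nb R1 R2 R3 + int (d * (m - d) + m' * (m - d))))"
      by (simp only: inversions_def k_def of_nat_add of_nat_mult ac_simps)
    show thesis by (rule that[OF 1 2])
  qed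
qed

definition "term_sign R1 R2 R3 =
  (if even (sigma_exponent d m n ma nb R1 R2 R3 + int (d * (m - d) + m' * (m - d))) then 1 else -1) *
  of_int (sign (listing_perm R1 R2 R3))"

definition "sum_term R1 R2 R3 A' B' =
  diff_prod A0 (\<beta>s (set bs - B')) * diff_prod (\<alpha>s (set as - A')) (\<beta>s (set bs - B') + B0) *
  (diff_prod {#x#} (\<alpha>s A') * diff_prod {#x#} (\<beta>s B') * schur_product R1 R2 R3 A' B')"

text \<open>
  The heart of the proof: the contribution of a term of the expansion is, up to the factor
  common to all terms, the corresponding term of the Sylvester sum. The differences between
  \<open>Abar\<close> and \<open>Bbar\<close> come from all three blocks, namely \<open>\<R>(A',B')\<close> from the third,
  \<open>\<R>(Abar - A',B')\<close> and \<open>\<R>(Abar - A',Bbar - B')\<close> from the second and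
  \<open>\<R>(Abar,Bbar - B')\<close> from the first; this includes \<open>\<R>(Abar - A',Bbar - B')\<close>
  twice, one of them being left over in the term.
\<close>

lemma split_term_value:
  assumes T: "(R1, R2, R3) \<in> tripartitions {1..L}" and A': "A' \<subseteq> set as" and B': "B' \<subseteq> set bs"
    and c3: "card R3 + (nb - card B') = t" and c2: "card R2 + (ma - card A') = k"
    and c1: "card R1 + card A' + card B' = d" and R1: "R1 \<subseteq> {m + n - 2 * d..}"
  shows "split_term R1 R2 R3 A' B' * diff_prod (\<alpha>s A') (\<alpha>s (set as - A')) * diff_prod (\<beta>s B') (\<beta>s (set bs - B')) =
    (-1) ^ d * vdm (map \<alpha> as @ map \<beta> bs) * (term_sign R1 R2 R3 * sum_term R1 R2 R3 A' B')"
proof -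
  let ?a1 = "map \<alpha> (in_list A' as)" and ?a2 = "map \<alpha> (out_list A' as)"
    and ?b1 = "map \<beta> (in_list B' bs)" and ?b2 = "map \<beta> (out_list B' bs)"
  let ?A1 = "\<alpha>s A'" and ?A2 = "\<alpha>s (set as - A')" and ?B1 = "\<beta>s B'" and ?B2 = "\<beta>s (set bs - B')"
  note ms = mset_lists[OF A' B']
  have sizes: "size ?A1 = card A'" "size ?B1 = card B'" "size ?B2 = nb - card B'"
    using length_filter_distinct[OF distinct_bs B'] distinct_card[OF distinct_bs]
      card_Diff_subset[OF finite_subset[OF B'] B'] by simp_all
  have parts: "image_mset \<alpha> (mset as) = ?A1 + ?A2" "image_mset \<beta> (mset bs) = ?B1 + ?B2"
    unfolding ms[symmetric] mset_map image_mset_union[symmetric] by (simp_all add: multiset_partition[symmetric])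
  obtain u v :: nat where
    s: "split_term R1 R2 R3 A' B' = of_int (sign (listing_perm R1 R2 R3)) * ((-1) ^ u * ((-1) ^ v *
      ((-1) ^ inversions R1 R2 R3 A' B' *
       (if card R3 + (nb - card B') = t \<and> card R2 + (ma - card A') = k \<and> card R1 + card A' + card B' = d
        then first_block R3 B' * second_block R2 A' * third_block R1 A' B' else 0))))"
    and u: "vdm (map \<alpha> as) = (-1) ^ u * vdm (map \<alpha> (in_list A' as @ out_list A' as))"
    and v: "vdm (map \<beta> bs) = (-1) ^ v * vdm (map \<beta> (in_list B' bs @ out_list B' bs))"
    using split_term_blocks[OF T A' B'] by blast
  obtain e :: nat where
    val: "first_block R3 B' * second_block R2 A' * third_block R1 A' B' =
      (-1) ^ e * schur_product R1 R2 R3 A' B' * (vdm ?b2 * diff_prod ?B2 A) * (vdm ?a2 * diff_prod ?A2 B) *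
      vdm (?a1 @ ?b1 @ [x])"
    and par: "even (int e + int (inversions R1 R2 R3 A' B') + int ((nb - card B') * m) + int (card A') + int (card B') + int d +
      (sigma_exponent d m n ma nb R1 R2 R3 + int (d * (m - d) + m' * (m - d))))"
    using blocks_value[OF T A' B' c3 c2 c1 R1] by blast
  have va: "vdm (map \<alpha> as) = (-1) ^ u * (vdm ?a1 * diff_prod ?A1 ?A2 * vdm ?a2)"
    unfolding u map_append vandermonde_append ms ..
  have vb: "vdm (map \<beta> bs) = (-1) ^ v * (vdm ?b1 * diff_prod ?B1 ?B2 * vdm ?b2)"
    unfolding v map_append vandermonde_append ms ..
  have vab: "vdm (map \<alpha> as @ map \<beta> bs) = vdm (map \<alpha> as) * diff_prod (?A1 + ?A2) (?B1 + ?B2) * vdm (map \<beta> bs)"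
    unfolding vandermonde_append mset_map parts ..
  have RAB: "diff_prod (?A1 + ?A2) (?B1 + ?B2) =
      diff_prod ?A1 ?B1 * diff_prod ?A1 ?B2 * (diff_prod ?A2 ?B1 * diff_prod ?A2 ?B2)"
    by (simp only: diff_prod_add_left diff_prod_add_right mult_ac)
  have b2A: "diff_prod ?B2 A = (-1) ^ ((nb - card B') * m) * (diff_prod ?A1 ?B2 * diff_prod ?A2 ?B2 * diff_prod A0 ?B2)"
    unfolding diff_prod_swap[of ?B2 A] size_A sizes by (simp only: A_def parts diff_prod_add_left)
  have a2B: "diff_prod ?A2 B = diff_prod ?A2 ?B1 * diff_prod ?A2 ?B2 * diff_prod ?A2 B0"
    by (simp only: B_def parts diff_prod_add_right)
  have v1: "vdm [x] = 1" using det_single[of "vandermonde 1 [x]"] by (simp add: vandermonde_def)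
  have z: "vdm (?a1 @ ?b1 @ [x]) = vdm ?a1 * (diff_prod ?A1 ?B1 * ((-1) ^ card A' * diff_prod {#x#} ?A1)) *
      (vdm ?b1 * ((-1) ^ card B' * diff_prod {#x#} ?B1))"
  proof -
    have 1: "diff_prod ?A1 {#x#} = (-1) ^ card A' * diff_prod {#x#} ?A1"
      "diff_prod ?B1 {#x#} = (-1) ^ card B' * diff_prod {#x#} ?B1"
      using diff_prod_swap[of ?A1 "{#x#}"] diff_prod_swap[of ?B1 "{#x#}"] by (simp_all add: sizes)
    have 2: "mset [x] = {#x#}" by simp
    show ?thesis
      unfolding vandermonde_append[of ?a1] vandermonde_append[of ?b1] mset_append ms v1 2 diff_prod_add_right 1
      by (simp only: mult_ac mult_1_right mult_1_left)
  qed
  have sg: "(-1) ^ inversions R1 R2 R3 A' B' * (-1) ^ e * (-1) ^ ((nb - card B') * m) * (-1) ^ card A' * (-1) ^ card B' =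
      (-1) ^ d * (if even (sigma_exponent d m n ma nb R1 R2 R3 + int (d * (m - d) + m' * (m - d))) then 1 else (-1 :: 'a))"
    by (rule collect_signs[OF par])
  have s': "split_term R1 R2 R3 A' B' = of_int (sign (listing_perm R1 R2 R3)) * ((-1) ^ u * ((-1) ^ v *
      ((-1) ^ inversions R1 R2 R3 A' B' * (first_block R3 B' * second_block R2 A' * third_block R1 A' B'))))"
    using s c1 c2 c3 by simp
  have "split_term R1 R2 R3 A' B' * diff_prod ?A1 ?A2 * diff_prod ?B1 ?B2 =
    ((-1) ^ inversions R1 R2 R3 A' B' * (-1) ^ e * (-1) ^ ((nb - card B') * m) * (-1) ^ card A' * (-1) ^ card B') *
    (of_int (sign (listing_perm R1 R2 R3)) * sum_term R1 R2 R3 A' B' * vdm (map \<alpha> as @ map \<beta> bs))"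
    unfolding vab va vb RAB sum_term_def diff_prod_add_right[of ?A2 ?B2]
    by (rule regroup_factors[OF s'[unfolded val b2A a2B z]])
  then show ?thesis unfolding sg term_sign_def by (simp only: mult_ac)
qed

lemma vandermonde_nonzero: "vdm (map \<alpha> as @ map \<beta> bs) \<noteq> 0"
proof (rule det_vandermonde_nonzero)
  show "distinct (map \<alpha> as @ map \<beta> bs)"
    using distinct_as distinct_bs inj_\<alpha> inj_\<beta> apart by (auto simp: distinct_map)
qed

text \<open>
  The sizes forced by the three row blocks are those prescribed in the Sylvester sum.
\<close>

lemma index_conditions:
  assumes T: "(R1, R2, R3) \<in> tripartitions {1..L}" and A': "A' \<subseteq> set as" and B': "B' \<subseteq> set bs"
  shows "(R1, R2, R3) \<in> index_triples d m n ma nb \<and> int (card A') = int (card R2) + int d - int m' \<and>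
      int (card B') = int (card R3) + min (int m') (int d - int n') \<longleftrightarrow>
    card R3 + (nb - card B') = t \<and> card R2 + (ma - card A') = k \<and> card R1 + card A' + card B' = d \<and>
      R1 \<subseteq> {m + n - 2 * d..}"
proof -
  note cT = sum_card_tripartition[OF T]
  have ca: "card A' \<le> ma" using card_mono[OF _ A'] distinct_card[OF distinct_as] by simp
  have cb: "card B' \<le> nb" using card_mono[OF _ B'] distinct_card[OF distinct_bs] by simp
  have idx: "(R1, R2, R3) \<in> index_triples d m n ma nb \<longleftrightarrow> R1 \<subseteq> {m + n - 2 * d..L} \<and>
       int (card R1) \<le> max 0 (int d - (int ma + int nb) + 1) \<and>
       int m' - int d \<le> int (card R2) \<and> int (card R2) \<le> int m - int d \<and>
       int n' - int d \<le> int (card R3) \<and> int (card R3) \<le> int n - int d"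
    using T by (auto simp: index_triples_def tripartitions_def Let_def L_def)
  have sub: "R1 \<subseteq> {m + n - 2 * d..L} \<longleftrightarrow> R1 \<subseteq> {m + n - 2 * d..}"
  proof -
    have "{1..L} \<subseteq> {..L}" by auto
    then have "R1 \<subseteq> {..L}" using cT(2) by (rule order_trans[rotated])
    moreover have "{m + n - 2 * d..L} = {m + n - 2 * d..} \<inter> {..L}" by auto
    ultimately show ?thesis by simp
  qed
  show ?thesis
  proof (cases "L = 0")
    case True
    then have R: "R1 = {}" "R2 = {}" "R3 = {}" using cT by auto
    show ?thesis unfolding idx sub unfolding R
      using dims_zero[OF True] dims(4) ca cb d_le_m d_le_n by auto
  next
    case False
    then have L: "L > 0" by simp
    have c1: "int (card R1) \<le> max 0 (int d - (int ma + int nb) + 1)" if "R1 \<subseteq> {m + n - 2 * d..}"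
    proof -
      have "card R1 \<le> card {m + n - 2 * d..L}" using that sub by (intro card_mono) auto
      then show ?thesis using dims_pos(3)[OF L] d_less by simp
    qed
    show ?thesis unfolding idx sub
      using c1 dims_pos[OF L] dims(4) ca cb cT(1) by (auto simp: min_def)
  qed
qed

text \<open>
  The weights \<open>w1\<close> and \<open>w2\<close> are the inverses of the denominators, which an integral domain
  need not contain in general.
\<close>

lemma sres_val_eq_sum:
  assumes w1: "\<And>S. S \<subseteq> set as \<Longrightarrow> w1 S * diff_prod (\<alpha>s S) (\<alpha>s (set as - S)) = 1"
    and w2: "\<And>S. S \<subseteq> set bs \<Longrightarrow> w2 S * diff_prod (\<beta>s S) (\<beta>s (set bs - S)) = 1"
  shows "sres_val d m n (root_poly A) (root_poly B) x =
    (\<Sum>(R1, R2, R3) \<in> index_triples d m n ma nb.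
     \<Sum>A' \<in> {A'. A' \<subseteq> set as \<and> int (card A') = int (card R2) + int d - int m'}.
     \<Sum>B' \<in> {B'. B' \<subseteq> set bs \<and> int (card B') = int (card R3) + min (int m') (int d - int n')}.
       term_sign R1 R2 R3 * w1 A' * w2 B' * sum_term R1 R2 R3 A' B')"
    (is "_ = ?S")
proof -
  let ?V = "(-1) ^ d * vdm (map \<alpha> as @ map \<beta> bs)"
  let ?PA = "\<lambda>R2 A'. int (card A') = int (card R2) + int d - int m'"
  let ?PB = "\<lambda>R3 B'. int (card B') = int (card R3) + min (int m') (int d - int n')"
  have zero: "split_term R1 R2 R3 A' B' = 0"
    if T: "(R1, R2, R3) \<in> tripartitions {1..L}" and A': "A' \<subseteq> set as" and B': "B' \<subseteq> set bs"
      and no: "\<not> ((R1, R2, R3) \<in> index_triples d m n ma nb \<and> ?PA R2 A' \<and> ?PB R3 B')" for R1 R2 R3 A' B'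
  proof -
    obtain u v :: nat where
      s: "split_term R1 R2 R3 A' B' = of_int (sign (listing_perm R1 R2 R3)) * ((-1) ^ u * ((-1) ^ v *
        ((-1) ^ inversions R1 R2 R3 A' B' *
         (if card R3 + (nb - card B') = t \<and> card R2 + (ma - card A') = k \<and> card R1 + card A' + card B' = d
          then first_block R3 B' * second_block R2 A' * third_block R1 A' B' else 0))))"
      using split_term_blocks[OF T A' B'] by blast
    show ?thesis
      using no third_block_eq_0[OF T A' B'] unfolding s index_conditions[OF T A' B'] by auto
  qed
  have val: "split_term R1 R2 R3 A' B' = ?V * (term_sign R1 R2 R3 * w1 A' * w2 B' * sum_term R1 R2 R3 A' B')"
    if T: "(R1, R2, R3) \<in> tripartitions {1..L}" and A': "A' \<subseteq> set as" and B': "B' \<subseteq> set bs"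
      and yes: "(R1, R2, R3) \<in> index_triples d m n ma nb" "?PA R2 A'" "?PB R3 B'" for R1 R2 R3 A' B'
  proof -
    have "split_term R1 R2 R3 A' B' * diff_prod (\<alpha>s A') (\<alpha>s (set as - A')) * diff_prod (\<beta>s B') (\<beta>s (set bs - B')) =
      ?V * (term_sign R1 R2 R3 * sum_term R1 R2 R3 A' B')"
      using split_term_value[OF T A' B'] index_conditions[OF T A' B'] yes by blast
    then have "split_term R1 R2 R3 A' B' * (w1 A' * diff_prod (\<alpha>s A') (\<alpha>s (set as - A'))) *
        (w2 B' * diff_prod (\<beta>s B') (\<beta>s (set bs - B'))) =
      ?V * (term_sign R1 R2 R3 * w1 A' * w2 B' * sum_term R1 R2 R3 A' B')"
      by (metis (no_types, lifting) mult.assoc mult.commute mult.left_commute)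
    then show ?thesis unfolding w1[OF A'] w2[OF B'] by simp
  qed
  have sub: "index_triples d m n ma nb \<subseteq> tripartitions {1..L}"
    by (auto simp: index_triples_def tripartitions_def Let_def L_def)
  have fin: "finite {A'. A' \<subseteq> set as}" "finite {B'. B' \<subseteq> set bs}" by simp_all
  have "?V * sres_val d m n (root_poly A) (root_poly B) x =
    (\<Sum>(R1, R2, R3)\<in>tripartitions {1..L}. \<Sum>A' | A' \<subseteq> set as. \<Sum>B' | B' \<subseteq> set bs. split_term R1 R2 R3 A' B')"
    by (rule sres_val_expansion)
  also have "\<dots> = (\<Sum>(R1, R2, R3)\<in>index_triples d m n ma nb. \<Sum>A' | A' \<subseteq> set as. \<Sum>B' | B' \<subseteq> set bs. split_term R1 R2 R3 A' B')"
  proof (rule sum.mono_neutral_right[OF finite_tripartitions sub])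
    show "\<forall>T\<in>tripartitions {1..L} - index_triples d m n ma nb.
      (case T of (R1, R2, R3) \<Rightarrow> \<Sum>A' | A' \<subseteq> set as. \<Sum>B' | B' \<subseteq> set bs. split_term R1 R2 R3 A' B') = 0"
      by (auto intro!: sum.neutral zero)
  qed simp
  also have "\<dots> = (\<Sum>(R1, R2, R3)\<in>index_triples d m n ma nb.
      \<Sum>A' | A' \<subseteq> set as \<and> ?PA R2 A'. \<Sum>B' | B' \<subseteq> set bs \<and> ?PB R3 B'.
        ?V * (term_sign R1 R2 R3 * w1 A' * w2 B' * sum_term R1 R2 R3 A' B'))"
  proof -
    have "(\<Sum>A' | A' \<subseteq> set as. \<Sum>B' | B' \<subseteq> set bs. split_term R1 R2 R3 A' B') =
      (\<Sum>A' | A' \<subseteq> set as \<and> ?PA R2 A'. \<Sum>B' | B' \<subseteq> set bs \<and> ?PB R3 B'.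
        ?V * (term_sign R1 R2 R3 * w1 A' * w2 B' * sum_term R1 R2 R3 A' B'))"
      if idx: "(R1, R2, R3) \<in> index_triples d m n ma nb" for R1 R2 R3
    proof -
      have T: "(R1, R2, R3) \<in> tripartitions {1..L}" using idx sub by blast
      have inner: "(\<Sum>B' | B' \<subseteq> set bs. split_term R1 R2 R3 A' B') =
          (\<Sum>B' | B' \<subseteq> set bs \<and> ?PB R3 B'. ?V * (term_sign R1 R2 R3 * w1 A' * w2 B' * sum_term R1 R2 R3 A' B'))"
        if A': "A' \<subseteq> set as" "?PA R2 A'" for A'
        by (rule sum.mono_neutral_cong_right) (use zero[OF T A'(1)] val[OF T A'(1) _ idx A'(2)] in auto)
      show ?thesis
      proof (rule sum.mono_neutral_cong_right)
        show "\<forall>A'\<in>{A'. A' \<subseteq> set as} - {A'. A' \<subseteq> set as \<and> ?PA R2 A'}. (\<Sum>B' | B' \<subseteq> set bs. split_term R1 R2 R3 A' B') = 0"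
          by (auto intro!: sum.neutral zero[OF T])
      qed (use inner in auto)
    qed
    then show ?thesis by (intro sum.cong refl) (auto split: prod.split)
  qed
  also have "\<dots> = ?V * ?S"
    by (simp only: sum_distrib_left case_prod_unfold)
  finally show ?thesis using vandermonde_nonzero by simp
qed

end

section \<open>Specialization\<close>

lemma (in comm_ring_hom) hom_sres_val:
  assumes "2 * d < m + n"
  shows "hom (sres_val d m n f g x) = sres_val d m n (map_poly hom f) (map_poly hom g) (hom x)"
proof -
  let ?ps = "\<lambda>f g. sylvester_basis (n - d) (m - d) f g"
  have l: "?ps (map_poly hom f) (map_poly hom g) = map (map_poly hom) (?ps f g)"
    by (simp add: sylvester_basis_def map_poly_hom_mult o_def)
  let ?us = "map (\<lambda>c i. coeff (?ps f g ! i) (m + n - d - 1 - c)) [0..<m + n - 2 * d - 1] @ [\<lambda>i. poly (?ps f g ! i) x]"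
  have len: "length ?us \<le> length (?ps f g)" using assms by simp
  show ?thesis
    unfolding sres_val_def Let_def l hom_coldet
  proof (rule coldet_cong)
    fix i j assume "i < length (map (\<lambda>u i. hom (u i)) ?us)" "j < length (map (\<lambda>u i. hom (u i)) ?us)"
    then have "i < length (?ps f g)" and "j \<le> m + n - 2 * d - 1" using len by auto
    then show "(map (\<lambda>u i. hom (u i)) ?us ! j) i =
      ((map (\<lambda>c i. coeff (map (map_poly hom) (?ps f g) ! i) (m + n - d - 1 - c)) [0..<m + n - 2 * d - 1] @
        [\<lambda>i. poly (map (map_poly hom) (?ps f g) ! i) (hom x)]) ! j) i"
      by (cases "j < m + n - 2 * d - 1") (auto simp: nth_append)
  qed simp
qed

lemma poly_lifted_at_x:
  "poly (map_poly (\<lambda>c. [:c:]) p) [:0, 1:] = (p :: 'a::comm_ring_1 poly)"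
proof (induction p)
  case (pCons a p)
  have "map_poly (\<lambda>c. [:c:]) (pCons a p) = pCons [:a:] (map_poly (\<lambda>c. [:c:]) p)"
    using pCons(1) by (intro map_poly_pCons) auto
  then show ?case using pCons by simp
qed simp

lemma comm_ring_hom_const: "comm_ring_hom (\<lambda>c :: 'a::comm_ring_1. [:c:])"
  by unfold_locales (auto simp: one_pCons)

text \<open>
  The last column of the subresultant matrix holds polynomials in \<open>x\<close>, so the coefficients are
  lifted to constants of the polynomial ring and the polynomials evaluated at \<open>x\<close> there.
\<close>

lemma subresultant_eq_sres_val:
  fixes f g :: "'a::comm_ring_1 poly"
  assumes "degree f = m" "degree g = n" "d \<le> m" "d \<le> n" "2 * d < m + n"
  shows "subresultant d f g = sres_val d m n (map_poly (\<lambda>c. [:c:]) f) (map_poly (\<lambda>c. [:c:]) g) [:0, 1:]"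
proof -
  let ?F = "map_poly (\<lambda>c. [:c:]) f" and ?G = "map_poly (\<lambda>c. [:c:]) g"
  let ?ps = "sylvester_basis (n - d) (m - d) ?F ?G"
  let ?us = "map (\<lambda>c i. coeff (?ps ! i) (m + n - d - 1 - c)) [0..<m + n - 2 * d - 1] @ [\<lambda>i. poly (?ps ! i) [:0, 1:]]"
  let ?N = "(m - d) + (n - d)"
  have N: "m + n - 2 * d - 1 = ?N - 1" "?N \<ge> 1" using assms by linarith+
  have "length ?us = m + n - 2 * d - 1 + 1" by simp
  then have len: "length ?us = ?N" using N by linarith
  have co: "coeff (map_poly (\<lambda>c. [:c:]) p) i = [:coeff p i:]" for p :: "'a poly" and i
    by (rule coeff_map_poly) simp
  have key: "coeff (monom 1 (e - 1 - i) * map_poly (\<lambda>c. [:c:]) p) (q + e - 1 - j) = [:coeff_int p (int q + int i - int j):]"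
    if "i < e" "j < q + e" for p :: "'a poly" and e i q j :: nat
  proof (cases "q + i < j")
    case True
    then show ?thesis using that by (simp add: coeff_monom_mult coeff_int_def)
  next
    case False
    then have "q + e - 1 - j - (e - 1 - i) = nat (int q + int i - int j)" "\<not> q + e - 1 - j < e - 1 - i"
      "\<not> int q + int i - int j < 0"
      using that by linarith+
    then show ?thesis by (simp add: coeff_monom_mult coeff_int_def co)
  qed
  have ev: "poly (monom 1 e * map_poly (\<lambda>c. [:c:]) p) [:0, 1:] = monom 1 e * p" for e and p :: "'a poly"
    unfolding poly_mult poly_lifted_at_x by (simp add: poly_monom monom_altdef)
  let ?M = "mat ?N ?N (\<lambda>(i, j).
    if i < n - d then
      (if j = ?N - 1 then monom 1 (n - d - 1 - i) * f
       else [: coeff_int f (int m + int i - int j) :])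
    else let i' = i - (n - d) in
      (if j = ?N - 1 then monom 1 (m - d - 1 - i') * g
       else [: coeff_int g (int n + int i' - int j) :]))"
  have "mat ?N ?N (\<lambda>(i, j). (?us ! j) i) = ?M"
  proof (rule eq_matI)
    fix i j assume "i < dim_row ?M" "j < dim_col ?M"
    then have i: "i < ?N" and j: "j < ?N" by auto
    have us: "(?us ! j) i = (if j = ?N - 1 then poly (?ps ! i) [:0, 1:] else coeff (?ps ! i) (m + n - d - 1 - j))"
    proof (cases "j = ?N - 1")
      case False
      then have "j < ?N - 1" using j by linarith
      then show ?thesis using False unfolding N(1) by (simp add: nth_append)
    next
      case True
      then show ?thesis unfolding N(1) by (simp add: nth_append)
    qed
    show "mat ?N ?N (\<lambda>(i, j). (?us ! j) i) $$ (i, j) = ?M $$ (i, j)"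
    proof (cases "i < n - d")
      case True
      have e: "m + (n - d) - 1 - j = m + n - d - 1 - j" using assms by simp
      have "j < m + (n - d)" using j by linarith
      from key[OF True this, of f] have "coeff (?ps ! i) (m + n - d - 1 - j) = [:coeff_int f (int m + int i - int j):]"
        unfolding e sylvester_basis_nth1[OF True] .
      moreover have "poly (?ps ! i) [:0, 1:] = monom 1 (n - d - 1 - i) * f"
        unfolding sylvester_basis_nth1[OF True] by (rule ev)
      ultimately show ?thesis unfolding index_mat(1)[OF i j] split us using True by (simp only: if_True)
    next
      case False
      let ?i = "i - (n - d)"
      have i': "n - d + ?i = i" "?i < m - d" using False i by auto
      have e: "n + (m - d) - 1 - j = m + n - d - 1 - j" using assms by simp
      have ps: "?ps ! i = monom 1 (m - d - 1 - ?i) * ?G"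
        using sylvester_basis_nth2[OF i'(2), of "n - d" ?F ?G] unfolding i'(1) .
      have "j < n + (m - d)" using j by linarith
      from key[OF i'(2) this, of g] have "coeff (?ps ! i) (m + n - d - 1 - j) = [:coeff_int g (int n + int ?i - int j):]"
        unfolding e ps .
      moreover have "poly (?ps ! i) [:0, 1:] = monom 1 (m - d - 1 - ?i) * g"
        unfolding ps by (rule ev)
      ultimately show ?thesis unfolding index_mat(1)[OF i j] split us Let_def using False by (simp only: if_False)
    qed
  qed auto
  then have "det ?M = coldet ?us" unfolding coldet_def len by simp
  moreover have "subresultant d f g = det ?M"
    using subresultant_row_form[of d f g] unfolding assms(1,2) .
  ultimately show ?thesis by (simp add: sres_val_def Let_def)
qed

lemma power_int_minus_one_field: "(-1 :: 'a::field) powi e = (if even e then 1 else -1)"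
  by (simp add: power_int_def minus_one_power_iff even_nat_iff)

lemma poly_signed_of_int:
  "poly ((if P then 1 else - 1) * of_int z :: 'a::comm_ring_1 poly poly) 0 = [:(if P then 1 else - 1) * of_int z:]"
  by (cases P) (simp_all add: of_int_poly)

theorem theorem1p5:
  fixes f g :: "'a::field poly" and A B :: "'a multiset" and Abar Bbar :: "'a set"
    and m n d :: nat
  assumes "lead_coeff f = 1" and "degree f = m"
    and "lead_coeff g = 1" and "degree g = n"
    and "f = (\<Prod>a\<in>#A. [:- a, 1:])" and "g = (\<Prod>b\<in>#B. [:- b, 1:])"
    and "Abar \<subseteq> set_mset A" and "Bbar \<subseteq> set_mset B"
    and "m \<noteq> n \<and> d \<le> min m n \<or> m = n \<and> d < m"
  shows "subresultant d f g = smult ((-1) ^ (d * (m - d))) (SylM d A Abar B Bbar)"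
proof -
  have f: "f = root_poly A" and g: "g = root_poly B" using assms by (simp_all add: root_poly_def)
  have m: "size A = m" and n: "size B = n"
    using root_poly_monic(1)[of A] root_poly_monic(1)[of B] assms f g by simp_all
  have dm: "d \<le> m" and dn: "d \<le> n" and dmn: "2 * d < m + n" using assms(9) by linarith+
  have fin: "finite Abar" "finite Bbar" using assms(7,8) finite_subset by blast+
  have subA: "mset_set Abar \<subseteq># A" and subB: "mset_set Bbar \<subseteq># B"
    using assms(7,8) fin by (auto simp: subseteq_mset_def count_mset_set' Suc_le_eq)
  obtain as where as: "set as = Abar" "distinct as" using finite_distinct_list[OF fin(1)] by blast
  obtain bs where bs: "set bs = Bbar" "distinct bs" using finite_distinct_list[OF fin(2)] by blast
  have la: "length as = card Abar" and lb: "length bs = card Bbar" using as bs distinct_card by fastforce+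
  have msa: "mset as = mset_set Abar" and msb: "mset bs = mset_set Bbar"
    using as bs by (metis mset_set_set)+
  define A1 where "A1 = A - mset_set Abar" define B1 where "B1 = B - mset_set Bbar"
  have A1: "mset_set Abar + A1 = A" and B1: "mset_set Bbar + B1 = B"
    using subA subB by (simp_all add: A1_def B1_def subset_mset.add_diff_inverse)
  have sA1: "size A1 = m - card Abar" and sB1: "size B1 = n - card Bbar"
    using size_Diff_submset[OF subA] size_Diff_submset[OF subB] m n by (simp_all add: A1_def B1_def)
  have cm: "card Abar \<le> m" and cn: "card Bbar \<le> n"
    using size_mset_mono[OF subA] size_mset_mono[OF subB] m n by simp_all
  define al where "al = (\<lambda>a :: 'a. [:[:a:]:])"
  \<comment> \<open>The root \<open>b + s\<close>, where \<open>s\<close> is the outer indeterminate of \<open>K[x][s]\<close>.\<close>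
  define be where "be = (\<lambda>b :: 'a. [:[:b:], 1:])"
  define xx where "xx = [:[:0, 1 :: 'a:]:]"
  interpret S: sylvester_data as bs al be "image_mset al A1" "image_mset be B1" d xx
  proof
    show "d \<le> size (image_mset al A1) + length as" "d \<le> size (image_mset be B1) + length bs"
      "2 * d < size (image_mset al A1) + length as + (size (image_mset be B1) + length bs)"
      using la lb sA1 sB1 cm cn dm dn dmn by simp_all
  qed (use as bs in \<open>auto simp: al_def be_def inj_on_def\<close>)
  have Sm: "size (image_mset al A1) + length as = m" and Sn: "size (image_mset be B1) + length bs = n"
    using la lb sA1 sB1 cm cn by simp_all
  have "m - card Abar + length as = m" "n - card Bbar + length bs = n"
    "m - card Abar + card Abar = m" "n - card Bbar + card Bbar = n"
    using la lb cm cn by simp_all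
  note sizes = Sm Sn this
  have SA: "S.A = image_mset al A" and SB: "S.B = image_mset be B"
    unfolding S.A_def S.B_def msa msb image_mset_union[symmetric] A1 B1 by (rule refl)+
  let ?c = "\<lambda>a :: 'a. [:a:]"
  have c: "comm_ring_hom ?c" by (rule comm_ring_hom_const)
  \<comment> \<open>Specialization at \<open>s = 0\<close>.\<close>
  let ?h = "\<lambda>p :: 'a poly poly. poly p 0"
  have h: "comm_ring_hom ?h" by (rule comm_ring_hom_poly)
  have hal: "image_mset ?h (image_mset al X) = image_mset ?c X" for X
    by (simp add: image_mset.compositionality o_def al_def)
  have hbe: "image_mset ?h (image_mset be X) = image_mset ?c X" for X
    by (simp add: image_mset.compositionality o_def be_def)
  have hx: "?h xx = [:0, 1:]" by (simp add: xx_def)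
  note c_dp = comm_ring_hom.hom_diff_prod[OF c, symmetric]
  note h_dp = comm_ring_hom.hom_diff_prod[OF h]
  define q where "q Y S = diff_prod (mset_set S) (mset_set (Y - S))" for Y S :: "'a set"
  have qnz: "q Y S \<noteq> 0" if "S \<subseteq> Y" "finite Y" for Y S
    using that finite_subset[OF that] by (auto simp: q_def diff_prod_def prod_mset_zero_iff)
  have dp_al: "diff_prod (image_mset al X) (image_mset al Y) = [:[:diff_prod X Y:]:]" for X Y
  proof -
    have "comm_ring_hom al" unfolding al_def by unfold_locales simp_all
    from comm_ring_hom.hom_diff_prod[OF this, of X Y] show ?thesis by (simp add: al_def)
  qed
  have dp_be: "diff_prod (image_mset be X) (image_mset be Y) = [:[:diff_prod X Y:]:]" for X Y
  proof -
    have "be a - be b = al a - al b" for a b by (simp add: al_def be_def)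
    then have "diff_prod (image_mset be X) (image_mset be Y) = diff_prod (image_mset al X) (image_mset al Y)"
      by (simp add: diff_prod_def image_mset.compositionality o_def)
    then show ?thesis by (simp only: dp_al)
  qed
  \<comment> \<open>The inverses of the denominators are constants of \<open>K[x][s]\<close>.\<close>
  define w where "w Y S = [:[:inverse (q Y S):]:]" for Y S :: "'a set"
  have w1: "w Abar S * diff_prod (image_mset al (mset_set S)) (image_mset al (mset_set (set as - S))) = 1"
    if "S \<subseteq> set as" for S
    using qnz[of S Abar] that fin unfolding dp_al as by (simp add: w_def q_def)
  have w2: "w Bbar S * diff_prod (image_mset be (mset_set S)) (image_mset be (mset_set (set bs - S))) = 1"
    if "S \<subseteq> set bs" for S
    using qnz[of S Bbar] that fin unfolding dp_be bs by (simp add: w_def q_def)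
  let ?PA = "\<lambda>R2 A'. int (card A') = int (card R2) + int d - int (m - card Abar)"
  let ?PB = "\<lambda>R3 B'. int (card B') = int (card R3) + min (int (m - card Abar)) (int d - int (n - card Bbar))"
  let ?I = "index_triples d m n (card Abar) (card Bbar)"
  have E1: "subresultant d f g = sres_val d m n (map_poly ?c (root_poly A)) (map_poly ?c (root_poly B)) [:0, 1:]"
    unfolding f[symmetric] g[symmetric] using assms dm dn dmn by (intro subresultant_eq_sres_val)
  have E2: "sres_val d m n (map_poly ?c (root_poly A)) (map_poly ?c (root_poly B)) [:0, 1:] =
      ?h (sres_val d m n (root_poly S.A) (root_poly S.B) xx)"
    unfolding comm_ring_hom.hom_sres_val[OF h dmn] comm_ring_hom.hom_root_poly[OF h] comm_ring_hom.hom_root_poly[OF c]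
      SA SB hal hbe hx ..
  have E3: "sres_val d m n (root_poly S.A) (root_poly S.B) xx = (\<Sum>(R1, R2, R3)\<in>?I.
      \<Sum>A' | A' \<subseteq> Abar \<and> ?PA R2 A'. \<Sum>B' | B' \<subseteq> Bbar \<and> ?PB R3 B'.
       S.term_sign R1 R2 R3 * w Abar A' * w Bbar B' * S.sum_term R1 R2 R3 A' B')"
    using S.sres_val_eq_sum[OF w1 w2] unfolding sizes la lb as bs size_image_mset sA1 sB1 .
  have E4: "?h (\<Sum>(R1, R2, R3)\<in>?I.
      \<Sum>A' | A' \<subseteq> Abar \<and> ?PA R2 A'. \<Sum>B' | B' \<subseteq> Bbar \<and> ?PB R3 B'.
       S.term_sign R1 R2 R3 * w Abar A' * w Bbar B' * S.sum_term R1 R2 R3 A' B') = (\<Sum>(R1, R2, R3)\<in>?I.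
      \<Sum>A' | A' \<subseteq> Abar \<and> ?PA R2 A'. \<Sum>B' | B' \<subseteq> Bbar \<and> ?PB R3 B'.
       ?h (S.term_sign R1 R2 R3 * w Abar A' * w Bbar B' * S.sum_term R1 R2 R3 A' B'))"
    by (simp add: poly_sum case_prod_unfold del: poly_mult)
  have E5: "(\<Sum>(R1, R2, R3)\<in>?I.
      \<Sum>A' | A' \<subseteq> Abar \<and> ?PA R2 A'. \<Sum>B' | B' \<subseteq> Bbar \<and> ?PB R3 B'.
       ?h (S.term_sign R1 R2 R3 * w Abar A' * w Bbar B' * S.sum_term R1 R2 R3 A' B')) =
    smult ((-1) ^ (d * (m - d))) (SylM d A Abar B Bbar)"
  proof -
    have "?h (S.term_sign R1 R2 R3 * w Abar A' * w Bbar B' * S.sum_term R1 R2 R3 A' B') =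
       smult ((-1) ^ (d * (m - d))) (smult ((-1) ^ ((m - card Abar) * (m - d)))
        (smult
          (sigma_sign d m n (card Abar) (card Bbar) R1 R2 R3 *
           (diff_prod (A - mset_set Abar) (mset_set (Bbar - B')) *
            diff_prod (mset_set (Abar - A')) (B - mset_set B')) /
           (diff_prod (mset_set A') (mset_set (Abar - A')) *
            diff_prod (mset_set B') (mset_set (Bbar - B'))))
          (diff_prod x_mset (const_mset (mset_set A')) *
           diff_prod x_mset (const_mset (mset_set B')) *
           schur_factors d A Abar B Bbar R1 R2 R3 A' B')))"
      if idx: "(R1, R2, R3) \<in> ?I" and A': "A' \<subseteq> Abar" "?PA R2 A'" and B': "B' \<subseteq> Bbar" "?PB R3 B'"
      for R1 R2 R3 A' B'
    proof -
      let ?e = "sigma_exponent d m n (card Abar) (card Bbar) R1 R2 R3"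
      let ?sg = "(if even (?e + int (d * (m - d) + (m - card Abar) * (m - d))) then 1 else -1) *
        of_int (sign (listing_perm R1 R2 R3)) :: 'a"
      have ts: "?h (S.term_sign R1 R2 R3) = [:?sg:]"
        unfolding S.term_sign_def sizes la lb size_image_mset sA1 sB1
        by (rule poly_signed_of_int)
      have sg: "?sg = (-1) ^ (d * (m - d)) * (-1) ^ ((m - card Abar) * (m - d)) *
          sigma_sign d m n (card Abar) (card Bbar) R1 R2 R3"
        unfolding sigma_sign_def power_int_minus_one_field power_add[symmetric] minus_one_power_iff
        by (auto simp del: of_nat_add of_nat_mult)
      have hw: "?h (w Y S) = [:inverse (q Y S):]" for Y S by (simp add: w_def)
      have B2: "mset_set (Bbar - B') + B1 = B - mset_set B'"
      proof -
        have "mset_set (Bbar - B') = mset_set Bbar - mset_set B'"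
          using mset_set_Diff[OF fin(2) B'(1)] .
        moreover have "mset_set B' \<subseteq># mset_set Bbar" using fin B' by (simp add: finite_subset subset_imp_msubset_mset_set)
        ultimately show ?thesis unfolding B1[symmetric] by (simp add: subset_mset.add_diff_assoc2)
      qed
      have dp1: "?h (diff_prod (image_mset al A1) (image_mset be (mset_set (Bbar - B')))) =
          [:diff_prod A1 (mset_set (Bbar - B')):]"
        unfolding h_dp hal hbe c_dp ..
      have dp2: "?h (diff_prod (image_mset al (mset_set (Abar - A'))) (image_mset be (mset_set (Bbar - B')) + image_mset be B1)) =
          [:diff_prod (mset_set (Abar - A')) (B - mset_set B'):]"
        unfolding image_mset_union[symmetric] h_dp hal hbe c_dp B2 ..
      have dp3: "?h (diff_prod {#xx#} (image_mset al (mset_set A'))) = diff_prod x_mset (const_mset (mset_set A'))"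
        "?h (diff_prod {#xx#} (image_mset be (mset_set B'))) = diff_prod x_mset (const_mset (mset_set B'))"
        unfolding h_dp hal hbe by (simp_all add: hx)
      have sf: "?h (S.schur_product R1 R2 R3 A' B') = schur_factors d A Abar B Bbar R1 R2 R3 A' B'"
      proof (cases "m - card Abar + (n - card Bbar) \<le> d")
        case True
        then show ?thesis
          unfolding S.schur_product_def schur_factors_def Let_def m n sizes size_image_mset sA1 sB1 by simp
      next
        case False
        have T: "(R1, R2, R3) \<in> tripartitions {1..S.L}"
          using idx unfolding S.L_def size_image_mset sA1 sB1
          by (auto simp: index_triples_def tripartitions_def Let_def)
        have L: "S.L > 0" using False unfolding S.L_def size_image_mset sA1 sB1 by simp
        have good: "card R3 + (card Bbar - card B') = S.t" "card R2 + (card Abar - card A') = S.k"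
          "card R1 + card A' + card B' = d" "R1 \<subseteq> {m + n - 2 * d..}"
          using S.index_conditions[OF T, of A' B'] A' B' idx
          unfolding sizes la lb as bs size_image_mset sA1 sB1 by blast+
        note dims = S.dims(4)[unfolded Sm] S.dims_pos(1)[OF L, unfolded Sn]
        note R = S.sum_card_tripartition[OF T]
        have LN: "S.L \<le> m + n - d"
          unfolding S.L_def size_image_mset sA1 sB1 by linarith
        have R23: "R2 \<subseteq> {1..m + n - d}" "R3 \<subseteq> {1..m + n - d}" using R LN by auto
        have cA: "card (Abar - A') = card Abar - card A'" "card (Bbar - B') = card Bbar - card B'"
          using card_Diff_subset A' B' fin finite_subset by metis+
        have cAle: "card A' \<le> card Abar" "card B' \<le> card Bbar" using A' B' fin card_mono by blast+
        have s2: "?h (schur (m + n - d) R2 (image_mset al (mset_set (Abar - A')) + image_mset be B)) =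
            [:schur (m + n - d) R2 (mset_set (Abar - A') + B):]"
        proof -
          have "card R2 + size (mset_set (Abar - A') + B) = m + n - d"
            using good dims n dm cA by simp
          then show ?thesis
            using hom_schur[OF h R23(1), of "image_mset al (mset_set (Abar - A')) + image_mset be B"]
              hom_schur[OF c R23(1), of "mset_set (Abar - A') + B"]
            by (simp add: hal hbe)
        qed
        have s3: "?h (schur (m + n - d) R3 (image_mset al A + image_mset be (mset_set (Bbar - B')))) =
            [:schur (m + n - d) R3 (A + mset_set (Bbar - B')):]"
        proof -
          have "card R3 + size (A + mset_set (Bbar - B')) = m + n - d"
            using good dims m dn cA by simp
          then show ?thesis
            using hom_schur[OF h R23(2), of "image_mset al A + image_mset be (mset_set (Bbar - B'))"]
              hom_schur[OF c R23(2), of "A + mset_set (Bbar - B')"]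
            by (simp add: hal hbe)
        qed
        let ?R = "(\<lambda>i. i - (m + n - 2 * d - 1)) ` R1"
        have s1: "?h (schur (d + 1) ?R (image_mset al (mset_set A') + image_mset be (mset_set B') + {#xx#})) =
            schur (d + 1) ?R (const_mset (mset_set A') + const_mset (mset_set B') + x_mset)"
        proof -
          have lt: "m + n - 2 * d \<le> r" "r \<le> S.L" if "r \<in> R1" for r using good(4) R(2) that by auto
          have "S.L + d \<le> m + n" unfolding S.L_def size_image_mset sA1 sB1 using dm by linarith
          then have "r - (m + n - 2 * d - 1) \<in> {1..d + 1}" if "r \<in> R1" for r
            using lt[OF that] dmn unfolding atLeastAtMost_iff by linarith
          then have sub: "?R \<subseteq> {1..d + 1}" by blast
          have "inj_on (\<lambda>i. i - (m + n - 2 * d - 1)) R1"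
            by (rule inj_onI) (use lt(1) dmn in \<open>metis (no_types, lifting) diff_le_self eq_diff_iff le_trans\<close>)
          then have "card ?R + size (image_mset al (mset_set A') + image_mset be (mset_set B') + {#xx#}) = d + 1"
            using good(3) by (simp add: card_image)
          from hom_schur[OF h sub this] show ?thesis by (simp add: hal hbe hx)
        qed
        show ?thesis
          using False s1
          unfolding S.schur_product_def schur_factors_def Let_def m n sizes size_image_mset sA1 sB1 as bs SA SB
          by (simp add: s2 s3 mult.commute)
      qed
      have "?h (S.term_sign R1 R2 R3 * w Abar A' * w Bbar B' * S.sum_term R1 R2 R3 A' B') =
        [:?sg:] * [:inverse (q Abar A'):] * [:inverse (q Bbar B'):] *
        ([:diff_prod A1 (mset_set (Bbar - B')):] * [:diff_prod (mset_set (Abar - A')) (B - mset_set B'):] *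
         (diff_prod x_mset (const_mset (mset_set A')) * diff_prod x_mset (const_mset (mset_set B')) *
          schur_factors d A Abar B Bbar R1 R2 R3 A' B'))"
        unfolding S.sum_term_def poly_mult as bs ts hw dp1 dp2 dp3 sf ..
      also have "\<dots> = smult (?sg * inverse (q Abar A') * inverse (q Bbar B') *
          (diff_prod A1 (mset_set (Bbar - B')) * diff_prod (mset_set (Abar - A')) (B - mset_set B')))
        (diff_prod x_mset (const_mset (mset_set A')) * diff_prod x_mset (const_mset (mset_set B')) *
          schur_factors d A Abar B Bbar R1 R2 R3 A' B')"
        by (simp only: mult_pCons_left mult_zero_left pCons_0_0 add_0_right smult_smult mult.assoc mult_smult_left)
      finally show ?thesis
        unfolding sg A1_def q_def by (simp add: divide_inverse mult_ac)
    qed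
    then show ?thesis
      unfolding SylM_def Let_def m n smult_sum2 case_prod_unfold
      by (intro sum.cong refl) (auto simp: case_prod_unfold)
  qed
  show ?thesis unfolding E1 E2 E3 E4 by (rule E5)
qed

end
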